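(* Let $[a,b]\subset\mathbb{R}$ be a compact interval, let $n\geq 0$ and $m\geq 1$ be integers, let $\alpha\in[0,1]$ and $\varepsilon_0>0$. For every $\varepsilon\in[0,\varepsilon_0)$ let $A(\cdot,\varepsilon)\in C^{n,\alpha}([a,b],\mathbb{C}^{m\times m})$ and let $B(\varepsilon):C^{n+1,\alpha}([a,b],\mathbb{C}^{m})\to\mathbb{C}^{m}$ be an arbitrary continuous linear operator. Consider the family of boundary-value problems $$L(\varepsilon)y(t,\varepsilon)\equiv y'(t,\varepsilon)+A(t,\varepsilon)y(t,\varepsilon)=f(t,\varepsilon),\quad a\leq t\leq b,\qquad B(\varepsilon)y(\cdot,\varepsilon)=q(\varepsilon),$$ for the unknown $y(\cdot,\varepsilon)\in C^{n+1,\alpha}([a,b],\mathbb{C}^{m})$, with right-hand sides $f(\cdot,\varepsilon)\in C^{n,\alpha}([a,b],\mathbb{C}^{m})$ and $q(\varepsilon)\in\mathbb{C}^{m}$. Then the solution to this boundary-value problem is continuous in the parameter $\varepsilon$ at $\varepsilon=0$ (in the sense defined in the context) if and only if the following three conditions hold: (0) the limiting homogeneous problem $L(0)y=0$ on $[a,b]$, $B(0)y=0$ has only the trivial solution $y=0$ in $C^{n+1,\alpha}([a,b],\mathbb{C}^{m})$; (I) $A(\cdot,\varepsilon)\to A(\cdot,0)$ in $C^{n,\alpha}([a,b],\mathbb{C}^{m\times m})$ as $\varepsilon\to0+$; (II) $B(\varepsilon)y\to B(0)y$ in $\mathbb{C}^{m}$ as $\varepsilon\to0+$ for every $y\in C^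{n+1,\alpha}([a,b],\mathbb{C}^{m})$.
   Context: Function spaces. For an integer $l\geq0$, $C^{(l)}=C^{(l)}([a,b],\mathbb{C})$ is the Banach space of $l$ times continuously differentiable functions $x:[a,b]\to\mathbb{C}$ with norm $\|x\|_{l}=\sum_{j=0}^{l}\max_{t\in[a,b]}|x^{(j)}(t)|$. For $0<\alpha\leq1$, $C^{l,\alpha}=C^{l,\alpha}([a,b],\mathbb{C})$ is the Banach space of all $x\in C^{(l)}$ with $$\|x^{(l)}\|'_{\alpha}:=\sup\Bigl\{\frac{|x^{(l)}(t_2)-x^{(l)}(t_1)|}{|t_2-t_1|^{\alpha}}: t_1,t_2\in[a,b],\ t_1\neq t_2\Bigr\}<\infty,$$ with norm $\|x\|_{l,\alpha}=\|x\|_{l}+\|x^{(l)}\|'_{\alpha}$; and $C^{l,0}:=C^{(l)}$, $\|\cdot\|_{l,0}:=\|\cdot\|_{l}$. The spaces $C^{l,\alpha}([a,b],\mathbb{C}^{m})$ and $C^{l,\alpha}([a,b],\mathbb{C}^{m\times m})$ consist of the vector- and matrix-valued functions all of whose components lie in $C^{l,\alpha}$, normed by the sum of the $C^{l,\alpha}$-norms of the components. Vectors are columns. Definition (continuity in the parameter). With the families $A(\cdot,\varepsilon)$ and $B(\varepsilon)$ given, the solution to the boundary-value problem is called continuous in the parameter $\varepsilon$ at $\varepsilon=0$ if the following two conditions hold: ($\ast$) there exists a positive number $\varepsilon_1<\varepsilon_0$ such that for arbitrary $\varepsilon\in[0,\varepsilon_1)$, $f(\cdot,\varepsilon)\in C^{n,\alpha}([a,b],\mathbb{C}^{m})$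 and $q(\varepsilon)\in\mathbb{C}^{m}$ the problem has a unique solution $y(\cdot,\varepsilon)\in C^{n+1,\alpha}([a,b],\mathbb{C}^{m})$; ($\ast\ast$) for all families of right-hand sides $f(\cdot,\varepsilon)$, $q(\varepsilon)$ such that $f(\cdot,\varepsilon)\to f(\cdot,0)$ in $C^{n,\alpha}([a,b],\mathbb{C}^{m})$ and $q(\varepsilon)\to q(0)$ in $\mathbb{C}^{m}$ as $\varepsilon\to0+$, one has $y(\cdot,\varepsilon)\to y(\cdot,0)$ in $C^{n+1,\alpha}([a,b],\mathbb{C}^{m})$ as $\varepsilon\to0+$. *)

theory Defs
  imports "HOL-Analysis.Analysis"
begin

text \<open>
  Functions on \<open>[a,b]\<close> are represented by functions on \<open>real\<close> of which only the values on
  \<open>{a..b}\<close> matter. Derivatives are taken within \<open>{a..b}\<close>, hence they are one-sided at the end points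
  and for \<open>a < b\<close> determined by the values on \<open>{a..b}\<close>. Equality of functions on \<open>[a,b]\<close> is
  therefore equality at all points of \<open>{a..b}\<close>.
\<close>

definition iter_deriv :: "real \<Rightarrow> real \<Rightarrow> nat \<Rightarrow> (real \<Rightarrow> complex) \<Rightarrow> real \<Rightarrow> complex" where
  "iter_deriv a b j x = ((\<lambda>g t. vector_derivative g (at t within {a..b})) ^^ j) x"

definition C_space :: "real \<Rightarrow> real \<Rightarrow> nat \<Rightarrow> (real \<Rightarrow> complex) set" where
  "C_space a b l =
    {x. (\<forall>j<l. iter_deriv a b j x differentiable_on {a..b}) \<and>
        continuous_on {a..b} (iter_deriv a b l x)}"

text \<open>For \<open>x \<in> C_space a b l\<close> the suprema below are attained.\<close>

definition C_norm :: "real \<Rightarrow> real \<Rightarrow> nat \<Rightarrow> (real \<Rightarrow> complex) \<Rightarrow> real" where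
  "C_norm a b l x = (\<Sum>j\<le>l. SUP t\<in>{a..b}. cmod (iter_deriv a b j x t))"

definition holder_quotients :: "real \<Rightarrow> real \<Rightarrow> real \<Rightarrow> (real \<Rightarrow> complex) \<Rightarrow> real set" where
  "holder_quotients a b \<alpha> g =
    {cmod (g t2 - g t1) / \<bar>t2 - t1\<bar> powr \<alpha> | t1 t2. t1 \<in> {a..b} \<and> t2 \<in> {a..b} \<and> t1 \<noteq> t2}"

definition holder_space :: "real \<Rightarrow> real \<Rightarrow> nat \<Rightarrow> real \<Rightarrow> (real \<Rightarrow> complex) set" where
  "holder_space a b l \<alpha> =
    (if \<alpha> = 0 then C_space a b l
     else {x \<in> C_space a b l. bdd_above (holder_quotients a b \<alpha> (iter_deriv a b l x))})"

definition holder_norm :: "real \<Rightarrow> real \<Rightarrow> nat \<Rightarrow> real \<Rightarrow> (real \<Rightarrow> complex) \<Rightarrow> real" where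
  "holder_norm a b l \<alpha> x =
    (if \<alpha> = 0 then C_norm a b l x
     else C_norm a b l x + Sup (holder_quotients a b \<alpha> (iter_deriv a b l x)))"

definition holder_space_vec ::
    "real \<Rightarrow> real \<Rightarrow> nat \<Rightarrow> real \<Rightarrow> (real \<Rightarrow> complex ^ 'm) set" where
  "holder_space_vec a b l \<alpha> = {y. \<forall>i. (\<lambda>t. y t $ i) \<in> holder_space a b l \<alpha>}"

definition holder_norm_vec ::
    "real \<Rightarrow> real \<Rightarrow> nat \<Rightarrow> real \<Rightarrow> (real \<Rightarrow> complex ^ 'm) \<Rightarrow> real" where
  "holder_norm_vec a b l \<alpha> y = (\<Sum>i\<in>UNIV. holder_norm a b l \<alpha> (\<lambda>t. y t $ i))"

definition holder_space_mat ::
    "real \<Rightarrow> real \<Rightarrow> nat \<Rightarrow> real \<Rightarrow> (real \<Rightarrow> complex ^ 'm ^ 'm) set" where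
  "holder_space_mat a b l \<alpha> = {M. \<forall>i j. (\<lambda>t. M t $ i $ j) \<in> holder_space a b l \<alpha>}"

definition holder_norm_mat ::
    "real \<Rightarrow> real \<Rightarrow> nat \<Rightarrow> real \<Rightarrow> (real \<Rightarrow> complex ^ 'm ^ 'm) \<Rightarrow> real" where
  "holder_norm_mat a b l \<alpha> M =
    (\<Sum>i\<in>UNIV. \<Sum>j\<in>UNIV. holder_norm a b l \<alpha> (\<lambda>t. M t $ i $ j))"

text \<open>
  Convergence as \<open>\<epsilon> \<rightarrow> 0+\<close> of a family of functions (first argument: \<open>\<epsilon>\<close>, second: \<open>t\<close>)
  to its member at \<open>\<epsilon> = 0\<close>.
\<close>

definition holder_convergent_vec ::
    "real \<Rightarrow> real \<Rightarrow> nat \<Rightarrow> real \<Rightarrow> (real \<Rightarrow> real \<Rightarrow> complex ^ 'm) \<Rightarrow> bool" where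
  "holder_convergent_vec a b l \<alpha> y \<longleftrightarrow>
    ((\<lambda>\<epsilon>. holder_norm_vec a b l \<alpha> (\<lambda>t. y \<epsilon> t - y 0 t)) \<longlongrightarrow> 0) (at_right 0)"

definition holder_convergent_mat ::
    "real \<Rightarrow> real \<Rightarrow> nat \<Rightarrow> real \<Rightarrow> (real \<Rightarrow> real \<Rightarrow> complex ^ 'm ^ 'm) \<Rightarrow> bool" where
  "holder_convergent_mat a b l \<alpha> M \<longleftrightarrow>
    ((\<lambda>\<epsilon>. holder_norm_mat a b l \<alpha> (\<lambda>t. M \<epsilon> t - M 0 t)) \<longlongrightarrow> 0) (at_right 0)"

text \<open>
  Continuous linear operators from the vector-valued space to \<open>complex ^ 'm\<close>. Continuity forces
  \<open>T x = T y\<close> whenever \<open>x\<close> and \<open>y\<close> agree on \<open>{a..b}\<close> (then \<open>y - x\<close> has norm \<open>0\<close>), so such a \<open>T\<close>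
  is an operator on functions on \<open>[a,b]\<close>.
\<close>

definition continuous_linear_operator ::
    "real \<Rightarrow> real \<Rightarrow> nat \<Rightarrow> real \<Rightarrow> ((real \<Rightarrow> complex ^ 'm) \<Rightarrow> complex ^ 'm) \<Rightarrow> bool" where
  "continuous_linear_operator a b l \<alpha> T \<longleftrightarrow>
    (\<forall>x\<in>holder_space_vec a b l \<alpha>. \<forall>y\<in>holder_space_vec a b l \<alpha>.
        T (\<lambda>t. x t + y t) = T x + T y) \<and>
    (\<forall>c. \<forall>x\<in>holder_space_vec a b l \<alpha>. T (\<lambda>t. c *s x t) = c *s T x) \<and>
    (\<forall>x\<in>holder_space_vec a b l \<alpha>. \<forall>e>0. \<exists>d>0. \<forall>y\<in>holder_space_vec a b l \<alpha>.
        holder_norm_vec a b l \<alpha> (\<lambda>t. y t - x t) < d \<longrightarrow> norm (T y - T x) < e)"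

definition L_op ::
    "real \<Rightarrow> real \<Rightarrow> (real \<Rightarrow> complex ^ 'm ^ 'm) \<Rightarrow> (real \<Rightarrow> complex ^ 'm) \<Rightarrow> real \<Rightarrow> complex ^ 'm" where
  "L_op a b M y t = vector_derivative y (at t within {a..b}) + M t *v y t"

definition bvp_solution ::
    "real \<Rightarrow> real \<Rightarrow> nat \<Rightarrow> real \<Rightarrow> (real \<Rightarrow> complex ^ 'm ^ 'm) \<Rightarrow>
      ((real \<Rightarrow> complex ^ 'm) \<Rightarrow> complex ^ 'm) \<Rightarrow> (real \<Rightarrow> complex ^ 'm) \<Rightarrow> complex ^ 'm \<Rightarrow>
      (real \<Rightarrow> complex ^ 'm) \<Rightarrow> bool" where
  "bvp_solution a b n \<alpha> M T g p y \<longleftrightarrow>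
    y \<in> holder_space_vec a b (n + 1) \<alpha> \<and> (\<forall>t\<in>{a..b}. L_op a b M y t = g t) \<and> T y = p"

definition uniquely_solvable ::
    "real \<Rightarrow> real \<Rightarrow> nat \<Rightarrow> real \<Rightarrow> (real \<Rightarrow> complex ^ 'm ^ 'm) \<Rightarrow>
      ((real \<Rightarrow> complex ^ 'm) \<Rightarrow> complex ^ 'm) \<Rightarrow> (real \<Rightarrow> complex ^ 'm) \<Rightarrow> complex ^ 'm \<Rightarrow> bool" where
  "uniquely_solvable a b n \<alpha> M T g p \<longleftrightarrow>
    (\<exists>y. bvp_solution a b n \<alpha> M T g p y \<and>
         (\<forall>z. bvp_solution a b n \<alpha> M T g p z \<longrightarrow> (\<forall>t\<in>{a..b}. z t = y t)))"

text \<open>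
  The solutions \<open>y \<epsilon>\<close> in the second condition are only defined for \<open>\<epsilon> < \<epsilon>1\<close>; this is why it
  stands in the scope of \<open>\<epsilon>1\<close>. As a condition on limits, it does not depend on the choice of \<open>\<epsilon>1\<close>.
\<close>

definition solution_continuous_in_parameter ::
    "real \<Rightarrow> real \<Rightarrow> nat \<Rightarrow> real \<Rightarrow> real \<Rightarrow> (real \<Rightarrow> real \<Rightarrow> complex ^ 'm ^ 'm) \<Rightarrow>
      (real \<Rightarrow> (real \<Rightarrow> complex ^ 'm) \<Rightarrow> complex ^ 'm) \<Rightarrow> bool" where
  "solution_continuous_in_parameter a b n \<alpha> \<epsilon>0 A B \<longleftrightarrow>
    (\<exists>\<epsilon>1. 0 < \<epsilon>1 \<and> \<epsilon>1 < \<epsilon>0 \<and>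
      (\<forall>\<epsilon>\<in>{0..<\<epsilon>1}. \<forall>g\<in>holder_space_vec a b n \<alpha>. \<forall>p.
          uniquely_solvable a b n \<alpha> (A \<epsilon>) (B \<epsilon>) g p) \<and>
      (\<forall>f q y.
          (\<forall>\<epsilon>\<in>{0..<\<epsilon>0}. f \<epsilon> \<in> holder_space_vec a b n \<alpha>) \<and>
          holder_convergent_vec a b n \<alpha> f \<and>
          (q \<longlongrightarrow> q 0) (at_right 0) \<and>
          (\<forall>\<epsilon>\<in>{0..<\<epsilon>1}. bvp_solution a b n \<alpha> (A \<epsilon>) (B \<epsilon>) (f \<epsilon>) (q \<epsilon>) (y \<epsilon>))
          \<longrightarrow> holder_convergent_vec a b (n + 1) \<alpha> y))"

end

theory Submission
  imports Defs
begin

text \<open>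
  Everything rests on an estimate for the Cauchy problem \<open>y' + A y = f\<close>, \<open>y a = c\<close>: its solution is
  bounded in \<open>C\<^sup>n\<^sup>+\<^sup>1\<close> with Hoelder exponent \<open>\<alpha>\<close> by \<open>c\<close> and the norm of \<open>f\<close> of order \<open>n\<close>, with a constant
  that depends only on a bound for \<open>A\<close> (\<open>ode_estimate\<close>). Gronwall's inequality bounds the values, and the
  equation itself then raises the regularity step by step. So these solutions depend continuously on
  \<open>\<epsilon>\<close> as soon as the coefficients do (\<open>ode_solutions_converge\<close>), and the boundary-value problem becomes
  a question about the linear map \<open>M \<epsilon>\<close> on \<open>complex ^ 'm\<close> that sends the initial value of a solution of the
  homogeneous equation to its boundary value.

  Suppose that (0), (I) and (II) hold. Then \<open>M 0\<close> is injective, and \<open>M \<epsilon>\<close> converges to \<open>M 0\<close> pointwise. Here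
  both the operator \<open>B \<epsilon>\<close> and the solution inserted into it vary; this is controlled by the
  Banach-Steinhaus theorem (\<open>uniform_boundedness_at_right\<close>), which turns the pointwise convergence (II) into
  a uniform bound. In finite dimension it follows that \<open>M \<epsilon>\<close> is bounded below uniformly for small \<open>\<epsilon>\<close>
  (\<open>eventually_bounded_below\<close>). So the problem is uniquely solvable, with an a priori estimate that is uniform
  in \<open>\<epsilon>\<close> (\<open>bvp_estimate\<close>); applied to the difference of the solutions for \<open>\<epsilon>\<close> and for \<open>0\<close> it yields
  convergence.

  Conversely, (0) is uniqueness for \<open>\<epsilon> = 0\<close>. For (I), consider the \<open>CARD('m)\<close> solutions of the homogeneous
  equations whose boundary values are, for every \<open>\<epsilon>\<close>, those of the fundamental system of the limiting
  equation. They converge to this system, so \<open>A \<epsilon> = - X' X\<^sup>-\<^sup>1\<close>, where \<open>X\<close> is the matrix with these columns,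
  converges too (\<open>coefficients_converge\<close>). For (II), subtract from a given \<open>y\<close> the solution \<open>z \<epsilon>\<close> of
  the same equation with boundary value \<open>0\<close>. What remains solves the homogeneous equation, has the
  boundary value \<open>B \<epsilon> y\<close> and a convergent initial value; and the map from boundary values to initial values
  is again a family of linear maps on \<open>complex ^ 'm\<close> with an injective limit (\<open>necessity\<close>).

  The norms are replaced by the predicate \<open>holder_le\<close>, which agrees with them up to constant factors and is
  defined by recursion on the order of differentiability.
\<close>

section \<open>Linear maps on finite-dimensional spaces\<close>

lemma bounded_linear_axis: "bounded_linear (axis i :: 'v::real_normed_vector \<Rightarrow> 'v ^ 'n)"
  and norm_axis_le: "norm (axis i v :: 'v ^ 'n) \<le> norm v"
proof -
  show le: "norm (axis i v :: 'v ^ 'n) \<le> norm v" for v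
  proof -
    have "norm (axis i v :: 'v ^ 'n) \<le> (\<Sum>j\<in>UNIV. norm ((axis i v :: 'v ^ 'n) $ j))"
      unfolding norm_vec_def by (rule L2_set_le_sum) simp
    also have "\<dots> = (\<Sum>j\<in>UNIV. if j = i then norm v else 0)"
      by (intro sum.cong) (auto simp: axis_def)
    finally show ?thesis by simp
  qed
  show "bounded_linear (axis i :: 'v \<Rightarrow> 'v ^ 'n)"
    using le by (intro bounded_linear_intro[where K = 1])
      (auto simp: axis_def vec_eq_iff)
qed

lemma bounded_bilinear_matrix_vector_mult:
  "bounded_bilinear ((*v) :: complex ^ 'm ^ 'm \<Rightarrow> complex ^ 'm \<Rightarrow> complex ^ 'm)"
  unfolding bilinear_conv_bounded_bilinear[symmetric] bilinear_def
  by (auto intro!: linearI simp: matrix_vector_mult_add_rdistrib matrix_vector_right_distrib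
      matrix_vector_mult_def vec_eq_iff scaleR_sum_right distrib_right sum.distrib)

lemma bounded_bilinear_matrix_matrix_mult:
  "bounded_bilinear ((**) :: complex ^ 'm ^ 'm \<Rightarrow> complex ^ 'm ^ 'm \<Rightarrow> complex ^ 'm ^ 'm)"
  unfolding bilinear_conv_bounded_bilinear[symmetric] bilinear_def
  by (auto intro!: linearI simp: matrix_add_ldistrib matrix_matrix_mult_def vec_eq_iff
      scaleR_sum_right distrib_right distrib_left sum.distrib)

lemma eventually_of_interval: "0 < \<delta> \<Longrightarrow> (\<And>\<epsilon>. \<epsilon> \<in> {0..<\<delta>} \<Longrightarrow> P \<epsilon>) \<Longrightarrow> \<forall>\<^sub>F \<epsilon> in at_right (0::real). P \<epsilon>"
  using eventually_at_right_real[of 0 \<delta>] by (auto elim!: eventually_mono)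

text \<open>
  In finite dimension, pointwise convergence of linear maps is convergence in the operator norm: it is
  enough to test it on a basis. An injective linear map is bounded below, and a perturbation by less
  than half of the lower bound leaves the other half.
\<close>

lemma eventually_bounded_below:
  fixes M :: "real \<Rightarrow> 'v::euclidean_space \<Rightarrow> 'v"
  assumes lin: "\<forall>\<^sub>F \<epsilon> in at_right 0. linear (M \<epsilon>)" and lin0: "linear (M 0)" and inj: "inj (M 0)"
    and lim: "\<And>v. ((\<lambda>\<epsilon>. M \<epsilon> v) \<longlongrightarrow> M 0 v) (at_right 0)"
  shows "\<exists>k>0. \<forall>\<^sub>F \<epsilon> in at_right 0. \<forall>v. k * norm v \<le> norm (M \<epsilon> v)"
proof -
  obtain k where k: "0 < k" "\<And>v. k * norm v \<le> norm (M 0 v)"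
    using linear_inj_bounded_below_pos[OF lin0 inj] by blast
  define d where "d = k / (2 * real DIM('v))"
  have d: "0 < d" using k(1) by (simp add: d_def)
  have "\<forall>\<^sub>F \<epsilon> in at_right 0. \<forall>i\<in>Basis. dist (M \<epsilon> i) (M 0 i) < d"
    by (intro eventually_ball_finite ballI tendstoD[OF lim d]) auto
  with lin have "\<forall>\<^sub>F \<epsilon> in at_right 0. \<forall>v. k / 2 * norm v \<le> norm (M \<epsilon> v)"
  proof eventually_elim
    case (elim \<epsilon>)
    show ?case
    proof
      fix v
      have lin_diff: "linear (\<lambda>v. M \<epsilon> v - M 0 v)"
        using elim(1) lin0 by (rule linear_compose_sub)
      have "M \<epsilon> v - M 0 v = M \<epsilon> (\<Sum>i\<in>Basis. (v \<bullet> i) *\<^sub>R i) - M 0 (\<Sum>i\<in>Basis. (v \<bullet> i) *\<^sub>R i)"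
        by (simp only: euclidean_representation)
      also have "\<dots> = (\<Sum>i\<in>Basis. (v \<bullet> i) *\<^sub>R (M \<epsilon> i - M 0 i))"
        by (simp only: linear_sum[OF lin_diff] linear_scale[OF lin_diff])
      finally have "norm (M \<epsilon> v - M 0 v) = norm (\<Sum>i\<in>Basis. (v \<bullet> i) *\<^sub>R (M \<epsilon> i - M 0 i))"
        by simp
      also have "\<dots> \<le> (\<Sum>i\<in>(Basis::'v set). norm v * d)"
        using elim(2) Basis_le_norm[of _ v]
        by (intro sum_norm_le) (simp add: dist_norm mult_mono less_imp_le)
      also have "\<dots> = k / 2 * norm v" by (simp add: d_def)
      finally have "norm (M \<epsilon> v - M 0 v) \<le> k / 2 * norm v" .
      moreover have "norm (M 0 v) \<le> norm (M \<epsilon> v) + norm (M \<epsilon> v - M 0 v)"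
        using norm_triangle_ineq4[of "M \<epsilon> v" "M \<epsilon> v - M 0 v"] by simp
      ultimately show "k / 2 * norm v \<le> norm (M \<epsilon> v)" using k(2)[of v] by simp
    qed
  qed
  moreover have "0 < k / 2" using k(1) by simp
  ultimately show ?thesis by blast
qed

section \<open>The scale of Hoelder spaces\<close>

locale holder_scale =
  fixes a b \<alpha> :: real
  assumes ab: "a < b" and alpha_nonneg: "0 \<le> \<alpha>" and alpha_le: "\<alpha> \<le> 1"

begin

text \<open>
  Up to constant factors, \<open>holder_le l K x\<close> says that \<open>x\<close> lies in the ball of radius \<open>K\<close> of \<open>C\<^sup>l\<close> with
  Hoelder exponent \<open>\<alpha>\<close>. All derivatives are measured by the same \<open>K\<close>, which keeps inductions on \<open>l\<close> free
  of sums of suprema, and the values lie in any normed space, which treats scalars, vectors and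
  matrices at once. The factor \<open>2\<close> makes the last condition of the first clause automatic for \<open>\<alpha> = 0\<close>,
  so that this clause covers both cases of the definition of the Hoelder spaces.
\<close>

primrec holder_le :: "nat \<Rightarrow> real \<Rightarrow> (real \<Rightarrow> 'e::real_normed_vector) \<Rightarrow> bool" where
  "holder_le 0 K x \<longleftrightarrow> continuous_on {a..b} x \<and> (\<forall>t\<in>{a..b}. norm (x t) \<le> K) \<and>
    (\<forall>s\<in>{a..b}. \<forall>t\<in>{a..b}. norm (x t - x s) \<le> 2 * K * \<bar>t - s\<bar> powr \<alpha>)"
| "holder_le (Suc l) K x \<longleftrightarrow> (\<forall>t\<in>{a..b}. norm (x t) \<le> K) \<and>
    (\<exists>x'. (\<forall>t\<in>{a..b}. (x has_vector_derivative x' t) (at t within {a..b})) \<and> holder_le l K x')"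

declare holder_le.simps(2) [simp del]

lemma holder_le_SucI:
  assumes "\<And>t. t \<in> {a..b} \<Longrightarrow> norm (x t) \<le> K"
    and "\<And>t. t \<in> {a..b} \<Longrightarrow> (x has_vector_derivative x' t) (at t within {a..b})"
    and "holder_le l K x'"
  shows "holder_le (Suc l) K x"
  using assms unfolding holder_le.simps(2) by blast

lemma holder_le_SucE:
  assumes "holder_le (Suc l) K x"
  obtains x' where "\<And>t. t \<in> {a..b} \<Longrightarrow> (x has_vector_derivative x' t) (at t within {a..b})"
    and "holder_le l K x'"
  using assms unfolding holder_le.simps(2) by blast

lemma holder_le_norm: "holder_le l K x \<Longrightarrow> t \<in> {a..b} \<Longrightarrow> norm (x t) \<le> K"
  by (cases l) (auto simp: holder_le.simps(2))

lemma holder_le_nonneg: "holder_le l K x \<Longrightarrow> 0 \<le> K"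
  using holder_le_norm[of l K x a] ab order_trans[OF norm_ge_zero[of "x a"]] by simp

lemma holder_le_continuous: "holder_le l K x \<Longrightarrow> continuous_on {a..b} x"
  by (cases l) (auto elim!: holder_le_SucE intro: continuous_on_vector_derivative simp del: atLeastAtMost_iff)

lemma holder_le_mono: "holder_le l K x \<Longrightarrow> K \<le> L \<Longrightarrow> holder_le l L x"
proof (induction l arbitrary: x)
  case 0
  have "norm (x t - x s) \<le> 2 * L * \<bar>t - s\<bar> powr \<alpha>" if "s \<in> {a..b}" "t \<in> {a..b}" for s t
  proof -
    have "norm (x t - x s) \<le> 2 * K * \<bar>t - s\<bar> powr \<alpha>"
      using 0 that by auto
    also have "\<dots> \<le> 2 * L * \<bar>t - s\<bar> powr \<alpha>"
      using 0 by (intro mult_right_mono) auto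
    finally show ?thesis .
  qed
  then show ?case using 0 by force
next
  case (Suc l)
  then show ?case unfolding holder_le.simps(2) by force
qed

lemma holder_le_cong:
  assumes "holder_le l K x" and eq: "\<And>t. t \<in> {a..b} \<Longrightarrow> x t = y t"
  shows "holder_le l K y"
proof (cases l)
  case 0
  then show ?thesis
    using assms continuous_on_cong[of "{a..b}" "{a..b}" x y] by simp
next
  case (Suc k)
  then obtain x' where x': "\<And>t. t \<in> {a..b} \<Longrightarrow> (x has_vector_derivative x' t) (at t within {a..b})"
    and "holder_le k K x'" using assms holder_le_SucE by metis
  have "(y has_vector_derivative x' t) (at t within {a..b})" if "t \<in> {a..b}" for t
    using has_vector_derivative_transform[OF that _ x'[OF that], of y] eq by auto
  then show ?thesis
    using Suc \<open>holder_le k K x'\<close> holder_le_norm[OF assms(1)] eq by (auto intro!: holder_le_SucI[of y _ x'])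
qed

lemma holder_le_const: "holder_le l (norm c) (\<lambda>_. c)"
proof -
  have zero: "holder_le l K (\<lambda>_. 0::'a)" if "0 \<le> K" for l K
    using that by (induction l) (auto intro!: holder_le_SucI[where x' = "\<lambda>_. 0"])
  show ?thesis
  proof (cases l)
    case (Suc k)
    then show ?thesis using zero[of "norm c" k]
      by (auto intro!: holder_le_SucI[where x' = "\<lambda>_. 0"])
  qed auto
qed

lemma holder_le_add:
  assumes "holder_le l K x" "holder_le l L y"
  shows "holder_le l (K + L) (\<lambda>t. x t + y t)"
  using assms
proof (induction l arbitrary: x y)
  case 0
  have "norm (x t + y t - (x s + y s)) \<le> 2 * (K + L) * \<bar>t - s\<bar> powr \<alpha>"
    if "s \<in> {a..b}" "t \<in> {a..b}" for s t
  proof -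
    have "norm (x t + y t - (x s + y s)) \<le> norm (x t - x s) + norm (y t - y s)"
      by (metis add_diff_add norm_triangle_ineq)
    also have "\<dots> \<le> 2 * K * \<bar>t - s\<bar> powr \<alpha> + 2 * L * \<bar>t - s\<bar> powr \<alpha>"
      using 0 that by (intro add_mono) auto
    finally show ?thesis by (simp add: algebra_simps)
  qed
  moreover have "norm (x t + y t) \<le> K + L" if "t \<in> {a..b}" for t
    using 0 that by (intro norm_triangle_mono) auto
  ultimately show ?case using 0 by (auto intro!: continuous_intros)
next
  case (Suc l)
  from Suc.prems(1) obtain x' where
    x': "\<And>t. t \<in> {a..b} \<Longrightarrow> (x has_vector_derivative x' t) (at t within {a..b})" "holder_le l K x'"
    by (rule holder_le_SucE) blast
  from Suc.prems(2) obtain y' where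
    y': "\<And>t. t \<in> {a..b} \<Longrightarrow> (y has_vector_derivative y' t) (at t within {a..b})" "holder_le l L y'"
    by (rule holder_le_SucE) blast
  have "norm (x t + y t) \<le> K + L" if "t \<in> {a..b}" for t
    using Suc.prems[THEN holder_le_norm, OF that] by (intro norm_triangle_mono) auto
  then show ?case
    using Suc.IH[OF x'(2) y'(2)] x'(1) y'(1)
    by (auto intro!: holder_le_SucI[where x' = "\<lambda>t. x' t + y' t"] has_vector_derivative_add)
qed

lemma holder_le_linear:
  assumes f: "bounded_linear f" and C: "\<And>v. norm (f v) \<le> C * norm v" and "0 \<le> C"
    and "holder_le l K x"
  shows "holder_le l (C * K) (\<lambda>t. f (x t))"
  using assms(4)
proof (induction l arbitrary: x)
  case 0
  interpret f: bounded_linear f by (fact f)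
  have "norm (f (x t) - f (x s)) \<le> 2 * (C * K) * \<bar>t - s\<bar> powr \<alpha>"
    if "s \<in> {a..b}" "t \<in> {a..b}" for s t
  proof -
    have "norm (f (x t) - f (x s)) \<le> C * norm (x t - x s)"
      using C[of "x t - x s"] by (simp add: f.diff)
    also have "\<dots> \<le> C * (2 * K * \<bar>t - s\<bar> powr \<alpha>)"
      using 0 that \<open>0 \<le> C\<close> by (intro mult_left_mono) auto
    finally show ?thesis by (simp add: algebra_simps)
  qed
  moreover have "norm (f (x t)) \<le> C * K" if "t \<in> {a..b}" for t
    using C[of "x t"] 0 that \<open>0 \<le> C\<close> by (meson holder_le_norm mult_left_mono order_trans)
  ultimately show ?case using 0 by (auto intro!: f.continuous_on)
next
  case (Suc l)
  from Suc.prems obtain x' where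
    x': "\<And>t. t \<in> {a..b} \<Longrightarrow> (x has_vector_derivative x' t) (at t within {a..b})" "holder_le l K x'"
    by (rule holder_le_SucE) blast
  have "norm (f (x t)) \<le> C * K" if "t \<in> {a..b}" for t
    using C[of "x t"] holder_le_norm[OF Suc.prems that] \<open>0 \<le> C\<close> by (meson mult_left_mono order_trans)
  then show ?case
    using Suc.IH[OF x'(2)] x'(1)
    by (auto intro!: holder_le_SucI[where x' = "\<lambda>t. f (x' t)"] bounded_linear.has_vector_derivative[OF f])
qed

lemma holder_le_scaleR: "holder_le l K x \<Longrightarrow> holder_le l (\<bar>c\<bar> * K) (\<lambda>t. c *\<^sub>R x t)"
  by (rule holder_le_linear[of "\<lambda>v. c *\<^sub>R v"]) (auto intro: bounded_linear_intros)

lemma holder_le_minus: "holder_le l K x \<Longrightarrow> holder_le l K (\<lambda>t. - x t)"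
  using holder_le_scaleR[of l K x "-1"] by simp

lemma holder_le_diff: "holder_le l K x \<Longrightarrow> holder_le l L y \<Longrightarrow> holder_le l (K + L) (\<lambda>t. x t - y t)"
  using holder_le_add[of l K x L "\<lambda>t. - y t"] holder_le_minus[of l L y] by simp

lemma holder_le_zero: "0 \<le> K \<Longrightarrow> holder_le l K (\<lambda>_. 0)"
  using holder_le_mono[OF holder_le_const[of l 0]] by simp

lemma holder_le_sum:
  assumes "finite I" "\<And>i. i \<in> I \<Longrightarrow> holder_le l (K i) (x i)"
  shows "holder_le l (\<Sum>i\<in>I. K i) (\<lambda>t. \<Sum>i\<in>I. x i t)"
  using assms by (induction I) (auto intro: holder_le_zero holder_le_add)

text \<open>
  A Lipschitz function on \<open>{a..b}\<close> is Hoelder continuous because \<open>\<bar>t - s\<bar> \<le> (b - a) powr (1 - \<alpha>) * \<bar>t - s\<bar> powr \<alpha>\<close>.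
  The maximum with \<open>1\<close> lets the same constant serve for the bound on the values.
\<close>

definition embed_const :: real where
  "embed_const = max 1 ((b - a) powr (1 - \<alpha>))"

lemma embed_const_ge_1: "1 \<le> embed_const"
  by (simp add: embed_const_def)

lemma holder_le_0_of_derivative:
  assumes K: "\<And>t. t \<in> {a..b} \<Longrightarrow> norm (x t) \<le> K"
    and x': "\<And>t. t \<in> {a..b} \<Longrightarrow> (x has_vector_derivative x' t) (at t within {a..b})"
    and K': "\<And>t. t \<in> {a..b} \<Longrightarrow> norm (x' t) \<le> K"
  shows "holder_le 0 (embed_const * K) x"
proof -
  have "0 \<le> K" using K[of a] ab order_trans[OF norm_ge_zero[of "x a"]] by simp
  have "norm (x t) \<le> embed_const * K" if "t \<in> {a..b}" for t
    using K[OF that] mult_right_mono[OF embed_const_ge_1 \<open>0 \<le> K\<close>] by simp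
  moreover have "norm (x t - x s) \<le> 2 * (embed_const * K) * \<bar>t - s\<bar> powr \<alpha>"
    if st: "s \<in> {a..b}" "t \<in> {a..b}" for s t
  proof -
    have "norm (x t - x s) \<le> K * norm (t - s)"
    proof (rule differentiable_bound[of "{a..b}" x "\<lambda>t h. h *\<^sub>R x' t"])
      show "onorm (\<lambda>h. h *\<^sub>R x' u) \<le> K" if "u \<in> {a..b}" for u
        using K'[OF that] by (intro onorm_le) (simp add: mult.commute[of K] mult_left_mono)
    qed (use x' st in \<open>auto simp: has_vector_derivative_def\<close>)
    also have "norm (t - s) \<le> embed_const * \<bar>t - s\<bar> powr \<alpha>"
    proof (cases "t = s")
      case False
      then have "\<bar>t - s\<bar> = \<bar>t - s\<bar> powr (1 - \<alpha>) * \<bar>t - s\<bar> powr \<alpha>"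
        by (simp flip: powr_add)
      also have "\<dots> \<le> (b - a) powr (1 - \<alpha>) * \<bar>t - s\<bar> powr \<alpha>"
        using st alpha_le by (intro mult_right_mono powr_mono2) auto
      also have "\<dots> \<le> embed_const * \<bar>t - s\<bar> powr \<alpha>"
        by (intro mult_right_mono) (auto simp: embed_const_def)
      finally show ?thesis by simp
    qed auto
    also have "K * (embed_const * \<bar>t - s\<bar> powr \<alpha>) \<le> 2 * (K * (embed_const * \<bar>t - s\<bar> powr \<alpha>))"
      using \<open>0 \<le> K\<close> embed_const_ge_1 by simp
    finally show ?thesis using \<open>0 \<le> K\<close> by (simp add: mult_ac mult_right_mono)
  qed
  moreover have "continuous_on {a..b} x"
    using x' by (rule continuous_on_vector_derivative)
  ultimately show ?thesis by simp
qed

lemma holder_le_lower: "holder_le (Suc l) K x \<Longrightarrow> holder_le l (embed_const * K) x"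
proof (induction l arbitrary: x)
  case 0
  then obtain x' where
    x': "\<And>t. t \<in> {a..b} \<Longrightarrow> (x has_vector_derivative x' t) (at t within {a..b})" "holder_le 0 K x'"
    by (rule holder_le_SucE) blast
  then show ?case
    using holder_le_0_of_derivative[of x K x'] holder_le_norm[OF 0] holder_le_norm[OF x'(2)] by blast
next
  case (Suc l)
  from Suc.prems obtain x' where
    x': "\<And>t. t \<in> {a..b} \<Longrightarrow> (x has_vector_derivative x' t) (at t within {a..b})" "holder_le (Suc l) K x'"
    by (rule holder_le_SucE) blast
  have "norm (x t) \<le> embed_const * K" if "t \<in> {a..b}" for t
    using holder_le_norm[OF Suc.prems that] mult_right_mono[OF embed_const_ge_1 holder_le_nonneg[OF Suc.prems]]
    by simp
  then show ?case using x'(1) Suc.IH[OF x'(2)] by (rule holder_le_SucI)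
qed

text \<open>
  By the Leibniz rule the derivative of a product is a sum of two products with one factor
  differentiated and the other one lowered from order \<open>l + 1\<close> to order \<open>l\<close>. So for
  the derivative of a product \<open>2 * embed_const\<close> times the constant of order \<open>l\<close> suffices, and for its values
  the bound of \<open>prod\<close> does.
\<close>

lemma holder_le_bilinear:
  fixes prod :: "'e::real_normed_vector \<Rightarrow> 'f::real_normed_vector \<Rightarrow> 'g::real_normed_vector"
  assumes "bounded_bilinear prod"
  shows "\<exists>C>0. \<forall>x y K L. holder_le l K x \<longrightarrow> holder_le l L y \<longrightarrow> holder_le l (C * K * L) (\<lambda>t. prod (x t) (y t))"
proof -
  interpret bounded_bilinear prod by fact
  obtain M where M: "0 < M" "\<And>u v. norm (prod u v) \<le> norm u * norm v * M"
    using pos_bounded by blast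
  have bound: "norm (prod u v) \<le> M * K * L" if "norm u \<le> K" "norm v \<le> L" for u v K L
  proof -
    have "norm u * norm v * M \<le> K * L * M"
      using that M(1) by (intro mult_right_mono mult_mono) (auto intro: order_trans[OF norm_ge_zero])
    then show ?thesis using M(2)[of u v] by (simp add: mult_ac)
  qed
  show ?thesis
  proof (induction l)
    case 0
    have "holder_le 0 (2 * M * K * L) (\<lambda>t. prod (x t) (y t))" if x: "holder_le 0 K x" and y: "holder_le 0 L y" for x y K L
    proof -
      have KL: "0 \<le> M * K * L"
        using M holder_le_nonneg[OF x] holder_le_nonneg[OF y] by simp
      have "norm (prod (x t) (y t)) \<le> 2 * M * K * L" if "t \<in> {a..b}" for t
        using bound[OF holder_le_norm[OF x that] holder_le_norm[OF y that]] KL by simp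
      moreover have "norm (prod (x t) (y t) - prod (x s) (y s)) \<le> 2 * (2 * M * K * L) * \<bar>t - s\<bar> powr \<alpha>"
        if st: "s \<in> {a..b}" "t \<in> {a..b}" for s t
      proof -
        have "prod (x t) (y t) - prod (x s) (y s) = prod (x t - x s) (y t) + prod (x s) (y t - y s)"
          by (simp add: diff_left diff_right)
        also have "norm \<dots> \<le> M * (2 * K * \<bar>t - s\<bar> powr \<alpha>) * L + M * K * (2 * L * \<bar>t - s\<bar> powr \<alpha>)"
          using x y st by (intro norm_triangle_mono bound) auto
        finally show ?thesis by (simp add: algebra_simps)
      qed
      moreover have "continuous_on {a..b} (\<lambda>t. prod (x t) (y t))"
        using x y by (intro continuous_on) auto
      ultimately show ?thesis by simp
    qed
    then show ?case using M by (intro exI[of _ "2 * M"]) auto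
  next
    case (Suc l)
    then obtain C where C: "C > 0"
      "\<And>x y K L. holder_le l K x \<Longrightarrow> holder_le l L y \<Longrightarrow> holder_le l (C * K * L) (\<lambda>t. prod (x t) (y t))"
      by blast
    let ?C = "max M (2 * embed_const * C)"
    have "holder_le (Suc l) (?C * K * L) (\<lambda>t. prod (x t) (y t))"
      if x: "holder_le (Suc l) K x" and y: "holder_le (Suc l) L y" for x y K L
    proof -
      have KL: "0 \<le> K * L"
        using holder_le_nonneg[OF x] holder_le_nonneg[OF y] by simp
      from x obtain x' where
        x': "\<And>t. t \<in> {a..b} \<Longrightarrow> (x has_vector_derivative x' t) (at t within {a..b})" "holder_le l K x'"
        by (rule holder_le_SucE) blast
      from y obtain y' where
        y': "\<And>t. t \<in> {a..b} \<Longrightarrow> (y has_vector_derivative y' t) (at t within {a..b})" "holder_le l L y'"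
        by (rule holder_le_SucE) blast
      have "C * (embed_const * K) * L + C * K * (embed_const * L) = 2 * embed_const * C * (K * L)"
        by simp
      also have "\<dots> \<le> ?C * (K * L)"
        using KL by (intro mult_right_mono) auto
      finally have "C * (embed_const * K) * L + C * K * (embed_const * L) \<le> ?C * K * L"
        by (simp only: mult.assoc)
      then have deriv: "holder_le l (?C * K * L) (\<lambda>t. prod (x t) (y' t) + prod (x' t) (y t))"
        by (rule holder_le_mono[OF holder_le_add[OF C(2)[OF holder_le_lower[OF x] y'(2)] C(2)[OF x'(2) holder_le_lower[OF y]]]])
      have prod_bound: "norm (prod (x t) (y t)) \<le> ?C * K * L" if "t \<in> {a..b}" for t
      proof -
        have "norm (prod (x t) (y t)) \<le> M * (K * L)"
          using bound[OF holder_le_norm[OF x that] holder_le_norm[OF y that]] by (simp add: mult_ac)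
        also have "\<dots> \<le> ?C * (K * L)"
          using KL by (intro mult_right_mono) auto
        finally show ?thesis by (simp add: mult_ac)
      qed
      have "((\<lambda>t. prod (x t) (y t)) has_vector_derivative prod (x t) (y' t) + prod (x' t) (y t))
          (at t within {a..b})" if "t \<in> {a..b}" for t
        using has_vector_derivative[OF x'(1)[OF that] y'(1)[OF that]] .
      with prod_bound show ?thesis using deriv by (rule holder_le_SucI)
    qed
    note step = this
    have pos: "0 < ?C" using M(1) by (simp add: less_max_iff_disj)
    show ?case
      by (rule exI[of _ ?C], intro conjI allI impI, rule pos, rule step)
  qed
qed

lemma vector_derivative_Icc:
  assumes "t \<in> {a..b}" "(x has_vector_derivative x') (at t within {a..b})"
  shows "vector_derivative x (at t within {a..b}) = x'"
  using vector_derivative_within_cbox[of a b t x x'] assms ab by (simp only: box_real)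

text \<open>
  The same recursion with the derivative that occurs in the definition of the spaces.
\<close>

lemma holder_le_Suc_iff:
  "holder_le (Suc l) K x \<longleftrightarrow> (\<forall>t\<in>{a..b}. norm (x t) \<le> K) \<and> x differentiable_on {a..b} \<and>
    holder_le l K (\<lambda>t. vector_derivative x (at t within {a..b}))"
proof
  assume h: "holder_le (Suc l) K x"
  then obtain x' where
    x': "\<And>t. t \<in> {a..b} \<Longrightarrow> (x has_vector_derivative x' t) (at t within {a..b})" "holder_le l K x'"
    by (rule holder_le_SucE) blast
  have "vector_derivative x (at t within {a..b}) = x' t" if "t \<in> {a..b}" for t
    using vector_derivative_Icc[OF that x'(1)[OF that]] .
  then have "holder_le l K (\<lambda>t. vector_derivative x (at t within {a..b}))"
    by (intro holder_le_cong[OF x'(2)]) simp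
  moreover have "x differentiable_on {a..b}"
    using x'(1) differentiableI_vector unfolding differentiable_on_def by blast
  ultimately show "(\<forall>t\<in>{a..b}. norm (x t) \<le> K) \<and> x differentiable_on {a..b} \<and>
    holder_le l K (\<lambda>t. vector_derivative x (at t within {a..b}))"
    using holder_le_norm[OF h] by blast
next
  assume h: "(\<forall>t\<in>{a..b}. norm (x t) \<le> K) \<and> x differentiable_on {a..b} \<and>
    holder_le l K (\<lambda>t. vector_derivative x (at t within {a..b}))"
  then have "(x has_vector_derivative vector_derivative x (at t within {a..b})) (at t within {a..b})"
    if "t \<in> {a..b}" for t
    using that vector_derivative_works unfolding differentiable_on_def by blast
  then show "holder_le (Suc l) K x"
    using h by (intro holder_le_SucI[where x' = "\<lambda>t. vector_derivative x (at t within {a..b})"]) blast+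
qed

text \<open>
  Completeness of the Hoelder spaces. The derivatives converge uniformly, so their limit is the
  derivative of the limit. The rate \<open>e\<close> is explicit because the gliding hump argument below compares
  each member of the sequence with the limit.
\<close>

lemma holder_le_complete:
  fixes s :: "nat \<Rightarrow> real \<Rightarrow> 'e::banach"
  assumes "\<And>k. \<exists>K. holder_le l K (s k)"
    and "\<And>j k. k \<le> j \<Longrightarrow> holder_le l (e k) (\<lambda>t. s j t - s k t)"
    and "e \<longlonglongrightarrow> 0"
  shows "\<exists>x. (\<exists>K. holder_le l K x) \<and> (\<forall>k. holder_le l (e k) (\<lambda>t. x t - s k t))"
proof -
  have limit: "\<exists>x. (\<forall>t\<in>{a..b}. (\<lambda>j. s j t) \<longlonglongrightarrow> x t) \<and> (\<forall>k. holder_le l (e k) (\<lambda>t. x t - s k t))"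
    using assms(1,2)
  proof (induction l arbitrary: s)
    case 0
    have bound: "norm (s j t - s k t) \<le> e k" if "k \<le> j" "t \<in> {a..b}" for j k t
      using holder_le_norm[OF 0(2)[OF that(1)] that(2)] .
    have "uniformly_Cauchy_on {a..b} s"
      unfolding uniformly_Cauchy_on_def
    proof (intro allI impI)
      fix r :: real assume "0 < r"
      then have "\<forall>\<^sub>F k in sequentially. e k < r / 2"
        using assms(3) by (intro order_tendstoD(2)[of e 0]) auto
      then obtain M where M: "e M < r / 2"
        by (auto simp: eventually_sequentially)
      have "dist (s m t) (s n t) < r" if "t \<in> {a..b}" "m \<ge> M" "n \<ge> M" for t m n
        using bound[OF that(2,1)] bound[OF that(3,1)] M dist_triangle2[of "s m t" "s n t" "s M t"]
        by (simp add: dist_norm)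
      then show "\<exists>M. \<forall>t\<in>{a..b}. \<forall>m\<ge>M. \<forall>n\<ge>M. dist (s m t) (s n t) < r"
        by blast
    qed
    then obtain x where x: "uniform_limit {a..b} s x sequentially"
      using Cauchy_uniformly_convergent uniformly_convergent_on_def by blast
    have lim: "(\<lambda>j. s j t) \<longlonglongrightarrow> x t" if "t \<in> {a..b}" for t
      using tendsto_uniform_limitI[OF x that] .
    have "continuous_on {a..b} x"
      using 0(1) x by (intro uniform_limit_theorem[OF _ x]) auto
    moreover have "continuous_on {a..b} (s k)" for k
      using 0(1) by auto
    moreover have "norm (x t - s k t) \<le> e k" if "t \<in> {a..b}" for k t
      by (rule Lim_bounded[where M = k and f = "\<lambda>j. norm (s j t - s k t)"])
        (use that bound in \<open>auto intro!: tendsto_intros lim\<close>)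
    moreover have "norm (x t - s k t - (x u - s k u)) \<le> 2 * e k * \<bar>t - u\<bar> powr \<alpha>"
      if "t \<in> {a..b}" "u \<in> {a..b}" for k t u
      by (rule Lim_bounded[where M = k and f = "\<lambda>j. norm (s j t - s k t - (s j u - s k u))"])
        (use that 0(2) in \<open>auto intro!: tendsto_intros lim\<close>)
    ultimately have "holder_le 0 (e k) (\<lambda>t. x t - s k t)" for k
      by (auto intro!: continuous_intros)
    then show ?case using lim by blast
  next
    case (Suc l)
    define s' where "s' k = (\<lambda>t. vector_derivative (s k) (at t within {a..b}))" for k
    have s'_hb: "\<exists>K. holder_le l K (s' k)" for k
      using Suc.prems(1)[of k] unfolding holder_le_Suc_iff s'_def by blast
    have s': "(s k has_vector_derivative s' k t) (at t within {a..b})" if "t \<in> {a..b}" for k t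
      using Suc.prems(1)[of k] that vector_derivative_works
      unfolding holder_le_Suc_iff s'_def differentiable_on_def by blast
    have diff': "vector_derivative (\<lambda>t. s j t - s k t) (at t within {a..b}) = s' j t - s' k t"
      if "t \<in> {a..b}" for j k t
      using vector_derivative_Icc[OF that has_vector_derivative_diff[OF s'[OF that] s'[OF that]]] .
    have s'_diff: "holder_le l (e k) (\<lambda>t. s' j t - s' k t)" if "k \<le> j" for j k
      using Suc.prems(2)[OF that] by (intro holder_le_cong[OF _ diff']) (auto simp: holder_le_Suc_iff)
    obtain x' where x': "\<And>t. t \<in> {a..b} \<Longrightarrow> (\<lambda>j. s' j t) \<longlonglongrightarrow> x' t"
        "\<And>k. holder_le l (e k) (\<lambda>t. x' t - s' k t)"
      using Suc.IH[OF s'_hb s'_diff] by blast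
    have bound: "norm (s j t - s k t) \<le> e k" if "k \<le> j" "t \<in> {a..b}" for j k t
      using holder_le_norm[OF Suc.prems(2)[OF that(1)] that(2)] .
    have "Cauchy (\<lambda>j. s j a)"
    proof (rule metric_CauchyI)
      fix r :: real assume "0 < r"
      then have "\<forall>\<^sub>F k in sequentially. e k < r / 2"
        using assms(3) by (intro order_tendstoD(2)[of e 0]) auto
      then obtain M where M: "e M < r / 2"
        by (auto simp: eventually_sequentially)
      have "dist (s m a) (s n a) < r" if "m \<ge> M" "n \<ge> M" for m n
        using bound[OF that(1), of a] bound[OF that(2), of a] ab M
          dist_triangle2[of "s m a" "s n a" "s M a"]
        by (simp add: dist_norm)
      then show "\<exists>M. \<forall>m\<ge>M. \<forall>n\<ge>M. dist (s m a) (s n a) < r" by blast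
    qed
    then obtain l0 where l0: "(\<lambda>j. s j a) \<longlonglongrightarrow> l0"
      using Cauchy_convergent convergent_def by blast
    have "\<exists>g. \<forall>t\<in>{a..b}. (\<lambda>j. s j t) \<longlonglongrightarrow> g t \<and> (g has_derivative (\<lambda>h. h *\<^sub>R x' t)) (at t within {a..b})"
    proof (rule has_derivative_sequence[of _ s "\<lambda>j t h. h *\<^sub>R s' j t"])
      show "\<forall>\<^sub>F j in sequentially. \<forall>t\<in>{a..b}. \<forall>h. norm (h *\<^sub>R s' j t - h *\<^sub>R x' t) \<le> r * norm h"
        if "0 < r" for r
        using order_tendstoD(2)[OF assms(3) that]
      proof eventually_elim
        case (elim j)
        show ?case
        proof (intro ballI allI)
          fix t h assume "t \<in> {a..b}"
          then have "norm (s' j t - x' t) \<le> r"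
            using holder_le_norm[OF x'(2)] elim by (metis less_imp_le norm_minus_commute order_trans)
          then show "norm (h *\<^sub>R s' j t - h *\<^sub>R x' t) \<le> r * norm h"
            by (simp flip: scaleR_diff_right add: mult.commute[of r] mult_left_mono)
        qed
      qed
    qed (use s' ab l0 in \<open>auto simp: has_vector_derivative_def\<close>)
    then obtain x where x: "\<And>t. t \<in> {a..b} \<Longrightarrow> (\<lambda>j. s j t) \<longlonglongrightarrow> x t"
        "\<And>t. t \<in> {a..b} \<Longrightarrow> (x has_vector_derivative x' t) (at t within {a..b})"
      unfolding has_vector_derivative_def by blast
    have "holder_le (Suc l) (e k) (\<lambda>t. x t - s k t)" for k
    proof -
      have "norm (x t - s k t) \<le> e k" if "t \<in> {a..b}" for t
        by (rule Lim_bounded[where M = k and f = "\<lambda>j. norm (s j t - s k t)"])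
          (use that bound in \<open>auto intro!: tendsto_intros x\<close>)
      then show ?thesis
        using x(2) s' x'(2)[of k]
        by (auto intro!: holder_le_SucI[where x' = "\<lambda>t. x' t - s' k t"] has_vector_derivative_diff)
    qed
    then show ?case using x(1) by blast
  qed
  then obtain x where x: "\<And>k. holder_le l (e k) (\<lambda>t. x t - s k t)" by blast
  obtain K where "holder_le l K (s 0)" using assms(1) by blast
  from holder_le_add[OF x[of 0] this] have "holder_le l (e 0 + K) x" by simp
  with x show ?thesis by blast
qed

section \<open>Comparison with the Hoelder norms\<close>

lemma holder_space_Suc:
  "x \<in> holder_space a b (Suc l) \<alpha> \<longleftrightarrow> x differentiable_on {a..b} \<and>
    (\<lambda>t. vector_derivative x (at t within {a..b})) \<in> holder_space a b l \<alpha>"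
  by (auto simp: holder_space_def C_space_def iter_deriv_def funpow_Suc_right All_less_Suc2
      simp del: funpow.simps(2))

lemma holder_norm_Suc:
  "holder_norm a b (Suc l) \<alpha> x = (SUP t\<in>{a..b}. cmod (x t)) +
    holder_norm a b l \<alpha> (\<lambda>t. vector_derivative x (at t within {a..b}))"
  unfolding holder_norm_def C_norm_def sum.atMost_Suc_shift
  by (simp add: iter_deriv_def funpow_Suc_right del: funpow.simps(2))

lemma sup_bounds:
  assumes "continuous_on {a..b} (x :: real \<Rightarrow> complex)"
  shows "t \<in> {a..b} \<Longrightarrow> cmod (x t) \<le> (SUP t\<in>{a..b}. cmod (x t))"
    and "0 \<le> (SUP t\<in>{a..b}. cmod (x t))"
proof -
  have "compact ((\<lambda>t. cmod (x t)) ` {a..b})"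
    using assms by (intro compact_continuous_image continuous_intros) auto
  then have "bdd_above ((\<lambda>t. cmod (x t)) ` {a..b})"
    by (intro bounded_imp_bdd_above compact_imp_bounded)
  then show *: "cmod (x t) \<le> (SUP t\<in>{a..b}. cmod (x t))" if "t \<in> {a..b}" for t
    using that by (rule cSUP_upper[rotated])
  show "0 \<le> (SUP t\<in>{a..b}. cmod (x t))"
    using *[of a] ab by (intro order_trans[OF norm_ge_zero]) auto
qed

lemma holder_quotients_nonempty: "holder_quotients a b \<alpha> g \<noteq> {}"
proof -
  have "cmod (g b - g a) / \<bar>b - a\<bar> powr \<alpha> \<in> holder_quotients a b \<alpha> g"
    unfolding holder_quotients_def using ab by fastforce
  then show ?thesis by blast
qed

lemma holder_le_holder_norm:
  assumes "x \<in> holder_space a b l \<alpha>"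
  shows "holder_le l (holder_norm a b l \<alpha> x) x"
  using assms
proof (induction l arbitrary: x)
  case 0
  define S where "S = (SUP t\<in>{a..b}. cmod (x t))"
  have cont: "continuous_on {a..b} x"
    using 0 by (auto simp: holder_space_def C_space_def iter_deriv_def split: if_splits)
  note sup = sup_bounds[OF cont, folded S_def]
  show ?case
  proof (cases "\<alpha> = 0")
    case True
    then have N: "holder_norm a b 0 \<alpha> x = S"
      by (simp add: holder_norm_def C_norm_def iter_deriv_def S_def)
    have "cmod (x t - x s) \<le> 2 * S * \<bar>t - s\<bar> powr \<alpha>" if "s \<in> {a..b}" "t \<in> {a..b}" for s t
      using sup(1)[OF that(1)] sup(1)[OF that(2)] norm_triangle_ineq4[of "x t" "x s"] True
      by (cases "t = s") auto
    then show ?thesis using cont sup N by auto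
  next
    case False
    define H where "H = Sup (holder_quotients a b \<alpha> x)"
    have bdd: "bdd_above (holder_quotients a b \<alpha> x)"
      using False 0 by (simp add: holder_space_def iter_deriv_def)
    have N: "holder_norm a b 0 \<alpha> x = S + H"
      using False by (simp add: holder_norm_def C_norm_def iter_deriv_def S_def H_def)
    have quot: "q \<le> H" if "q \<in> holder_quotients a b \<alpha> x" for q
      unfolding H_def using that bdd by (rule cSup_upper)
    have H0: "0 \<le> H"
    proof -
      obtain q where "q \<in> holder_quotients a b \<alpha> x" using holder_quotients_nonempty by blast
      moreover then have "0 \<le> q" by (auto simp: holder_quotients_def)
      ultimately show ?thesis using quot order_trans by blast
    qed
    have "cmod (x t - x s) \<le> 2 * (S + H) * \<bar>t - s\<bar> powr \<alpha>"
      if "s \<in> {a..b}" "t \<in> {a..b}" for s t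
    proof (cases "t = s")
      case False
      have "cmod (x t - x s) / \<bar>t - s\<bar> powr \<alpha> \<le> H"
        using that False by (intro quot) (auto simp: holder_quotients_def)
      then have "cmod (x t - x s) \<le> H * \<bar>t - s\<bar> powr \<alpha>"
        using False by (simp add: field_simps)
      also have "\<dots> \<le> 2 * (S + H) * \<bar>t - s\<bar> powr \<alpha>"
        using H0 sup(2) by (intro mult_right_mono) auto
      finally show ?thesis .
    qed auto
    moreover have "cmod (x t) \<le> S + H" if "t \<in> {a..b}" for t
      using sup(1)[OF that] H0 by simp
    ultimately show ?thesis using cont N by simp
  qed
next
  case (Suc l)
  let ?D = "\<lambda>t. vector_derivative x (at t within {a..b})"
  have D: "x differentiable_on {a..b}" "?D \<in> holder_space a b l \<alpha>"
    using Suc.prems by (auto simp: holder_space_Suc)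
  note sup = sup_bounds[OF differentiable_imp_continuous_on[OF D(1)]]
  note IH = Suc.IH[OF D(2)]
  show ?case
    unfolding holder_le_Suc_iff holder_norm_Suc
  proof (intro conjI ballI)
    show "cmod (x t) \<le> (SUP t\<in>{a..b}. cmod (x t)) + holder_norm a b l \<alpha> ?D" if "t \<in> {a..b}" for t
      using sup(1)[OF that] holder_le_nonneg[OF IH] by simp
    show "holder_le l ((SUP t\<in>{a..b}. cmod (x t)) + holder_norm a b l \<alpha> ?D) ?D"
      using sup(2) by (intro holder_le_mono[OF IH]) simp
  qed fact
qed

lemma holder_le_holder_space:
  assumes "holder_le l K x"
  shows "x \<in> holder_space a b l \<alpha>" and "holder_norm a b l \<alpha> x \<le> (real l + 3) * K"
proof -
  have sup: "(SUP t\<in>{a..b}. cmod (x t)) \<le> K" if "holder_le l K x" for l K x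
    using ab holder_le_norm[OF that] by (intro cSUP_least) auto
  have "x \<in> holder_space a b l \<alpha> \<and> holder_norm a b l \<alpha> x \<le> (real l + 3) * K"
    using assms
  proof (induction l arbitrary: x)
    case 0
    have quot: "q \<le> 2 * K" if "q \<in> holder_quotients a b \<alpha> x" for q
    proof -
      from that obtain s t where st: "s \<in> {a..b}" "t \<in> {a..b}" "s \<noteq> t"
        and q: "q = cmod (x t - x s) / \<bar>t - s\<bar> powr \<alpha>"
        unfolding holder_quotients_def by blast
      have "cmod (x t - x s) \<le> 2 * K * \<bar>t - s\<bar> powr \<alpha>"
        using 0 st by auto
      then show ?thesis using q st(3) by (simp add: pos_divide_le_eq)
    qed
    have "Sup (holder_quotients a b \<alpha> x) \<le> 2 * K"
      using holder_quotients_nonempty quot by (rule cSup_least)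
    moreover have "bdd_above (holder_quotients a b \<alpha> x)"
      using quot by (rule bdd_aboveI)
    ultimately show ?case
      using 0 sup[OF 0] holder_le_nonneg[OF 0]
      by (simp add: holder_space_def holder_norm_def C_space_def C_norm_def iter_deriv_def)
  next
    case (Suc l)
    let ?D = "\<lambda>t. vector_derivative x (at t within {a..b})"
    have D: "x differentiable_on {a..b}" "holder_le l K ?D"
      using Suc.prems by (auto simp: holder_le_Suc_iff)
    show ?case
      using Suc.IH[OF D(2)] D(1) sup[OF Suc.prems]
      unfolding holder_space_Suc holder_norm_Suc by (simp add: algebra_simps)
  qed
  then show "x \<in> holder_space a b l \<alpha>" and "holder_norm a b l \<alpha> x \<le> (real l + 3) * K"
    by auto
qed

lemma holder_le_component: "holder_le l K y \<Longrightarrow> holder_le l K (\<lambda>t. y t $ i)"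
  using holder_le_linear[OF bounded_linear_vec_nth, where C = 1 and x = y and K = K]
  by (simp add: Finite_Cartesian_Product.norm_nth_le)

text \<open>
  A vector is the sum of its components times unit vectors, and embedding a component does not
  increase norms.
\<close>

lemma holder_le_vec:
  fixes y :: "real \<Rightarrow> 'v::real_normed_vector ^ 'n"
  assumes "\<And>i. holder_le l (K i) (\<lambda>t. y t $ i)"
  shows "holder_le l (\<Sum>i\<in>UNIV. K i) y"
proof -
  have "holder_le l (1 * K i) (\<lambda>t. axis i (y t $ i) :: 'v ^ 'n)" for i
    using norm_axis_le[of i] by (intro holder_le_linear[OF bounded_linear_axis _ _ assms]) auto
  then have "holder_le l (\<Sum>i\<in>UNIV. K i) (\<lambda>t. \<Sum>i\<in>UNIV. axis i (y t $ i) :: 'v ^ 'n)"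
    by (intro holder_le_sum) auto
  moreover have "(\<Sum>i\<in>UNIV. axis i (v $ i)) = v" for v :: "'v ^ 'n"
    by (simp add: vec_eq_iff axis_def if_distrib cong: if_cong)
  ultimately show ?thesis by simp
qed

lemma holder_le_holder_norm_vec:
  "y \<in> holder_space_vec a b l \<alpha> \<Longrightarrow> holder_le l (holder_norm_vec a b l \<alpha> y) y"
  unfolding holder_space_vec_def holder_norm_vec_def
  by (intro holder_le_vec holder_le_holder_norm) auto

lemma holder_le_holder_space_vec:
  fixes y :: "real \<Rightarrow> complex ^ 'm"
  assumes "holder_le l K y"
  shows "y \<in> holder_space_vec a b l \<alpha>"
    and "holder_norm_vec a b l \<alpha> y \<le> real CARD('m) * (real l + 3) * K"
proof -
  note comp = holder_le_holder_space[OF holder_le_component[OF assms]]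
  show "y \<in> holder_space_vec a b l \<alpha>"
    using comp(1) by (simp add: holder_space_vec_def)
  show "holder_norm_vec a b l \<alpha> y \<le> real CARD('m) * (real l + 3) * K"
    unfolding holder_norm_vec_def using comp(2)
    by (intro order_trans[OF sum_bounded_above[where K = "(real l + 3) * K"]]) auto
qed

lemma holder_space_vec_iff: "y \<in> holder_space_vec a b l \<alpha> \<longleftrightarrow> (\<exists>K. holder_le l K y)"
  using holder_le_holder_norm_vec holder_le_holder_space_vec(1) by blast

lemma holder_le_holder_norm_mat:
  "M \<in> holder_space_mat a b l \<alpha> \<Longrightarrow> holder_le l (holder_norm_mat a b l \<alpha> M) M"
  unfolding holder_space_mat_def holder_norm_mat_def
  by (intro holder_le_vec holder_le_holder_norm) auto

lemma holder_le_holder_space_mat: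
  fixes M :: "real \<Rightarrow> complex ^ 'm ^ 'm"
  assumes "holder_le l K M"
  shows "M \<in> holder_space_mat a b l \<alpha>"
    and "holder_norm_mat a b l \<alpha> M \<le> real CARD('m) * (real CARD('m) * (real l + 3) * K)"
proof -
  have row: "holder_le l K (\<lambda>t. M t $ i)" for i
    using assms by (rule holder_le_component)
  show "M \<in> holder_space_mat a b l \<alpha>"
    using holder_le_holder_space(1)[OF holder_le_component[OF row]] by (simp add: holder_space_mat_def)
  show "holder_norm_mat a b l \<alpha> M \<le> real CARD('m) * (real CARD('m) * (real l + 3) * K)"
    unfolding holder_norm_mat_def using holder_le_holder_space_vec(2)[OF row, unfolded holder_norm_vec_def]
    by (rule order_trans[OF sum_bounded_above]) simp
qed

section \<open>Convergence to zero in a Hoelder space\<close>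

definition vanishes :: "nat \<Rightarrow> (real \<Rightarrow> real \<Rightarrow> 'e::real_normed_vector) \<Rightarrow> bool" where
  "vanishes l d \<longleftrightarrow> (\<forall>e>0. \<forall>\<^sub>F \<epsilon> in at_right 0. holder_le l e (d \<epsilon>))"

text \<open>
  The argument common to vectors and matrices: \<open>S\<close> stands for a space and \<open>N\<close> for its norm, which is
  comparable with the radius in \<open>holder_le\<close>.
\<close>

lemma norm_tendsto_0_iff_vanishes:
  assumes lower: "\<And>x. S x \<Longrightarrow> holder_le l (N x) x"
    and upper: "\<And>x K. holder_le l K x \<Longrightarrow> S x" "\<And>x K. holder_le l K x \<Longrightarrow> N x \<le> C * K"
    and S: "\<forall>\<^sub>F \<epsilon> in at_right 0. S (d \<epsilon>)"
  shows "((\<lambda>\<epsilon>. N (d \<epsilon>)) \<longlongrightarrow> 0) (at_right 0) \<longleftrightarrow> vanishes l d"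
proof
  assume lim: "((\<lambda>\<epsilon>. N (d \<epsilon>)) \<longlongrightarrow> 0) (at_right 0)"
  show "vanishes l d"
    unfolding vanishes_def
  proof (intro allI impI)
    fix e :: real assume "0 < e"
    show "\<forall>\<^sub>F \<epsilon> in at_right 0. holder_le l e (d \<epsilon>)"
      using S order_tendstoD(2)[OF lim \<open>0 < e\<close>]
      by eventually_elim (auto intro: holder_le_mono[OF lower])
  qed
next
  assume v: "vanishes l d"
  show "((\<lambda>\<epsilon>. N (d \<epsilon>)) \<longlongrightarrow> 0) (at_right 0)"
  proof (rule tendstoI)
    fix e :: real assume "0 < e"
    define e' where "e' = e / (\<bar>C\<bar> + 1)"
    have "0 < e'" using \<open>0 < e\<close> by (simp add: e'_def)
    then have "\<forall>\<^sub>F \<epsilon> in at_right 0. holder_le l e' (d \<epsilon>)"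
      using v by (simp add: vanishes_def)
    then show "\<forall>\<^sub>F \<epsilon> in at_right 0. dist (N (d \<epsilon>)) 0 < e"
    proof eventually_elim
      case (elim \<epsilon>)
      have "N (d \<epsilon>) \<le> C * e'" using elim by (rule upper(2))
      also have "\<dots> \<le> \<bar>C\<bar> * e'" using \<open>0 < e'\<close> by (intro mult_right_mono) auto
      also have "\<dots> < (\<bar>C\<bar> + 1) * e'" using \<open>0 < e'\<close> by simp
      also have "\<dots> = e" by (simp add: e'_def)
      finally have "N (d \<epsilon>) < e" .
      moreover have "0 \<le> N (d \<epsilon>)"
        using holder_le_nonneg[OF lower[OF upper(1)[OF elim]]] .
      ultimately show ?case by simp
    qed
  qed
qed

lemma holder_convergent_vec_iff:
  fixes y :: "real \<Rightarrow> real \<Rightarrow> complex ^ 'm"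
  assumes "\<forall>\<^sub>F \<epsilon> in at_right 0. y \<epsilon> \<in> holder_space_vec a b l \<alpha>" "y 0 \<in> holder_space_vec a b l \<alpha>"
  shows "holder_convergent_vec a b l \<alpha> y \<longleftrightarrow> vanishes l (\<lambda>\<epsilon> t. y \<epsilon> t - y 0 t)"
  unfolding holder_convergent_vec_def
proof (rule norm_tendsto_0_iff_vanishes[where S = "\<lambda>x. x \<in> holder_space_vec a b l \<alpha>"])
  show "\<forall>\<^sub>F \<epsilon> in at_right 0. (\<lambda>t. y \<epsilon> t - y 0 t) \<in> holder_space_vec a b l \<alpha>"
    using assms(1)
  proof eventually_elim
    case (elim \<epsilon>)
    then show ?case using assms(2) holder_le_diff unfolding holder_space_vec_iff by blast
  qed
qed (use holder_le_holder_norm_vec holder_le_holder_space_vec in blast)+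

lemma holder_convergent_mat_iff:
  fixes M :: "real \<Rightarrow> real \<Rightarrow> complex ^ 'm ^ 'm"
  assumes "\<forall>\<^sub>F \<epsilon> in at_right 0. M \<epsilon> \<in> holder_space_mat a b l \<alpha>" "M 0 \<in> holder_space_mat a b l \<alpha>"
  shows "holder_convergent_mat a b l \<alpha> M \<longleftrightarrow> vanishes l (\<lambda>\<epsilon> t. M \<epsilon> t - M 0 t)"
  unfolding holder_convergent_mat_def
proof (rule norm_tendsto_0_iff_vanishes[where S = "\<lambda>x. x \<in> holder_space_mat a b l \<alpha>"
      and C = "real CARD('m) * (real CARD('m) * (real l + 3))"])
  show "\<forall>\<^sub>F \<epsilon> in at_right 0. (\<lambda>t. M \<epsilon> t - M 0 t) \<in> holder_space_mat a b l \<alpha>"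
    using assms(1)
  proof eventually_elim
    case (elim \<epsilon>)
    then show ?case
      using holder_le_holder_space_mat(1)[OF holder_le_diff[OF holder_le_holder_norm_mat holder_le_holder_norm_mat]] assms(2)
      by blast
  qed
qed (use holder_le_holder_norm_mat holder_le_holder_space_mat in \<open>auto simp: mult.assoc\<close>)

section \<open>Linear differential equations\<close>

text \<open>
  The function \<open>(norm (y s)\<^sup>2 + K\<^sup>2) * exp (- (2 * R + 1) * (s - a))\<close> is nonincreasing, since the
  hypotheses give \<open>2 * (y s \<bullet> y' s) \<le> (2 * R + 1) * (norm (y s)\<^sup>2 + K\<^sup>2)\<close>.
\<close>

lemma gronwall:
  fixes y :: "real \<Rightarrow> 'e::real_inner"
  assumes deriv: "\<And>t. t \<in> {a..b} \<Longrightarrow> (y has_vector_derivative y' t) (at t within {a..b})"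
    and bound: "\<And>t. t \<in> {a..b} \<Longrightarrow> norm (y' t) \<le> R * norm (y t) + K"
    and init: "norm (y a) \<le> K" and "0 \<le> R" and t: "t \<in> {a..b}"
  shows "norm (y t) \<le> 2 * exp ((2 * R + 1) * (b - a)) * K"
proof -
  have K: "0 \<le> K" using init norm_ge_zero order_trans by blast
  define k where "k = 2 * R + 1"
  define \<phi> where "\<phi> s = (y s \<bullet> y s + K\<^sup>2) * exp (- (k * (s - a)))" for s
  have inner: "((\<lambda>s. y s \<bullet> y s) has_real_derivative 2 * (y s \<bullet> y' s)) (at s within {a..b})"
    if "s \<in> {a..b}" for s
    using bounded_bilinear.has_vector_derivative[OF bounded_bilinear_inner deriv[OF that] deriv[OF that]]
    by (simp add: has_real_derivative_iff_has_vector_derivative inner_commute)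
  have \<phi>: "(\<phi> has_real_derivative (2 * (y s \<bullet> y' s) - k * (y s \<bullet> y s + K\<^sup>2)) * exp (- (k * (s - a))))
      (at s within {a..b})" if "s \<in> {a..b}" for s
    unfolding \<phi>_def
    by (rule derivative_eq_intros inner[OF that] refl)+ (simp add: algebra_simps)
  have "\<phi> t \<le> \<phi> a"
  proof (rule DERIV_nonpos_imp_decreasing_open[where f = \<phi>])
    fix s assume s: "a < s" "s < t"
    then have s': "s \<in> {a..b}" using t by auto
    have "y s \<bullet> y' s \<le> norm (y s) * (R * norm (y s) + K)"
      using norm_cauchy_schwarz[of "y s" "y' s"] bound[OF s']
      by (meson mult_left_mono norm_ge_zero order_trans)
    moreover have "2 * (norm (y s) * K) \<le> (norm (y s))\<^sup>2 + K\<^sup>2"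
      using sum_squares_bound[of "norm (y s)" K] by simp
    moreover have "0 \<le> R * K\<^sup>2" using \<open>0 \<le> R\<close> by simp
    ultimately have "2 * (y s \<bullet> y' s) \<le> k * (y s \<bullet> y s + K\<^sup>2)"
      unfolding k_def power2_norm_eq_inner[symmetric] by (simp add: algebra_simps power2_eq_square)
    then have "(2 * (y s \<bullet> y' s) - k * (y s \<bullet> y s + K\<^sup>2)) * exp (- (k * (s - a))) \<le> 0"
      by (intro mult_nonpos_nonneg) auto
    moreover have "at s within {a..b} = at s"
      using s t by (intro at_within_Icc_at) auto
    ultimately show "\<exists>d. (\<phi> has_real_derivative d) (at s) \<and> d \<le> 0"
      using \<phi>[OF s'] by auto
  next
    have "continuous_on {a..b} \<phi>"
      using \<phi> by (rule DERIV_continuous_on)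
    then show "continuous_on {a..t} \<phi>"
      using t by (auto elim: continuous_on_subset)
  qed (use t in auto)
  also have "\<phi> a \<le> K\<^sup>2 + K\<^sup>2"
    using init power_mono[OF init, of 2] by (simp add: \<phi>_def power2_norm_eq_inner)
  finally have "(y t \<bullet> y t + K\<^sup>2) * exp (- (k * (t - a))) \<le> 2 * K\<^sup>2" by (simp add: \<phi>_def)
  then have "y t \<bullet> y t + K\<^sup>2 \<le> 2 * K\<^sup>2 * exp (k * (t - a))"
    unfolding exp_minus using exp_gt_zero[of "k * (t - a)"] by (simp only: pos_divide_le_eq flip: divide_inverse)
  then have "(norm (y t))\<^sup>2 \<le> 2 * K\<^sup>2 * exp (k * (t - a))"
    unfolding power2_norm_eq_inner using zero_le_power2[of K] by linarith
  \<comment> \<open>The crude constants make the right-hand side a square.\<close>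
  also have "\<dots> \<le> 4 * K\<^sup>2 * exp (2 * (k * (b - a)))"
  proof -
    have "k * (t - a) \<le> k * (b - a)" "0 \<le> k * (b - a)"
      using t ab \<open>0 \<le> R\<close> by (auto simp: k_def intro!: mult_left_mono)
    then show ?thesis by (intro mult_mono) auto
  qed
  also have "\<dots> = (2 * exp (k * (b - a)) * K)\<^sup>2"
    by (simp add: power_mult_distrib exp_double)
  finally show ?thesis
    using power2_le_imp_le K unfolding k_def by simp
qed

text \<open>
  The inequality of Gronwall bounds the values of \<open>y\<close>. Then the equation \<open>y' = f - A y\<close> bounds the
  derivative, first uniformly and then, since products are bounded in the Hoelder spaces, with one
  more order of differentiability in each step. The product is arbitrary in order to cover, besides
  \<open>y' = f - A y\<close> for vectors, the adjoint equation \<open>Z' = Z A\<close> for matrices.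
\<close>

lemma ode_estimate:
  fixes prod :: "'g::real_normed_vector \<Rightarrow> 'e::real_inner \<Rightarrow> 'e"
  assumes prod: "bounded_bilinear prod" and "0 \<le> R"
  shows "\<exists>C>0. \<forall>A f y K. holder_le n R A \<longrightarrow> holder_le n K f \<longrightarrow> norm (y a) \<le> K \<longrightarrow>
    (\<forall>t\<in>{a..b}. (y has_vector_derivative f t - prod (A t) (y t)) (at t within {a..b})) \<longrightarrow>
    holder_le (Suc n) (C * K) y"
proof -
  interpret prod: bounded_bilinear prod by (fact prod)
  obtain M where M: "0 < M" "\<And>u v. norm (prod u v) \<le> norm u * norm v * M"
    using prod.pos_bounded by blast
  have step: "\<exists>C'>0. \<forall>A f y K. holder_le n R A \<longrightarrow> holder_le n K f \<longrightarrow> holder_le n (C * K) y \<longrightarrow>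
      (\<forall>t\<in>{a..b}. (y has_vector_derivative f t - prod (A t) (y t)) (at t within {a..b})) \<longrightarrow>
      holder_le (Suc n) (C' * K) y" if "0 < C" "0 \<le> R" for C R n
  proof -
    obtain D where D: "0 < D"
      "\<And>A y K L. holder_le n K A \<Longrightarrow> holder_le n L y \<Longrightarrow> holder_le n (D * K * L) (\<lambda>t. prod (A t) (y t))"
      using holder_le_bilinear[OF prod, of n] by blast
    let ?C = "1 + D * R * C + C"
    have "holder_le (Suc n) (?C * K) y"
      if A: "holder_le n R A" and f: "holder_le n K f" and y: "holder_le n (C * K) y"
        and ode: "\<forall>t\<in>{a..b}. (y has_vector_derivative f t - prod (A t) (y t)) (at t within {a..b})"
      for A f y K
    proof -
      have nonneg: "0 \<le> K" "0 \<le> C * K" "0 \<le> D * R * C * K"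
        using holder_le_nonneg[OF f] D(1) that(1) \<open>0 < C\<close> \<open>0 \<le> R\<close> by auto
      have "holder_le n (K + D * R * (C * K)) (\<lambda>t. f t - prod (A t) (y t))"
        by (rule holder_le_diff[OF f D(2)[OF A y]])
      then have "holder_le n (?C * K) (\<lambda>t. f t - prod (A t) (y t))"
        by (rule holder_le_mono) (use nonneg in \<open>simp add: algebra_simps\<close>)
      moreover have "norm (y t) \<le> ?C * K" if "t \<in> {a..b}" for t
        using holder_le_norm[OF y that] nonneg by (simp add: algebra_simps)
      ultimately show ?thesis using ode by (intro holder_le_SucI) auto
    qed
    moreover have "0 < ?C" using D(1) that by (simp add: add_pos_nonneg)
    ultimately show ?thesis by blast
  qed
  show ?thesis
    using \<open>0 \<le> R\<close>
  proof (induction n arbitrary: R)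
    case (0 R)
    let ?G = "2 * exp ((2 * (M * R) + 1) * (b - a))"
    let ?C = "embed_const * (?G + (M * R * ?G + 1))"
    have C: "0 < ?C"
      using embed_const_ge_1 M(1) \<open>0 \<le> R\<close> by (intro mult_pos_pos add_pos_nonneg) auto
    have "holder_le 0 (?C * K) y"
      if A: "holder_le 0 R A" and f: "holder_le 0 K f" and init: "norm (y a) \<le> K"
        and ode: "\<forall>t\<in>{a..b}. (y has_vector_derivative f t - prod (A t) (y t)) (at t within {a..b})"
      for A f y K
    proof -
      define G where "G = ?G"
      have K: "0 \<le> K" using holder_le_nonneg[OF f] .
      have rhs: "norm (f t - prod (A t) (y t)) \<le> M * R * norm (y t) + K" if "t \<in> {a..b}" for t
      proof -
        have "norm (prod (A t) (y t)) \<le> norm (A t) * norm (y t) * M" by (rule M(2))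
        also have "\<dots> \<le> R * norm (y t) * M"
          using holder_le_norm[OF A that] M(1) by (intro mult_right_mono) auto
        finally show ?thesis
          using holder_le_norm[OF f that] norm_triangle_ineq4[of "f t" "prod (A t) (y t)"]
          by (simp add: mult_ac)
      qed
      have y: "norm (y t) \<le> G * K" if "t \<in> {a..b}" for t
        using ode rhs init that M(1) \<open>0 \<le> R\<close> unfolding G_def by (intro gronwall) auto
      have "holder_le 0 (embed_const * ((G + (M * R * G + 1)) * K)) y"
      proof (rule holder_le_0_of_derivative)
        fix t assume t: "t \<in> {a..b}"
        show "(y has_vector_derivative f t - prod (A t) (y t)) (at t within {a..b})"
          using ode t by blast
        have MR: "0 \<le> M * R" using M(1) \<open>0 \<le> R\<close> by simp
        have GK: "0 \<le> G * K" using K by (simp add: G_def)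
        have "0 \<le> M * R * (G * K)" using MR GK by (rule mult_nonneg_nonneg)
        then show "norm (y t) \<le> (G + (M * R * G + 1)) * K"
          using y[OF t] K by (simp add: distrib_right mult.assoc)
        have "M * R * norm (y t) \<le> M * R * (G * K)"
          using y[OF t] MR by (rule mult_left_mono)
        then have "norm (f t - prod (A t) (y t)) \<le> M * R * (G * K) + K"
          using rhs[OF t] by linarith
        then show "norm (f t - prod (A t) (y t)) \<le> (G + (M * R * G + 1)) * K"
          using GK by (simp add: distrib_right mult.assoc)
      qed
      then show ?thesis by (simp only: mult.assoc G_def)
    qed
    note base = this
    obtain C' where "C' > 0" and C': "\<And>A f y K. holder_le 0 R A \<Longrightarrow> holder_le 0 K f \<Longrightarrow> holder_le 0 (?C * K) y \<Longrightarrow>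
      (\<forall>t\<in>{a..b}. (y has_vector_derivative f t - prod (A t) (y t)) (at t within {a..b})) \<Longrightarrow>
      holder_le (Suc 0) (C' * K) y" using step[OF C \<open>0 \<le> R\<close>, of 0] by blast
    show ?case
      by (rule exI[of _ C'], intro conjI allI impI, fact, rule C', assumption, assumption,
          rule base, assumption+)
  next
    case (Suc n R)
    have "0 \<le> embed_const * R" using embed_const_ge_1 Suc.prems by simp
    from Suc.IH[OF this] obtain C where "C > 0" and
      C: "\<And>A f y K. holder_le n (embed_const * R) A \<Longrightarrow> holder_le n K f \<Longrightarrow> norm (y a) \<le> K \<Longrightarrow>
      (\<forall>t\<in>{a..b}. (y has_vector_derivative f t - prod (A t) (y t)) (at t within {a..b})) \<Longrightarrow>
      holder_le (Suc n) (C * K) y" by blast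
    have C1: "0 < C * embed_const" using \<open>C > 0\<close> embed_const_ge_1 by simp
    have base: "holder_le (Suc n) (C * embed_const * K) y"
      if A: "holder_le (Suc n) R A" and f: "holder_le (Suc n) K f" and init: "norm (y a) \<le> K"
        and ode: "\<forall>t\<in>{a..b}. (y has_vector_derivative f t - prod (A t) (y t)) (at t within {a..b})"
      for A f y K
    proof -
      have "K \<le> embed_const * K"
        using mult_right_mono[OF embed_const_ge_1 holder_le_nonneg[OF f]] by simp
      then have "norm (y a) \<le> embed_const * K" using init by simp
      then show ?thesis
        using C[OF holder_le_lower[OF A] holder_le_lower[OF f] _ ode] by (simp add: mult.assoc)
    qed
    obtain C' where "C' > 0" and C': "\<And>A f y K. holder_le (Suc n) R A \<Longrightarrow> holder_le (Suc n) K f \<Longrightarrow>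
      holder_le (Suc n) (C * embed_const * K) y \<Longrightarrow>
      (\<forall>t\<in>{a..b}. (y has_vector_derivative f t - prod (A t) (y t)) (at t within {a..b})) \<Longrightarrow>
      holder_le (Suc (Suc n)) (C' * K) y" using step[OF C1 Suc.prems, of "Suc n"] by blast
    show ?case
      by (rule exI[of _ C'], intro conjI allI impI, fact, rule C', assumption, assumption,
          rule base, assumption+)
  qed
qed

text \<open>
  The integral equation \<open>y t = c + integral {a..t} (f - A y)\<close> is solved by Banach's fixed point
  theorem on the whole interval at once: in the norm with the weight \<open>exp (- 2 * R * (t - a))\<close>, where
  \<open>R\<close> bounds the coefficients, the integral operator is a contraction with factor \<open>1/2\<close>.
\<close>

lemma ode_exists:
  fixes prod :: "'g::real_normed_vector \<Rightarrow> 'e::banach \<Rightarrow> 'e"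
  assumes prod: "bounded_bilinear prod" and A: "continuous_on {a..b} A" and f: "continuous_on {a..b} f"
  shows "\<exists>y. y a = c \<and>
    (\<forall>t\<in>{a..b}. (y has_vector_derivative f t - prod (A t) (y t)) (at t within {a..b}))"
proof -
  interpret prod: bounded_bilinear prod by (fact prod)
  obtain M where M: "0 < M" "\<And>u v. norm (prod u v) \<le> norm u * norm v * M"
    using prod.pos_bounded by blast
  have "compact (A ` {a..b})" using A by (intro compact_continuous_image) auto
  then obtain R0 where R0: "\<And>t. t \<in> {a..b} \<Longrightarrow> norm (A t) \<le> R0"
    using compact_imp_bounded bounded_iff by (metis imageI)
  define R where "R = \<bar>R0\<bar> * M + 1"
  have R: "0 < R" "norm (prod (A t) v) \<le> R * norm v" if "t \<in> {a..b}" for t v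
  proof -
    have "norm (prod (A t) v) \<le> norm (A t) * norm v * M" by (rule M(2))
    also have "\<dots> \<le> \<bar>R0\<bar> * norm v * M"
      using R0[OF that] M(1) by (intro mult_right_mono) auto
    also have "\<dots> \<le> R * norm v" by (simp add: R_def algebra_simps)
    finally show "norm (prod (A t) v) \<le> R * norm v" .
    show "0 < R" using M(1) by (simp add: R_def add_nonneg_pos)
  qed
  have R_pos: "0 < R" using R(1)[of a] ab by simp
  \<comment> \<open>The fixed point is sought for \<open>u = y / w\<close>, so that the usual supremum norm of \<open>u\<close> is the weighted one of \<open>y\<close>.\<close>
  define w where "w s = exp (2 * R * (s - a))" for s
  have w_pos: "0 < w s" for s by (simp add: w_def)
  define F where "F u s = f s - prod (A s) (w s *\<^sub>R u s)" for u :: "real \<Rightarrow> 'e" and s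
  define h where "h u t = inverse (w t) *\<^sub>R (c + integral {a..t} (F u))" for u :: "real \<Rightarrow> 'e" and t
  \<comment> \<open>Functions on \<open>{a..b}\<close> are extended to the real line along the retraction \<open>p\<close>, which makes them members of the complete space of bounded continuous functions.\<close>
  define p where "p t = max a (min b t)" for t
  have p: "p t \<in> {a..b}" and p_id: "t \<in> {a..b} \<Longrightarrow> p t = t" for t
    using ab by (auto simp: p_def)
  have F_cont: "continuous_on {a..b} (F u)" if "continuous_on {a..b} u" for u
    unfolding F_def w_def
    by (intro continuous_intros prod.continuous_on A f that)
  have h_cont: "continuous_on {a..b} (h u)" if "continuous_on {a..b} u" for u
    unfolding h_def w_def
    by (intro continuous_intros indefinite_integral_continuous_1 integrable_continuous_real
        F_cont that) auto
  define T where "T u = Bcontfun (\<lambda>t. h (apply_bcontfun u) (p t))" for u :: "real \<Rightarrow>\<^sub>C 'e"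
  have T: "apply_bcontfun (T u) t = h u (p t)" for u t
  proof -
    have "continuous_on UNIV (\<lambda>t. h u (p t))"
      by (rule continuous_on_compose2[OF h_cont])
        (auto simp: p_def intro!: continuous_intros, use ab in auto)
    moreover have "bounded (range (\<lambda>t. h u (p t)))"
    proof (rule bounded_subset)
      show "bounded (h u ` {a..b})"
        by (intro compact_imp_bounded compact_continuous_image h_cont) auto
      show "range (\<lambda>t. h u (p t)) \<subseteq> h u ` {a..b}" using p by auto
    qed
    ultimately show ?thesis
      unfolding T_def by (subst Bcontfun_inverse) (auto simp: bcontfun_def)
  qed
  have "dist (T u) (T v) \<le> 1/2 * dist u v" for u v
  proof (rule dist_bound)
    fix t
    define r where "r = p t"
    have r: "r \<in> {a..b}" using p by (simp add: r_def)
    then have sub: "{a..r} \<subseteq> {a..b}" by auto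
    have int: "F u integrable_on {a..r}" for u :: "real \<Rightarrow>\<^sub>C 'e"
      using continuous_on_subset[OF F_cont sub] by (intro integrable_continuous_real) simp
    have w_int: "((\<lambda>s. R * dist u v * w s) has_integral (dist u v / 2 * w r - dist u v / 2 * w a)) {a..r}"
    proof (rule fundamental_theorem_of_calculus)
      show "((\<lambda>s. dist u v / 2 * w s) has_vector_derivative R * dist u v * w s) (at s within {a..r})" for s
        unfolding w_def has_real_derivative_iff_has_vector_derivative[symmetric]
        by (rule derivative_eq_intros refl)+ simp
    qed (use r in auto)
    have "norm (integral {a..r} (F u) - integral {a..r} (F v)) = norm (integral {a..r} (\<lambda>s. F u s - F v s))"
      using int by (subst Henstock_Kurzweil_Integration.integral_diff) auto
    also have "\<dots> \<le> integral {a..r} (\<lambda>s. R * dist u v * w s)"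
    proof (rule integral_norm_bound_integral)
      show "(\<lambda>s. F u s - F v s) integrable_on {a..r}"
        using int by (intro Henstock_Kurzweil_Integration.integrable_diff)
      show "(\<lambda>s. R * dist u v * w s) integrable_on {a..r}"
        using w_int by (rule has_integral_integrable)
      fix s assume "s \<in> {a..r}"
      then have s: "s \<in> {a..b}" using sub by blast
      have "F u s - F v s = prod (A s) (w s *\<^sub>R (v s - u s))"
        by (simp add: F_def scaleR_diff_right prod.diff_right)
      then have "norm (F u s - F v s) \<le> R * norm (w s *\<^sub>R (v s - u s))"
        using R(2)[OF s, of "w s *\<^sub>R (v s - u s)"] by (simp only:)
      also have "\<dots> = R * w s * dist (v s) (u s)"
        using w_pos[of s] by (simp add: dist_norm)
      also have "\<dots> \<le> R * w s * dist u v"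
        using R_pos w_pos[of s] dist_bounded[of v s u] by (intro mult_left_mono) (auto simp: dist_commute)
      finally show "norm (F u s - F v s) \<le> R * dist u v * w s" by (simp add: mult_ac)
    qed
    also have "\<dots> = dist u v / 2 * w r - dist u v / 2 * w a"
      using w_int by (rule integral_unique)
    also have "\<dots> \<le> w r * (dist u v / 2)"
      using w_pos[of a] by simp
    finally have le: "norm (integral {a..r} (F u) - integral {a..r} (F v)) \<le> w r * (dist u v / 2)" .
    have "dist (T u t) (T v t) = inverse (w r) * norm (integral {a..r} (F u) - integral {a..r} (F v))"
      unfolding T r_def[symmetric] h_def dist_norm scaleR_diff_right[symmetric]
      using w_pos[of r] by simp
    also have "\<dots> \<le> inverse (w r) * (w r * (dist u v / 2))"
      using le w_pos[of r] by (intro mult_left_mono) auto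
    also have "\<dots> = 1/2 * dist u v"
      using w_pos[of r] by (simp flip: mult.assoc)
    finally show "dist (T u t) (T v t) \<le> 1/2 * dist u v" .
  qed
  then have "\<exists>!u. T u = u" by (intro banach_fix_type[of "1/2"]) auto
  then obtain u where u: "T u = u" by blast
  define y where "y t = w t *\<^sub>R u t" for t
  have y: "y t = c + integral {a..t} (\<lambda>s. f s - prod (A s) (y s))" if "t \<in> {a..b}" for t
  proof -
    have "u t = h u t" using T[of u t] u p_id[OF that] by simp
    then have "y t = w t *\<^sub>R h u t" by (simp add: y_def)
    also have "\<dots> = c + integral {a..t} (F u)"
      using w_pos[of t] by (simp add: h_def)
    finally show ?thesis by (simp add: F_def[abs_def] y_def)
  qed
  have "(y has_vector_derivative f t - prod (A t) (y t)) (at t within {a..b})" if t: "t \<in> {a..b}" for t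
  proof (rule has_vector_derivative_transform[OF t])
    have "continuous_on {a..b} (\<lambda>s. f s - prod (A s) (y s))"
      using F_cont[of u] by (simp add: F_def[abs_def] y_def)
    from integral_has_vector_derivative[OF this t]
    show "((\<lambda>t. c + integral {a..t} (\<lambda>s. f s - prod (A s) (y s))) has_vector_derivative
        f t - prod (A t) (y t)) (at t within {a..b})"
      using has_vector_derivative_add[OF has_vector_derivative_const[of c]] by fastforce
  qed (use y in auto)
  moreover have "y a = c" using y[of a] ab by simp
  ultimately show ?thesis by blast
qed

section \<open>Bounded operators and uniform boundedness\<close>

definition bounded_operator ::
    "nat \<Rightarrow> ((real \<Rightarrow> 'e::real_normed_vector) \<Rightarrow> 'f::real_normed_vector) \<Rightarrow> bool" where
  "bounded_operator l T \<longleftrightarrow>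
    (\<forall>x y K L. holder_le l K x \<longrightarrow> holder_le l L y \<longrightarrow> T (\<lambda>t. x t + y t) = T x + T y) \<and>
    (\<forall>c x K. holder_le l K x \<longrightarrow> T (\<lambda>t. c *\<^sub>R x t) = c *\<^sub>R T x) \<and>
    (\<exists>C. \<forall>x K. holder_le l K x \<longrightarrow> norm (T x) \<le> C * K)"

lemma
  assumes "bounded_operator l T"
  shows bounded_operator_add: "holder_le l K x \<Longrightarrow> holder_le l L y \<Longrightarrow> T (\<lambda>t. x t + y t) = T x + T y"
    and bounded_operator_scaleR: "holder_le l K x \<Longrightarrow> T (\<lambda>t. c *\<^sub>R x t) = c *\<^sub>R T x"
    and bounded_operator_bound: "\<exists>C. \<forall>x K. holder_le l K x \<longrightarrow> norm (T x) \<le> C * K"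
  using assms unfolding bounded_operator_def by blast+

lemma bounded_operator_diff:
  assumes T: "bounded_operator l T" and x: "holder_le l K x" and y: "holder_le l L y"
  shows "T (\<lambda>t. x t - y t) = T x - T y"
  using bounded_operator_add[OF T x holder_le_minus[OF y]] bounded_operator_scaleR[OF T y, of "-1"] by simp

text \<open>
  The difference of \<open>x\<close> and \<open>y\<close> lies in the ball of radius \<open>0\<close>.
\<close>

lemma bounded_operator_cong:
  assumes T: "bounded_operator l T" and x: "holder_le l K x" and eq: "\<And>t. t \<in> {a..b} \<Longrightarrow> x t = y t"
  shows "T x = T y"
proof -
  have y: "holder_le l K y" using x eq by (rule holder_le_cong)
  have "holder_le l 0 (\<lambda>t. x t - y t)"
    by (rule holder_le_cong[OF holder_le_zero]) (use eq in auto)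
  then have "norm (T (\<lambda>t. x t - y t)) \<le> 0"
    using bounded_operator_bound[OF T] by fastforce
  then show ?thesis using bounded_operator_diff[OF T x y] by simp
qed

text \<open>
  Continuity at \<open>0\<close> sends a small ball into the unit ball; rescaling turns this into a linear bound.
\<close>

lemma continuous_linear_operator_bounded:
  fixes T :: "(real \<Rightarrow> complex ^ 'm) \<Rightarrow> complex ^ 'm"
  assumes "continuous_linear_operator a b l \<alpha> T"
  shows "bounded_operator l T"
proof -
  note clo = assms[unfolded continuous_linear_operator_def]
  have mem: "x \<in> holder_space_vec a b l \<alpha>" if "holder_le l K x" for x :: "real \<Rightarrow> complex ^ 'm" and K
    using that by (rule holder_le_holder_space_vec(1))
  have add: "T (\<lambda>t. x t + y t) = T x + T y" if "holder_le l K x" "holder_le l L y" for x y K L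
    by (rule bspec[OF bspec[OF conjunct1[OF clo] mem[OF that(1)]] mem[OF that(2)]])
  have of_real: "complex_of_real c *s v = c *\<^sub>R v" for c and v :: "complex ^ 'm"
    unfolding vec_eq_iff by (simp add: scaleR_conv_of_real[where 'a = complex])
  have scale: "T (\<lambda>t. c *\<^sub>R x t) = c *\<^sub>R T x" if "holder_le l K x" for c x K
  proof -
    have "T (\<lambda>t. complex_of_real c *s x t) = complex_of_real c *s T x"
      by (rule bspec[OF spec[OF conjunct1[OF conjunct2[OF clo]]] mem[OF that]])
    then show ?thesis by (simp only: of_real)
  qed
  have zero: "holder_le l 0 (\<lambda>_. 0 :: complex ^ 'm)" "T (\<lambda>_. 0) = 0"
    using scale[OF holder_le_zero[of 0], of 0] by (simp_all add: holder_le_zero)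
  obtain d where d: "0 < d" "\<And>y. y \<in> holder_space_vec a b l \<alpha> \<Longrightarrow>
      holder_norm_vec a b l \<alpha> y < d \<Longrightarrow> norm (T y) < 1"
  proof -
    have "\<exists>d>0. \<forall>y\<in>holder_space_vec a b l \<alpha>.
        holder_norm_vec a b l \<alpha> (\<lambda>t. y t - 0) < d \<longrightarrow> norm (T y - T (\<lambda>_. 0)) < 1"
      using bspec[OF conjunct2[OF conjunct2[OF clo]] mem[OF zero(1)]] by simp
    then show ?thesis using zero(2) that by auto
  qed
  define N where "N = real CARD('m) * (real l + 3)"
  have N: "0 < N" by (simp add: N_def add_nonneg_pos)
  have bound: "norm (T x) \<le> 2 * N / d * K" if x: "holder_le l K x" and "0 < K" for x K
  proof -
    define r where "r = d / (2 * N * K)"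
    have r: "0 < r" using d(1) N \<open>0 < K\<close> by (simp add: r_def)
    have rx: "holder_le l (\<bar>r\<bar> * K) (\<lambda>t. r *\<^sub>R x t)" using x by (rule holder_le_scaleR)
    have "holder_norm_vec a b l \<alpha> (\<lambda>t. r *\<^sub>R x t) \<le> N * (\<bar>r\<bar> * K)"
      using holder_le_holder_space_vec(2)[OF rx] by (simp add: N_def)
    also have "\<dots> < d" using d(1) N \<open>0 < K\<close> by (simp add: r_def)
    finally have "norm (T (\<lambda>t. r *\<^sub>R x t)) < 1" using d(2) mem[OF rx] by blast
    then have "r * norm (T x) < 1" using scale[OF x, of r] r by simp
    then have "norm (T x) < 1 / r" using r by (simp add: field_simps)
    then show ?thesis by (simp add: r_def)
  qed
  \<comment> \<open>A radius \<open>K = 0\<close> does not permit rescaling and is approached from above.\<close>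
  have "norm (T x) \<le> 2 * N / d * K" if x: "holder_le l K x" for x K
  proof (rule field_le_epsilon)
    fix e :: real assume "0 < e"
    define k where "k = K + e * d / (2 * N)"
    have "0 < e * d / (2 * N)" using \<open>0 < e\<close> d(1) N by simp
    then have "0 < k" "K \<le> k" using holder_le_nonneg[OF x] by (auto simp: k_def)
    then have "norm (T x) \<le> 2 * N / d * k" using holder_le_mono[OF x] bound by blast
    then show "norm (T x) \<le> 2 * N / d * K + e"
      using d(1) N by (simp add: k_def algebra_simps)
  qed
  with add scale show ?thesis unfolding bounded_operator_def by blast
qed

text \<open>
  The Banach-Steinhaus theorem by a gliding hump. Let \<open>M k\<close> be the norm of \<open>T k\<close> and suppose that
  \<open>M (\<kappa> n) \<ge> 4 ^ n\<close>. Starting at \<open>0\<close>, take steps of length \<open>(1/3) ^ n\<close> in a direction in which \<open>T (\<kappa> n)\<close>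
  is nearly as large as its norm. As \<open>max (norm (u + v)) (norm (u - v)) \<ge> norm v\<close>, one of the two signs
  of the step leads to a point at which \<open>T (\<kappa> n)\<close> is at least \<open>2/3 * (1/3) ^ n * M (\<kappa> n)\<close>. All later
  steps together have length at most \<open>1/2 * (1/3) ^ n\<close>, so at the limit of the points \<open>T (\<kappa> n)\<close> is still
  at least \<open>1/6 * (4/3) ^ n\<close>, and the family is not bounded there.
\<close>

lemma uniform_boundedness:
  fixes T :: "nat \<Rightarrow> (real \<Rightarrow> 'e::banach) \<Rightarrow> 'f::real_normed_vector"
  assumes T: "\<And>k. bounded_operator l (T k)"
    and pointwise: "\<And>x K. holder_le l K x \<Longrightarrow> \<exists>C. \<forall>k. norm (T k x) \<le> C"
  shows "\<exists>C. \<forall>k x K. 0 < K \<longrightarrow> holder_le l K x \<longrightarrow> norm (T k x) \<le> C * K"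
proof (rule ccontr)
  assume unbounded: "\<nexists>C. \<forall>k x K. 0 < K \<longrightarrow> holder_le l K x \<longrightarrow> norm (T k x) \<le> C * K"
  define M where "M k = (SUP x\<in>{x. holder_le l 1 x}. norm (T k x))" for k
  have bdd: "bdd_above ((\<lambda>x. norm (T k x)) ` {x. holder_le l 1 x})" for k
  proof -
    obtain C where "\<And>x K. holder_le l K x \<Longrightarrow> norm (T k x) \<le> C * K"
      using bounded_operator_bound[OF T[of k]] by blast
    from this[of 1] show ?thesis by (intro bdd_aboveI[of _ C]) auto
  qed
  have ne: "{x :: real \<Rightarrow> 'e. holder_le l 1 x} \<noteq> {}" using holder_le_zero[of 1 l] by auto
  have M: "norm (T k x) \<le> M k * K" if x: "holder_le l K x" and "0 < K" for k x K
  proof -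
    have "holder_le l 1 (\<lambda>t. (1 / K) *\<^sub>R x t)" using holder_le_scaleR[OF x, of "1 / K"] \<open>0 < K\<close> by simp
    then have "norm (T k (\<lambda>t. (1 / K) *\<^sub>R x t)) \<le> M k"
      unfolding M_def by (intro cSUP_upper bdd) simp
    then show ?thesis
      using \<open>0 < K\<close> by (simp add: bounded_operator_scaleR[OF T x] field_simps)
  qed
  have "\<exists>k. 4 ^ n \<le> M k" for n :: nat
  proof (rule ccontr)
    assume "\<nexists>k. 4 ^ n \<le> M k"
    then have "M k \<le> 4 ^ n" for k by (simp add: not_le less_imp_le)
    then have "norm (T k x) \<le> 4 ^ n * K" if "0 < K" "holder_le l K x" for k x K
      using that by (intro order_trans[OF M[OF that(2,1)]] mult_right_mono) auto
    then have "\<exists>C. \<forall>k x K. 0 < K \<longrightarrow> holder_le l K x \<longrightarrow> norm (T k x) \<le> C * K"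
      by (intro exI[of _ "4 ^ n"]) blast
    with unbounded show False by (rule notE)
  qed
  then have "\<forall>n. \<exists>k. 4 ^ n \<le> M k" by blast
  from choice[OF this] obtain \<kappa> where \<kappa>: "\<And>n::nat. 4 ^ n \<le> M (\<kappa> n)" by blast
  have M_pos: "0 < M (\<kappa> n)" for n using \<kappa>[of n] by (rule less_le_trans[rotated]) simp
  have "\<exists>z. holder_le l 1 z \<and> 2/3 * M (\<kappa> n) \<le> norm (T (\<kappa> n) z)" for n
  proof -
    have "2/3 * M (\<kappa> n) < M (\<kappa> n)" using M_pos[of n] by simp
    then show ?thesis
      unfolding M_def using less_cSUP_iff[OF ne bdd, of "2/3 * M (\<kappa> n)" "\<kappa> n"]
      by (auto simp: M_def intro: less_imp_le)
  qed
  then have "\<forall>n. \<exists>z. holder_le l 1 z \<and> 2/3 * M (\<kappa> n) \<le> norm (T (\<kappa> n) z)" by blast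
  from choice[OF this] obtain z
    where z: "\<And>n. holder_le l 1 (z n)" "\<And>n. 2/3 * M (\<kappa> n) \<le> norm (T (\<kappa> n) (z n))"
    by blast
  define \<rho> :: "nat \<Rightarrow> real" where "\<rho> n = (1/3) ^ n" for n
  have \<rho>: "0 < \<rho> n" "\<rho> (Suc n) = \<rho> n / 3" for n by (auto simp: \<rho>_def)
  \<comment> \<open>The sign of each step is the one that makes the current operator larger.\<close>
  define s where "s = rec_nat (\<lambda>_. 0) (\<lambda>n x.
    if norm (T (\<kappa> n) (\<lambda>t. x t - \<rho> n *\<^sub>R z n t)) \<le> norm (T (\<kappa> n) (\<lambda>t. x t + \<rho> n *\<^sub>R z n t))
    then (\<lambda>t. x t + \<rho> n *\<^sub>R z n t) else (\<lambda>t. x t - \<rho> n *\<^sub>R z n t))"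
  have s_Suc: "s (Suc n) =
    (if norm (T (\<kappa> n) (\<lambda>t. s n t - \<rho> n *\<^sub>R z n t)) \<le> norm (T (\<kappa> n) (\<lambda>t. s n t + \<rho> n *\<^sub>R z n t))
    then (\<lambda>t. s n t + \<rho> n *\<^sub>R z n t) else (\<lambda>t. s n t - \<rho> n *\<^sub>R z n t))" for n
    by (simp add: s_def)
  have \<rho>z: "holder_le l (\<rho> n) (\<lambda>t. \<rho> n *\<^sub>R z n t)" for n
    using holder_le_scaleR[OF z(1), of "\<rho> n" n] \<rho>(1)[of n] by simp
  have s_diff: "holder_le l (\<rho> n) (\<lambda>t. s (Suc n) t - s n t)" for n
    using \<rho>z[of n] holder_le_minus[OF \<rho>z[of n]] by (simp add: s_Suc)
  have s_hb: "\<exists>K. holder_le l K (s n)" for n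
  proof (induction n)
    case 0
    then show ?case using holder_le_zero[of 0 l] by (auto simp: s_def)
  next
    case (Suc n)
    then obtain K where "holder_le l K (s n)" by blast
    from holder_le_add[OF s_diff[of n] this] show ?case by auto
  qed
  have s_large: "2/3 * M (\<kappa> n) * \<rho> n \<le> norm (T (\<kappa> n) (s (Suc n)))" for n
  proof -
    obtain K where K: "holder_le l K (s n)" using s_hb by blast
    let ?u = "T (\<kappa> n) (s n)" and ?v = "\<rho> n *\<^sub>R T (\<kappa> n) (z n)"
    have plus: "T (\<kappa> n) (\<lambda>t. s n t + \<rho> n *\<^sub>R z n t) = ?u + ?v"
      using bounded_operator_add[OF T K \<rho>z] bounded_operator_scaleR[OF T z(1)] by simp
    have minus: "T (\<kappa> n) (\<lambda>t. s n t - \<rho> n *\<^sub>R z n t) = ?u - ?v"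
      using bounded_operator_diff[OF T K \<rho>z] bounded_operator_scaleR[OF T z(1)] by simp
    have "norm v \<le> max (norm (u + v)) (norm (u - v))" for u v :: 'f
    proof -
      have "norm ((u + v) - (u - v)) \<le> norm (u + v) + norm (u - v)"
        by (rule norm_triangle_ineq4)
      moreover have "(u + v) - (u - v) = 2 *\<^sub>R v" by (simp add: scaleR_2)
      ultimately show ?thesis by (simp add: max_def)
    qed
    then have "norm ?v \<le> max (norm (?u + ?v)) (norm (?u - ?v))" .
    also have "\<dots> = norm (T (\<kappa> n) (s (Suc n)))"
      by (simp add: s_Suc plus minus max_def)
    finally have "\<rho> n * norm (T (\<kappa> n) (z n)) \<le> norm (T (\<kappa> n) (s (Suc n)))"
      using \<rho>(1)[of n] by simp
    moreover have "2/3 * M (\<kappa> n) * \<rho> n \<le> \<rho> n * norm (T (\<kappa> n) (z n))"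
      using mult_right_mono[OF z(2), of "\<rho> n" n] \<rho>(1)[of n] by (simp add: mult_ac)
    ultimately show ?thesis by simp
  qed
  \<comment> \<open>The steps from \<open>k\<close> to \<open>j\<close> form a geometric sum with ratio \<open>1/3\<close>.\<close>
  have s_cauchy': "holder_le l (3/2 * (\<rho> k - \<rho> j)) (\<lambda>t. s j t - s k t)" if "k \<le> j" for j k
    using that
  proof (induction j rule: dec_induct)
    case base
    then show ?case by (simp add: holder_le_zero)
  next
    case (step j)
    have "holder_le l (\<rho> j + 3/2 * (\<rho> k - \<rho> j)) (\<lambda>t. s (Suc j) t - s k t)"
      using holder_le_add[OF s_diff[of j] step.IH] by simp
    then show ?case by (rule holder_le_mono) (simp add: \<rho>(2) field_simps)
  qed
  have s_cauchy: "holder_le l (3/2 * \<rho> k) (\<lambda>t. s j t - s k t)" if "k \<le> j" for j k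
    using holder_le_mono[OF s_cauchy'[OF that]] \<rho>(1)[of j] by simp
  have "(\<lambda>k. 3/2 * \<rho> k) \<longlonglongrightarrow> 0"
    unfolding \<rho>_def by (intro tendsto_mult_right_zero LIMSEQ_power_zero) simp
  from holder_le_complete[OF s_hb s_cauchy this] obtain x K where
    x: "holder_le l K x" "\<And>k. holder_le l (3/2 * \<rho> k) (\<lambda>t. x t - s k t)" by blast
  obtain C where C: "\<And>k. norm (T k x) \<le> C" using pointwise[OF x(1)] by blast
  have "(4/3) ^ n \<le> 6 * C" for n :: nat
  proof -
    have tail: "norm (T (\<kappa> n) (\<lambda>t. x t - s (Suc n) t)) \<le> M (\<kappa> n) * (\<rho> n / 2)"
      using M[OF x(2)[of "Suc n"], of "\<kappa> n"] \<rho>(1)[of n] by (simp add: \<rho>(2))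
    obtain L where "holder_le l L (s (Suc n))" using s_hb by blast
    then have "T (\<kappa> n) (\<lambda>t. x t - s (Suc n) t) = T (\<kappa> n) x - T (\<kappa> n) (s (Suc n))"
      by (rule bounded_operator_diff[OF T x(1)])
    then have "norm (T (\<kappa> n) (s (Suc n))) \<le> norm (T (\<kappa> n) x) + norm (T (\<kappa> n) (\<lambda>t. x t - s (Suc n) t))"
      using norm_triangle_ineq4[of "T (\<kappa> n) x" "T (\<kappa> n) x - T (\<kappa> n) (s (Suc n))"] by simp
    with tail s_large[of n] C[of "\<kappa> n"] have "M (\<kappa> n) * \<rho> n \<le> 6 * C"
      by (simp add: algebra_simps)
    moreover have "4 ^ n * \<rho> n \<le> M (\<kappa> n) * \<rho> n"
      using \<kappa>[of n] \<rho>(1)[of n] by (intro mult_right_mono) auto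
    moreover have "4 ^ n * \<rho> n = (4/3) ^ n" by (simp add: \<rho>_def power_divide)
    ultimately show ?thesis by simp
  qed
  moreover obtain n :: nat where "6 * C < (4/3) ^ n"
    using real_arch_pow[of "4/3" "6 * C"] by auto
  ultimately show False by (simp add: not_le[symmetric])
qed

text \<open>
  If no constant works near \<open>0\<close>, then for every \<open>k\<close> the constant \<open>k + 1\<close> fails at some parameter
  below \<open>1 / (k + 1)\<close>. The operators at these parameters converge pointwise and hence contradict the
  theorem for sequences.
\<close>

lemma uniform_boundedness_at_right:
  fixes T :: "real \<Rightarrow> (real \<Rightarrow> 'e::banach) \<Rightarrow> 'f::real_normed_vector"
  assumes T: "\<forall>\<^sub>F \<epsilon> in at_right 0. bounded_operator l (T \<epsilon>)"
    and lim: "\<And>x K. holder_le l K x \<Longrightarrow> ((\<lambda>\<epsilon>. T \<epsilon> x) \<longlongrightarrow> T 0 x) (at_right 0)"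
  shows "\<exists>C>0. \<forall>\<^sub>F \<epsilon> in at_right 0. \<forall>x K. 0 < K \<longrightarrow> holder_le l K x \<longrightarrow> norm (T \<epsilon> x) \<le> C * K"
proof (rule ccontr)
  assume contr: "\<not> ?thesis"
  have "\<exists>\<epsilon>. 0 < \<epsilon> \<and> \<epsilon> < 1 / real (Suc k) \<and> bounded_operator l (T \<epsilon>) \<and>
    (\<exists>x K. 0 < K \<and> holder_le l K x \<and> real (Suc k) * K < norm (T \<epsilon> x))" for k
  proof -
    have "\<not> (\<forall>\<^sub>F \<epsilon> in at_right 0. \<forall>x K. 0 < K \<longrightarrow> holder_le l K x \<longrightarrow> norm (T \<epsilon> x) \<le> real (Suc k) * K)"
    proof
      assume h: "\<forall>\<^sub>F \<epsilon> in at_right 0. \<forall>x K. 0 < K \<longrightarrow> holder_le l K x \<longrightarrow> norm (T \<epsilon> x) \<le> real (Suc k) * K"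
      have "0 < real (Suc k)" by simp
      with h contr show False by blast
    qed
    then have freq: "\<exists>\<^sub>F \<epsilon> in at_right 0.
        \<not> (\<forall>x K. 0 < K \<longrightarrow> holder_le l K x \<longrightarrow> norm (T \<epsilon> x) \<le> real (Suc k) * K)"
      by (simp only: frequently_def not_not not_False_eq_True)
    have "\<forall>\<^sub>F \<epsilon> in at_right (0::real). \<epsilon> \<in> {0<..<1 / real (Suc k)}"
      by (rule eventually_at_right_real) simp
    from frequently_eventually_frequently[OF freq eventually_conj[OF this T]]
    obtain \<epsilon> where "\<not> (\<forall>x K. 0 < K \<longrightarrow> holder_le l K x \<longrightarrow> norm (T \<epsilon> x) \<le> real (Suc k) * K)"
      "\<epsilon> \<in> {0<..<1 / real (Suc k)}" "bounded_operator l (T \<epsilon>)"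
      by (elim frequentlyE conjE)
    then show ?thesis unfolding not_le[symmetric] by (intro exI[of _ \<epsilon>]) auto
  qed
  then have "\<forall>k. \<exists>\<epsilon>. 0 < \<epsilon> \<and> \<epsilon> < 1 / real (Suc k) \<and> bounded_operator l (T \<epsilon>) \<and>
    (\<exists>x K. 0 < K \<and> holder_le l K x \<and> real (Suc k) * K < norm (T \<epsilon> x))" by (rule allI)
  from choice[OF this] obtain \<epsilon> where "\<forall>k. 0 < \<epsilon> k \<and> \<epsilon> k < 1 / real (Suc k) \<and>
    bounded_operator l (T (\<epsilon> k)) \<and>
    (\<exists>x K. 0 < K \<and> holder_le l K x \<and> real (Suc k) * K < norm (T (\<epsilon> k) x))" ..
  then have \<epsilon>: "\<And>k. 0 < \<epsilon> k" "\<And>k. \<epsilon> k < 1 / real (Suc k)"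
    "\<And>k. bounded_operator l (T (\<epsilon> k))"
    "\<And>k. \<exists>x K. 0 < K \<and> holder_le l K x \<and> real (Suc k) * K < norm (T (\<epsilon> k) x)" by simp_all
  have "\<epsilon> \<longlonglongrightarrow> 0"
  proof (rule tendsto_sandwich[where f = "\<lambda>_. 0" and h = "\<lambda>k. 1 / real (Suc k)"])
    show "(\<lambda>k. 1 / real (Suc k)) \<longlonglongrightarrow> 0"
      using LIMSEQ_inverse_real_of_nat by (simp add: inverse_eq_divide)
  qed (use \<epsilon>(1,2) in \<open>auto intro!: always_eventually less_imp_le\<close>)
  then have \<epsilon>_lim: "filterlim \<epsilon> (at_right 0) sequentially"
    using \<epsilon>(1) by (simp add: filterlim_at order_less_imp_not_eq2)
  have "\<exists>C. \<forall>k. norm (T (\<epsilon> k) x) \<le> C" if "holder_le l K x" for x K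
  proof -
    have "(\<lambda>k. T (\<epsilon> k) x) \<longlonglongrightarrow> T 0 x"
      using filterlim_compose[OF lim[OF that] \<epsilon>_lim] .
    then have "Bseq (\<lambda>k. T (\<epsilon> k) x)" using convergent_imp_Bseq convergentI by blast
    then obtain C where "\<forall>k. norm (T (\<epsilon> k) x) \<le> C" by (rule BseqE)
    then show ?thesis ..
  qed
  then have "\<exists>C. \<forall>k x K. 0 < K \<longrightarrow> holder_le l K x \<longrightarrow> norm (T (\<epsilon> k) x) \<le> C * K"
    by (rule uniform_boundedness[OF \<epsilon>(3)])
  then obtain C where
    C: "\<And>k x K. 0 < K \<Longrightarrow> holder_le l K x \<Longrightarrow> norm (T (\<epsilon> k) x) \<le> C * K" by blast
  obtain k where k: "C < real k" using reals_Archimedean2 by blast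
  obtain x K where xK: "0 < K" "holder_le l K x" "real (Suc k) * K < norm (T (\<epsilon> k) x)"
    using \<epsilon>(4)[of k] by blast
  have "C * K \<le> real (Suc k) * K" using k xK(1) by (intro mult_right_mono) auto
  with C[OF xK(1,2), of k] xK(3) show False by linarith
qed

lemma vanishes_eventually: "vanishes l d \<Longrightarrow> 0 < e \<Longrightarrow> \<forall>\<^sub>F \<epsilon> in at_right 0. holder_le l e (d \<epsilon>)"
  by (simp add: vanishes_def)

text \<open>
  Most limits below are obtained in this way from a linear estimate of one family by another.
\<close>

lemma vanishes_transfer:
  assumes d: "vanishes l d" and "0 < C"
    and bound: "\<forall>\<^sub>F \<epsilon> in at_right 0. \<forall>K>0. holder_le l K (d \<epsilon>) \<longrightarrow> holder_le l' (C * K) (d' \<epsilon>)"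
  shows "vanishes l' d'"
  unfolding vanishes_def
proof (intro allI impI)
  fix e :: real assume "0 < e"
  then have "0 < e / C" using \<open>0 < C\<close> by simp
  from bound vanishes_eventually[OF d this] show "\<forall>\<^sub>F \<epsilon> in at_right 0. holder_le l' e (d' \<epsilon>)"
  proof eventually_elim
    case (elim \<epsilon>)
    then have "holder_le l' (C * (e / C)) (d' \<epsilon>)" using \<open>0 < e / C\<close> by blast
    then show ?case using \<open>0 < C\<close> by simp
  qed
qed

lemma vanishes_add:
  assumes "vanishes l d" "vanishes l d'"
  shows "vanishes l (\<lambda>\<epsilon> t. d \<epsilon> t + d' \<epsilon> t)"
  unfolding vanishes_def
proof (intro allI impI)
  fix e :: real assume "0 < e"
  then have "0 < e / 2" by simp
  from vanishes_eventually[OF assms(1) this] vanishes_eventually[OF assms(2) this]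
  show "\<forall>\<^sub>F \<epsilon> in at_right 0. holder_le l e (\<lambda>t. d \<epsilon> t + d' \<epsilon> t)"
    by eventually_elim (use holder_le_add in fastforce)
qed

lemma vanishes_minus: "vanishes l d \<Longrightarrow> vanishes l (\<lambda>\<epsilon> t. - d \<epsilon> t)"
  by (rule vanishes_transfer[where C = 1]) (auto intro: holder_le_minus always_eventually)

lemma vanishes_diff:
  "vanishes l d \<Longrightarrow> vanishes l d' \<Longrightarrow> vanishes l (\<lambda>\<epsilon> t. d \<epsilon> t - d' \<epsilon> t)"
  using vanishes_add[of l d "\<lambda>\<epsilon> t. - d' \<epsilon> t"] vanishes_minus[of l d'] by simp

lemma vanishes_cong:
  assumes "vanishes l d" and "\<forall>\<^sub>F \<epsilon> in at_right 0. \<forall>t\<in>{a..b}. d \<epsilon> t = d' \<epsilon> t"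
  shows "vanishes l d'"
  using assms(1)
proof (rule vanishes_transfer[where C = 1])
  show "\<forall>\<^sub>F \<epsilon> in at_right 0. \<forall>K>0. holder_le l K (d \<epsilon>) \<longrightarrow> holder_le l (1 * K) (d' \<epsilon>)"
    using assms(2) by eventually_elim (auto intro: holder_le_cong)
qed simp

lemma vanishes_prod_left:
  fixes prod :: "'e::real_normed_vector \<Rightarrow> 'f::real_normed_vector \<Rightarrow> 'g::real_normed_vector"
  assumes prod: "bounded_bilinear prod" and d: "vanishes l d" and y: "holder_le l L y"
  shows "vanishes l (\<lambda>\<epsilon> t. prod (d \<epsilon> t) (y t))"
proof -
  obtain C where C: "0 < C" "\<And>x y K L. holder_le l K x \<Longrightarrow> holder_le l L y \<Longrightarrow> holder_le l (C * K * L) (\<lambda>t. prod (x t) (y t))"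
    using holder_le_bilinear[OF prod] by blast
  have "0 \<le> L" using y by (rule holder_le_nonneg)
  show ?thesis
    using d
  proof (rule vanishes_transfer[where C = "C * (L + 1)"])
    have "holder_le l (C * (L + 1) * K) (\<lambda>t. prod (d \<epsilon> t) (y t))" if "holder_le l K (d \<epsilon>)" for \<epsilon> K
      using C(2)[OF that holder_le_mono[OF y, of "L + 1"]] by (simp add: mult_ac)
    then show "\<forall>\<^sub>F \<epsilon> in at_right 0. \<forall>K>0. holder_le l K (d \<epsilon>) \<longrightarrow>
        holder_le l (C * (L + 1) * K) (\<lambda>t. prod (d \<epsilon> t) (y t))" by (intro always_eventually) blast
  qed (use C(1) \<open>0 \<le> L\<close> in simp)
qed

lemma vanishes_tendsto:
  assumes d: "vanishes l d" and t: "t \<in> {a..b}"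
  shows "((\<lambda>\<epsilon>. d \<epsilon> t) \<longlongrightarrow> 0) (at_right 0)"
proof (rule tendstoI)
  fix e :: real assume "0 < e"
  then have "0 < e / 2" by simp
  from vanishes_eventually[OF d this] show "\<forall>\<^sub>F \<epsilon> in at_right 0. dist (d \<epsilon> t) 0 < e"
  proof eventually_elim
    case (elim \<epsilon>)
    then show ?case using holder_le_norm[OF elim t] \<open>0 < e\<close> by simp
  qed
qed

section \<open>Solutions and their dependence on the coefficients\<close>

text \<open>
  The equation \<open>y' + A y = f\<close> on \<open>{a..b}\<close>, in a form that includes the differentiability of \<open>y\<close>.
\<close>

definition ode ::
    "(real \<Rightarrow> complex ^ 'm ^ 'm) \<Rightarrow> (real \<Rightarrow> complex ^ 'm) \<Rightarrow> (real \<Rightarrow> complex ^ 'm) \<Rightarrow> bool" where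
  "ode A f y \<longleftrightarrow> (\<forall>t\<in>{a..b}. (y has_vector_derivative f t - A t *v y t) (at t within {a..b}))"

lemma ode_iff_L_op:
  assumes "holder_le (Suc l) K y"
  shows "ode A f y \<longleftrightarrow> (\<forall>t\<in>{a..b}. L_op a b A y t = f t)"
proof -
  have "(y has_vector_derivative vector_derivative y (at t within {a..b})) (at t within {a..b})"
    if "t \<in> {a..b}" for t
    using assms that vector_derivative_works unfolding holder_le_Suc_iff differentiable_on_def by blast
  then have "(y has_vector_derivative v) (at t within {a..b}) \<longleftrightarrow> vector_derivative y (at t within {a..b}) = v"
    if "t \<in> {a..b}" for t v
    using vector_derivative_Icc[OF that, of y v] that by auto
  then show ?thesis by (simp add: ode_def L_op_def eq_diff_eq)
qed

lemma bvp_solution_iff: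
  "bvp_solution a b n \<alpha> A T f p y \<longleftrightarrow> (\<exists>K. holder_le (Suc n) K y) \<and> ode A f y \<and> T y = p"
proof -
  have "ode A f y \<longleftrightarrow> (\<forall>t\<in>{a..b}. L_op a b A y t = f t)" if "\<exists>K. holder_le (Suc n) K y"
    using that ode_iff_L_op by blast
  then show ?thesis
    unfolding bvp_solution_def holder_space_vec_iff Suc_eq_plus1[symmetric] by blast
qed

lemma ode_add:
  assumes "ode A f y" "ode A g z"
  shows "ode A (\<lambda>t. f t + g t) (\<lambda>t. y t + z t)"
  unfolding ode_def
proof
  fix t assume "t \<in> {a..b}"
  with assms show "((\<lambda>t. y t + z t) has_vector_derivative f t + g t - A t *v (y t + z t)) (at t within {a..b})"
    unfolding ode_def
    by (auto intro!: has_vector_derivative_eq_rhs[OF has_vector_derivative_add]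
        simp: matrix_vector_right_distrib simp del: atLeastAtMost_iff)
qed

lemma ode_scaleR:
  assumes "ode A f y"
  shows "ode A (\<lambda>t. c *\<^sub>R f t) (\<lambda>t. c *\<^sub>R y t)"
  unfolding ode_def
proof
  fix t assume t: "t \<in> {a..b}"
  have *: "c *\<^sub>R f t - A t *v (c *\<^sub>R y t) = c *\<^sub>R (f t - A t *v y t)"
    using bounded_bilinear.scaleR_right[OF bounded_bilinear_matrix_vector_mult]
    by (simp add: scaleR_diff_right)
  show "((\<lambda>t. c *\<^sub>R y t) has_vector_derivative c *\<^sub>R f t - A t *v (c *\<^sub>R y t)) (at t within {a..b})"
    unfolding * using assms t unfolding ode_def
    by (intro bounded_linear.has_vector_derivative[OF bounded_linear_scaleR_right]) blast
qed

lemma ode_diff: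
  assumes "ode A f y" "ode A g z"
  shows "ode A (\<lambda>t. f t - g t) (\<lambda>t. y t - z t)"
  using ode_add[OF assms(1) ode_scaleR[OF assms(2), of "-1"]] by simp

text \<open>
  A change of the coefficients is moved to the right-hand side; so solutions for different parameters
  can be compared within one equation.
\<close>

lemma ode_perturb:
  assumes "ode A f y"
  shows "ode A' (\<lambda>t. f t + (A' t - A t) *v y t) y"
  using assms unfolding ode_def by (simp add: matrix_vector_mult_diff_rdistrib)

lemma ode_cong:
  assumes "ode A f y" "\<And>t. t \<in> {a..b} \<Longrightarrow> f t = g t"
  shows "ode A g y"
  using assms unfolding ode_def by simp

lemma ode_holder_le:
  fixes n and R :: real
  assumes "0 \<le> R"
  obtains C where "0 < C" and "\<And>A f (y :: real \<Rightarrow> complex ^ 'm) K.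
    holder_le n R A \<Longrightarrow> holder_le n K f \<Longrightarrow> norm (y a) \<le> K \<Longrightarrow> ode A f y \<Longrightarrow> holder_le (Suc n) (C * K) y"
proof -
  from ode_estimate[OF bounded_bilinear_matrix_vector_mult assms, of n]
  obtain C where C: "0 < C" and bound: "\<forall>A f (y :: real \<Rightarrow> complex ^ 'm) K. holder_le n R A \<longrightarrow> holder_le n K f \<longrightarrow>
    norm (y a) \<le> K \<longrightarrow> (\<forall>t\<in>{a..b}. (y has_vector_derivative f t - A t *v y t) (at t within {a..b})) \<longrightarrow>
    holder_le (Suc n) (C * K) y" by (elim exE conjE)
  show thesis
    by (rule that[OF C]) (use bound in \<open>simp add: ode_def\<close>)
qed

lemma ode_unique:
  fixes A :: "real \<Rightarrow> complex ^ 'm ^ 'm"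
  assumes A: "holder_le n R A" and "ode A f y" "ode A f z" "y a = z a" and t: "t \<in> {a..b}"
  shows "y t = z t"
proof -
  have diff: "ode A (\<lambda>_. 0) (\<lambda>t. y t - z t)"
    using ode_diff[OF assms(2,3)] by simp
  obtain C where "\<And>A f (y :: real \<Rightarrow> complex ^ 'm) K. holder_le n R A \<Longrightarrow> holder_le n K f \<Longrightarrow> norm (y a) \<le> K \<Longrightarrow>
      ode A f y \<Longrightarrow> holder_le (Suc n) (C * K) y"
    using holder_le_nonneg[OF A] by (rule ode_holder_le[where n = n]) blast
  from this[OF A holder_le_zero _ diff, of 0] have "holder_le (Suc n) (C * 0) (\<lambda>t. y t - z t)"
    using \<open>y a = z a\<close> by simp
  from holder_le_norm[OF this t] show ?thesis by simp
qed

definition cauchy_solution ::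
    "(real \<Rightarrow> complex ^ 'm ^ 'm) \<Rightarrow> (real \<Rightarrow> complex ^ 'm) \<Rightarrow> complex ^ 'm \<Rightarrow> real \<Rightarrow> complex ^ 'm" where
  "cauchy_solution A f c = (SOME y. y a = c \<and> ode A f y)"

lemma cauchy_solution:
  fixes A :: "real \<Rightarrow> complex ^ 'm ^ 'm"
  assumes A: "holder_le n R A" and f: "holder_le n K f"
  shows "cauchy_solution A f c a = c" and "ode A f (cauchy_solution A f c)" and "\<exists>K. holder_le (Suc n) K (cauchy_solution A f c)"
proof -
  have "\<exists>y. y a = c \<and> ode A f y"
    unfolding ode_def
    by (rule ode_exists[OF bounded_bilinear_matrix_vector_mult holder_le_continuous[OF A] holder_le_continuous[OF f]])
  then have *: "cauchy_solution A f c a = c \<and> ode A f (cauchy_solution A f c)"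
    unfolding cauchy_solution_def by (rule someI_ex)
  then show c: "cauchy_solution A f c a = c" and o: "ode A f (cauchy_solution A f c)" by auto
  obtain C where C: "\<And>A f (y :: real \<Rightarrow> complex ^ 'm) K. holder_le n R A \<Longrightarrow> holder_le n K f \<Longrightarrow> norm (y a) \<le> K \<Longrightarrow> ode A f y \<Longrightarrow>
      holder_le (Suc n) (C * K) y"
    using holder_le_nonneg[OF A] by (rule ode_holder_le[where n = n]) blast
  have "holder_le (Suc n) (C * max K (norm c)) (cauchy_solution A f c)"
    by (rule C[OF A holder_le_mono[OF f] _ o]) (use c in auto)
  then show "\<exists>K. holder_le (Suc n) K (cauchy_solution A f c)" by blast
qed

text \<open>
  The difference of \<open>y \<epsilon>\<close> and \<open>y 0\<close> solves the equation with the coefficients \<open>A \<epsilon>\<close> and the right-hand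
  side \<open>(f \<epsilon> - f 0) - (A \<epsilon> - A 0) (y 0)\<close>, which vanishes in the limit, and the constant of the Cauchy
  problem depends only on the common bound \<open>R\<close> of the coefficients.
\<close>

lemma ode_solutions_converge:
  fixes A :: "real \<Rightarrow> real \<Rightarrow> complex ^ 'm ^ 'm"
  assumes AR: "\<forall>\<^sub>F \<epsilon> in at_right 0. holder_le n R (A \<epsilon>)" and A0: "vanishes n (\<lambda>\<epsilon> t. A \<epsilon> t - A 0 t)"
    and y: "\<forall>\<^sub>F \<epsilon> in at_right 0. ode (A \<epsilon>) (f \<epsilon>) (y \<epsilon>)" and y0: "ode (A 0) (f 0) (y 0)" "holder_le (Suc n) L (y 0)"
    and f: "vanishes n (\<lambda>\<epsilon> t. f \<epsilon> t - f 0 t)"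
    and init: "((\<lambda>\<epsilon>. y \<epsilon> a) \<longlongrightarrow> y 0 a) (at_right 0)"
  shows "vanishes (Suc n) (\<lambda>\<epsilon> t. y \<epsilon> t - y 0 t)"
proof -
  have R: "holder_le n (\<bar>R\<bar>) (A \<epsilon>)" if "holder_le n R (A \<epsilon>)" for \<epsilon>
    using that by (rule holder_le_mono) simp
  obtain C where C: "0 < C" "\<And>A f (y :: real \<Rightarrow> complex ^ 'm) K. holder_le n \<bar>R\<bar> A \<Longrightarrow> holder_le n K f \<Longrightarrow> norm (y a) \<le> K \<Longrightarrow> ode A f y \<Longrightarrow>
      holder_le (Suc n) (C * K) y"
    using abs_ge_zero[of R] by (rule ode_holder_le[where n = n]) blast
  define g where "g \<epsilon> t = (f \<epsilon> t - f 0 t) - (A \<epsilon> t - A 0 t) *v y 0 t" for \<epsilon> t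
  have "vanishes n g"
    unfolding g_def
    by (intro vanishes_diff f vanishes_prod_left[OF bounded_bilinear_matrix_vector_mult A0 holder_le_lower[OF y0(2)]])
  have diff: "ode (A \<epsilon>) (g \<epsilon>) (\<lambda>t. y \<epsilon> t - y 0 t)" if "ode (A \<epsilon>) (f \<epsilon>) (y \<epsilon>)" for \<epsilon>
    by (rule ode_cong[OF ode_diff[OF that ode_perturb[OF y0(1)]]]) (simp add: g_def)
  show ?thesis
    unfolding vanishes_def
  proof (intro allI impI)
    fix e :: real assume "0 < e"
    then have eC: "0 < e / C" using C(1) by simp
    from AR y vanishes_eventually[OF \<open>vanishes n g\<close> eC] tendstoD[OF init eC]
    show "\<forall>\<^sub>F \<epsilon> in at_right 0. holder_le (Suc n) e (\<lambda>t. y \<epsilon> t - y 0 t)"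
    proof eventually_elim
      case (elim \<epsilon>)
      then have "holder_le (Suc n) (C * (e / C)) (\<lambda>t. y \<epsilon> t - y 0 t)"
        by (intro C(2)[OF R _ _ diff]) (auto simp: dist_norm)
      then show ?case using C(1) by simp
    qed
  qed
qed

text \<open>
  The difference of \<open>B \<epsilon> (y \<epsilon>)\<close> and \<open>B \<epsilon> y0\<close> is at most \<open>C\<close> times the distance of \<open>y \<epsilon>\<close> and \<open>y0\<close>. This
  is where uniform boundedness is indispensable: argument and operator move at the same time.
\<close>

lemma operators_converge:
  assumes B: "\<forall>\<^sub>F \<epsilon> in at_right 0. bounded_operator l (B \<epsilon>)"
    and bound: "\<forall>\<^sub>F \<epsilon> in at_right 0. \<forall>x K. 0 < K \<longrightarrow> holder_le l K x \<longrightarrow> norm (B \<epsilon> x) \<le> C * K" "0 < C"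
    and y: "vanishes l (\<lambda>\<epsilon> t. y \<epsilon> t - y0 t)" and y0: "holder_le l L y0"
    and lim: "((\<lambda>\<epsilon>. B \<epsilon> y0) \<longlongrightarrow> q) (at_right 0)"
  shows "((\<lambda>\<epsilon>. B \<epsilon> (y \<epsilon>)) \<longlongrightarrow> q) (at_right 0)"
proof -
  have "((\<lambda>\<epsilon>. B \<epsilon> y0 - B \<epsilon> (y \<epsilon>)) \<longlongrightarrow> 0) (at_right 0)"
  proof (rule tendstoI)
    fix e :: real assume "0 < e"
    then have "0 < e / (2 * C)" using bound(2) by simp
    from B bound(1) vanishes_eventually[OF y this]
    show "\<forall>\<^sub>F \<epsilon> in at_right 0. dist (B \<epsilon> y0 - B \<epsilon> (y \<epsilon>)) 0 < e"
    proof eventually_elim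
      case (elim \<epsilon>)
      from holder_le_add[OF elim(3) y0] have "holder_le l (e / (2 * C) + L) (y \<epsilon>)" by simp
      then have "B \<epsilon> (\<lambda>t. y \<epsilon> t - y0 t) = B \<epsilon> (y \<epsilon>) - B \<epsilon> y0"
        using y0 by (rule bounded_operator_diff[OF elim(1)])
      moreover have "norm (B \<epsilon> (\<lambda>t. y \<epsilon> t - y0 t)) \<le> C * (e / (2 * C))"
        using elim(2,3) \<open>0 < e / (2 * C)\<close> by blast
      ultimately have "norm (B \<epsilon> (y \<epsilon>) - B \<epsilon> y0) \<le> C * (e / (2 * C))" by (simp only:)
      then show ?case using bound(2) \<open>0 < e\<close> by (simp add: norm_minus_commute)
    qed
  qed
  with lim show ?thesis by (rule Lim_transform2)
qed

section \<open>The boundary-value problem as a linear map on initial values\<close>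

text \<open>
  Assigning to an initial value the boundary value of the solution of the homogeneous equation reduces
  the boundary-value problem to a square system of linear equations.
\<close>

lemma linear_boundary_map:
  fixes A :: "real \<Rightarrow> complex ^ 'm ^ 'm"
  assumes A: "holder_le n R A" and T: "bounded_operator (Suc n) T"
  shows "linear (\<lambda>c. T (cauchy_solution A (\<lambda>_. 0) c))"
proof (rule linearI)
  have zero: "holder_le n 0 (\<lambda>_. 0 :: complex ^ 'm)" by (simp add: holder_le_zero)
  note S = cauchy_solution[OF A zero]
  fix c d :: "complex ^ 'm" and r :: real
  obtain K where K: "holder_le (Suc n) K (cauchy_solution A (\<lambda>_. 0) c)" using S(3) by blast
  obtain L where L: "holder_le (Suc n) L (cauchy_solution A (\<lambda>_. 0) d)" using S(3) by blast
  have "T (\<lambda>t. cauchy_solution A (\<lambda>_. 0) c t + cauchy_solution A (\<lambda>_. 0) d t) = T (cauchy_solution A (\<lambda>_. 0) (c + d))"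
  proof (rule bounded_operator_cong[OF T holder_le_add[OF K L]])
    fix t assume t: "t \<in> {a..b}"
    have sum: "ode A (\<lambda>_. 0) (\<lambda>t. cauchy_solution A (\<lambda>_. 0) c t + cauchy_solution A (\<lambda>_. 0) d t)"
      using ode_add[OF S(2) S(2), of c d] by simp
    show "cauchy_solution A (\<lambda>_. 0) c t + cauchy_solution A (\<lambda>_. 0) d t = cauchy_solution A (\<lambda>_. 0) (c + d) t"
      using ode_unique[OF A sum S(2) _ t, of "c + d"] S(1) by simp
  qed
  then show "T (cauchy_solution A (\<lambda>_. 0) (c + d)) = T (cauchy_solution A (\<lambda>_. 0) c) + T (cauchy_solution A (\<lambda>_. 0) d)"
    using bounded_operator_add[OF T K L] by simp
  have "T (\<lambda>t. r *\<^sub>R cauchy_solution A (\<lambda>_. 0) c t) = T (cauchy_solution A (\<lambda>_. 0) (r *\<^sub>R c))"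
  proof (rule bounded_operator_cong[OF T holder_le_scaleR[OF K]])
    fix t assume t: "t \<in> {a..b}"
    have mult: "ode A (\<lambda>_. 0) (\<lambda>t. r *\<^sub>R cauchy_solution A (\<lambda>_. 0) c t)"
      using ode_scaleR[OF S(2), of r c] by simp
    show "r *\<^sub>R cauchy_solution A (\<lambda>_. 0) c t = cauchy_solution A (\<lambda>_. 0) (r *\<^sub>R c) t"
      using ode_unique[OF A mult S(2) _ t, of "r *\<^sub>R c"] S(1) by simp
  qed
  then show "T (cauchy_solution A (\<lambda>_. 0) (r *\<^sub>R c)) = r *\<^sub>R T (cauchy_solution A (\<lambda>_. 0) c)"
    using bounded_operator_scaleR[OF T K] by simp
qed

lemma bvp_solution_representation:
  fixes A :: "real \<Rightarrow> complex ^ 'm ^ 'm"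
  assumes A: "holder_le n R A" and y: "holder_le (Suc n) K y" "ode A f y" and z: "holder_le (Suc n) L z" "ode A f z"
    and T: "bounded_operator (Suc n) T"
  shows "T (cauchy_solution A (\<lambda>_. 0) (y a - z a)) = T y - T z"
    and "t \<in> {a..b} \<Longrightarrow> y t = z t + cauchy_solution A (\<lambda>_. 0) (y a - z a) t"
proof -
  have zero: "holder_le n 0 (\<lambda>_. 0 :: complex ^ 'm)" by (simp add: holder_le_zero)
  note S = cauchy_solution[OF A zero]
  have diff: "ode A (\<lambda>_. 0) (\<lambda>t. y t - z t)"
    using ode_diff[OF y(2) z(2)] by simp
  have eq: "y t - z t = cauchy_solution A (\<lambda>_. 0) (y a - z a) t" if "t \<in> {a..b}" for t
    using ode_unique[OF A diff S(2) _ that, of "y a - z a"] S(1) by simp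
  show "y t = z t + cauchy_solution A (\<lambda>_. 0) (y a - z a) t" if "t \<in> {a..b}"
    using eq[OF that] by (simp add: diff_eq_eq add.commute)
  have "T (\<lambda>t. y t - z t) = T (cauchy_solution A (\<lambda>_. 0) (y a - z a))"
    by (rule bounded_operator_cong[OF T holder_le_diff[OF y(1) z(1)]]) (rule eq)
  then show "T (cauchy_solution A (\<lambda>_. 0) (y a - z a)) = T y - T z"
    using bounded_operator_diff[OF T y(1) z(1)] by simp
qed

text \<open>
  An injective linear map of a finite-dimensional space into itself is surjective; so the initial
  value of the homogeneous correction to any solution of the equation can be chosen to match the
  boundary value.
\<close>

lemma uniquely_solvable_of_inj:
  fixes A :: "real \<Rightarrow> complex ^ 'm ^ 'm"
  assumes A: "holder_le n R A" and T: "bounded_operator (Suc n) T"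
    and inj: "inj (\<lambda>c. T (cauchy_solution A (\<lambda>_. 0) c))" and f: "holder_le n K f"
  shows "uniquely_solvable a b n \<alpha> A T f p"
proof -
  have zero: "holder_le n 0 (\<lambda>_. 0 :: complex ^ 'm)" by (simp add: holder_le_zero)
  note S = cauchy_solution[OF A zero] and F = cauchy_solution[OF A f, of 0]
  let ?M = "\<lambda>c. T (cauchy_solution A (\<lambda>_. 0) c)"
  have lin: "linear ?M" using A T by (rule linear_boundary_map)
  then have "surj ?M" using inj by (rule linear_injective_imp_surjective) simp
  from surjD[OF this, of "p - T (cauchy_solution A f 0)"]
  obtain c where c: "?M c = p - T (cauchy_solution A f 0)" by (elim exE) (rule that, erule sym)
  obtain L where L: "holder_le (Suc n) L (cauchy_solution A (\<lambda>_. 0) c)" using S(3) by blast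
  obtain L' where L': "holder_le (Suc n) L' (cauchy_solution A f 0)" using F(3) by blast
  define y where "y t = cauchy_solution A f 0 t + cauchy_solution A (\<lambda>_. 0) c t" for t
  have holder_le_y: "holder_le (Suc n) (L' + L) y" unfolding y_def by (rule holder_le_add[OF L' L])
  have ode_y: "ode A f y" unfolding y_def using ode_add[OF F(2) S(2)] by simp
  have T_y: "T y = p" unfolding y_def using bounded_operator_add[OF T L' L] c by simp
  show ?thesis
    unfolding uniquely_solvable_def bvp_solution_iff
  proof (intro exI[of _ y] conjI allI impI ballI)
    show "\<exists>K. holder_le (Suc n) K y" using holder_le_y by (rule exI)
    fix z t assume z: "(\<exists>K. holder_le (Suc n) K z) \<and> ode A f z \<and> T z = p" and t: "t \<in> {a..b}"
    then obtain K' where K': "holder_le (Suc n) K' z" by blast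
    have "?M (z a - y a) = 0"
      using bvp_solution_representation(1)[OF A K' _ holder_le_y ode_y T] z T_y by simp
    moreover have "?M 0 = 0" using lin by (rule linear_0)
    ultimately have "z a = y a" using injD[OF inj, of "z a - y a" 0] by simp
    with z show "z t = y t" using ode_unique[OF A _ ode_y _ t, of z] by blast
  qed fact+
qed

lemma eventually_bounded_of_vanishes:
  assumes "holder_le n R (A 0)" "vanishes n (\<lambda>\<epsilon> t. A \<epsilon> t - A 0 t)"
  shows "\<forall>\<^sub>F \<epsilon> in at_right 0. holder_le n (1 + R) (A \<epsilon>)"
  using vanishes_eventually[OF assms(2) zero_less_one]
proof eventually_elim
  case (elim \<epsilon>)
  from holder_le_add[OF elim assms(1)] show ?case by simp
qed

section \<open>Sufficiency of the three conditions\<close>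

lemma boundary_maps_converge:
  fixes A :: "real \<Rightarrow> real \<Rightarrow> complex ^ 'm ^ 'm"
    and B :: "real \<Rightarrow> (real \<Rightarrow> complex ^ 'm) \<Rightarrow> complex ^ 'm"
  assumes A0: "holder_le n R (A 0)" and A: "vanishes n (\<lambda>\<epsilon> t. A \<epsilon> t - A 0 t)"
    and B: "\<forall>\<^sub>F \<epsilon> in at_right 0. bounded_operator (Suc n) (B \<epsilon>)"
    and lim: "\<forall>y K. holder_le (Suc n) K y \<longrightarrow> ((\<lambda>\<epsilon>. B \<epsilon> y) \<longlongrightarrow> B 0 y) (at_right 0)"
  shows "((\<lambda>\<epsilon>. B \<epsilon> (cauchy_solution (A \<epsilon>) (\<lambda>_. 0) c)) \<longlongrightarrow> B 0 (cauchy_solution (A 0) (\<lambda>_. 0) c)) (at_right 0)"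
proof -
  have zero: "holder_le n 0 (\<lambda>_. 0 :: complex ^ 'm)" by (simp add: holder_le_zero)
  note S0 = cauchy_solution[OF A0 zero]
  obtain L where L: "holder_le (Suc n) L (cauchy_solution (A 0) (\<lambda>_. 0) c)" using S0(3) by blast
  note AR = eventually_bounded_of_vanishes[OF A0 A]
  have ode: "\<forall>\<^sub>F \<epsilon> in at_right 0. ode (A \<epsilon>) (\<lambda>_. 0) (cauchy_solution (A \<epsilon>) (\<lambda>_. 0) c)"
    using AR by eventually_elim (rule cauchy_solution(2)[OF _ zero])
  have init: "((\<lambda>\<epsilon>. cauchy_solution (A \<epsilon>) (\<lambda>_. 0) c a) \<longlongrightarrow> cauchy_solution (A 0) (\<lambda>_. 0) c a) (at_right 0)"
  proof (rule tendsto_eventually)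
    show "\<forall>\<^sub>F \<epsilon> in at_right 0. cauchy_solution (A \<epsilon>) (\<lambda>_. 0) c a = cauchy_solution (A 0) (\<lambda>_. 0) c a"
      using AR by eventually_elim (simp add: cauchy_solution(1)[OF _ zero] S0(1))
  qed
  have van: "vanishes (Suc n) (\<lambda>\<epsilon> t. cauchy_solution (A \<epsilon>) (\<lambda>_. 0) c t - cauchy_solution (A 0) (\<lambda>_. 0) c t)"
    by (rule ode_solutions_converge[where f = "\<lambda>_ _. 0" and y = "\<lambda>\<epsilon>. cauchy_solution (A \<epsilon>) (\<lambda>_. 0) c",
          OF AR A ode S0(2) L _ init]) (simp add: vanishes_def holder_le_zero)
  have "\<exists>C>0. \<forall>\<^sub>F \<epsilon> in at_right 0. \<forall>x K. 0 < K \<longrightarrow> holder_le (Suc n) K x \<longrightarrow> norm (B \<epsilon> x) \<le> C * K"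
    by (rule uniform_boundedness_at_right[OF B]) (use lim in blast)
  then obtain C where C: "0 < C"
    "\<forall>\<^sub>F \<epsilon> in at_right 0. \<forall>x K. 0 < K \<longrightarrow> holder_le (Suc n) K x \<longrightarrow> norm (B \<epsilon> x) \<le> C * K" by blast
  show ?thesis
    by (rule operators_converge[where y = "\<lambda>\<epsilon>. cauchy_solution (A \<epsilon>) (\<lambda>_. 0) c",
          OF B C(2,1) van L lim[rule_format, OF L]])
qed

text \<open>
  The maps from initial values to boundary values converge to an injective map; hence they are
  bounded below uniformly in \<open>\<epsilon>\<close>. This gives injectivity for small \<open>\<epsilon>\<close>, and it bounds the initial value
  of a solution by its boundary value and the right-hand side, which is all that the estimate for the
  Cauchy problem needs.
\<close>

lemma bvp_estimate:
  fixes A :: "real \<Rightarrow> real \<Rightarrow> complex ^ 'm ^ 'm"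
    and B :: "real \<Rightarrow> (real \<Rightarrow> complex ^ 'm) \<Rightarrow> complex ^ 'm"
  assumes A0: "holder_le n R (A 0)" and A: "vanishes n (\<lambda>\<epsilon> t. A \<epsilon> t - A 0 t)"
    and B0: "bounded_operator (Suc n) (B 0)"
    and B: "\<forall>\<^sub>F \<epsilon> in at_right 0. bounded_operator (Suc n) (B \<epsilon>)"
    and lim: "\<forall>y K. holder_le (Suc n) K y \<longrightarrow> ((\<lambda>\<epsilon>. B \<epsilon> y) \<longlongrightarrow> B 0 y) (at_right 0)"
    and inj: "inj (\<lambda>c. B 0 (cauchy_solution (A 0) (\<lambda>_. 0) c))"
  shows "\<forall>\<^sub>F \<epsilon> in at_right 0. inj (\<lambda>c. B \<epsilon> (cauchy_solution (A \<epsilon>) (\<lambda>_. 0) c))"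
    and "\<exists>C>0. \<forall>\<^sub>F \<epsilon> in at_right 0. \<forall>y f K L. 0 < K \<longrightarrow> holder_le (Suc n) L y \<longrightarrow> ode (A \<epsilon>) f y \<longrightarrow>
      holder_le n K f \<longrightarrow> norm (B \<epsilon> y) \<le> K \<longrightarrow> holder_le (Suc n) (C * K) y"
proof -
  define M where "M \<epsilon> c = B \<epsilon> (cauchy_solution (A \<epsilon>) (\<lambda>_. 0) c)" for \<epsilon> c
  note AR = eventually_bounded_of_vanishes[OF A0 A]
  have R1: "0 \<le> 1 + R" using holder_le_nonneg[OF A0] by simp
  have lin: "\<forall>\<^sub>F \<epsilon> in at_right 0. linear (M \<epsilon>)"
    using AR B by eventually_elim (simp add: M_def[abs_def] linear_boundary_map)
  have "linear (M 0)" "inj (M 0)"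
    using linear_boundary_map[OF A0 B0] inj by (simp_all add: M_def[abs_def])
  moreover have "((\<lambda>\<epsilon>. M \<epsilon> c) \<longlongrightarrow> M 0 c) (at_right 0)" for c
    unfolding M_def by (rule boundary_maps_converge[OF A0 A B lim])
  ultimately obtain k where k: "0 < k" "\<forall>\<^sub>F \<epsilon> in at_right 0. \<forall>c. k * norm c \<le> norm (M \<epsilon> c)"
    using eventually_bounded_below[OF lin] by blast
  show "\<forall>\<^sub>F \<epsilon> in at_right 0. inj (\<lambda>c. B \<epsilon> (cauchy_solution (A \<epsilon>) (\<lambda>_. 0) c))"
    using lin k(2)
  proof eventually_elim
    case (elim \<epsilon>)
    have "c = d" if "M \<epsilon> c = M \<epsilon> d" for c d
    proof -
      have "k * norm (c - d) \<le> norm (M \<epsilon> (c - d))" using elim(2) by blast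
      also have "\<dots> = 0" using linear_diff[OF elim(1), of c d] that by simp
      finally show ?thesis using k(1) by (simp add: mult_le_0_iff)
    qed
    then show ?case unfolding M_def by (intro injI) blast
  qed
  obtain C1 where C1: "0 < C1" "\<And>A f (y :: real \<Rightarrow> complex ^ 'm) K. holder_le n (1 + R) A \<Longrightarrow> holder_le n K f \<Longrightarrow>
      norm (y a) \<le> K \<Longrightarrow> ode A f y \<Longrightarrow> holder_le (Suc n) (C1 * K) y"
    using R1 by (rule ode_holder_le[where n = n]) blast
  have "\<exists>C>0. \<forall>\<^sub>F \<epsilon> in at_right 0. \<forall>x K. 0 < K \<longrightarrow> holder_le (Suc n) K x \<longrightarrow> norm (B \<epsilon> x) \<le> C * K"
    by (rule uniform_boundedness_at_right[OF B]) (use lim in blast)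
  then obtain C2 where C2: "0 < C2"
    "\<forall>\<^sub>F \<epsilon> in at_right 0. \<forall>x K. 0 < K \<longrightarrow> holder_le (Suc n) K x \<longrightarrow> norm (B \<epsilon> x) \<le> C2 * K"
    by blast
  define C3 where "C3 = 1 + (1 + C2 * C1) / k"
  have C3: "1 \<le> C3" using C1(1) C2(1) k(1) by (simp add: C3_def)
  have "\<forall>\<^sub>F \<epsilon> in at_right 0. \<forall>y f K L. 0 < K \<longrightarrow> holder_le (Suc n) L y \<longrightarrow> ode (A \<epsilon>) f y \<longrightarrow>
      holder_le n K f \<longrightarrow> norm (B \<epsilon> y) \<le> K \<longrightarrow> holder_le (Suc n) (C1 * C3 * K) y"
    using AR B C2(2) k(2)
  proof eventually_elim
    case (elim \<epsilon>)
    show ?case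
    proof (intro allI impI)
      fix y f K L
      assume K: "0 < K" and y: "holder_le (Suc n) L y" and ode: "ode (A \<epsilon>) f y" and f: "holder_le n K f"
        and By: "norm (B \<epsilon> y) \<le> K"
      \<comment> \<open>The solution with initial value \<open>0\<close> carries the right-hand side.\<close>
      define z where "z = cauchy_solution (A \<epsilon>) f 0"
      have z: "z a = 0" "ode (A \<epsilon>) f z" unfolding z_def using cauchy_solution[OF elim(1) f] by auto
      have holder_le_z: "holder_le (Suc n) (C1 * K) z"
        by (rule C1(2)[OF elim(1) f _ z(2)]) (use z(1) K in simp)
      then have Bz: "norm (B \<epsilon> z) \<le> C2 * (C1 * K)"
        using elim(3) K C1(1) by simp
      have "M \<epsilon> (y a) = B \<epsilon> y - B \<epsilon> z"
        using bvp_solution_representation(1)[OF elim(1) y ode holder_le_z z(2) elim(2)] z(1)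
        by (simp add: M_def)
      then have "k * norm (y a) \<le> norm (B \<epsilon> y) + norm (B \<epsilon> z)"
        using elim(4) norm_triangle_ineq4[of "B \<epsilon> y" "B \<epsilon> z"] by (metis order_trans)
      also have "\<dots> \<le> (1 + C2 * C1) * K" using By Bz by (simp add: algebra_simps)
      finally have "norm (y a) \<le> (1 + C2 * C1) / k * K"
        using k(1) by (simp add: field_simps)
      also have "\<dots> \<le> C3 * K" using K by (intro mult_right_mono) (auto simp: C3_def)
      finally have ya: "norm (y a) \<le> C3 * K" .
      have "holder_le n (C3 * K) f" using f by (rule holder_le_mono) (use C3 K in simp)
      from C1(2)[OF elim(1) this ya ode] show "holder_le (Suc n) (C1 * C3 * K) y"
        by (simp add: mult.assoc)
    qed
  qed
  moreover have "0 < C1 * C3" using C1(1) C3 by simp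
  ultimately show "\<exists>C>0. \<forall>\<^sub>F \<epsilon> in at_right 0. \<forall>y f K L. 0 < K \<longrightarrow> holder_le (Suc n) L y \<longrightarrow>
      ode (A \<epsilon>) f y \<longrightarrow> holder_le n K f \<longrightarrow> norm (B \<epsilon> y) \<le> K \<longrightarrow> holder_le (Suc n) (C * K) y"
    by blast
qed

lemma inj_of_trivial_kernel:
  fixes A :: "real \<Rightarrow> complex ^ 'm ^ 'm"
  assumes A: "holder_le n R A" and T: "bounded_operator (Suc n) T"
    and trivial: "\<And>y K t. holder_le (Suc n) K y \<Longrightarrow> ode A (\<lambda>_. 0) y \<Longrightarrow> T y = 0 \<Longrightarrow> t \<in> {a..b} \<Longrightarrow> y t = 0"
  shows "inj (\<lambda>c. T (cauchy_solution A (\<lambda>_. 0) c))"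
proof (rule injI)
  have zero: "holder_le n 0 (\<lambda>_. 0 :: complex ^ 'm)" by (simp add: holder_le_zero)
  note S = cauchy_solution[OF A zero]
  fix c d assume "T (cauchy_solution A (\<lambda>_. 0) c) = T (cauchy_solution A (\<lambda>_. 0) d)"
  then have "T (cauchy_solution A (\<lambda>_. 0) (c - d)) = 0"
    using linear_diff[OF linear_boundary_map[OF A T], of c d] by simp
  moreover obtain K where "holder_le (Suc n) K (cauchy_solution A (\<lambda>_. 0) (c - d))" using S(3) by blast
  ultimately have "cauchy_solution A (\<lambda>_. 0) (c - d) a = 0"
    using trivial[OF _ S(2)] ab by (metis atLeastAtMost_iff less_imp_le order_refl)
  then show "c = d" using S(1) by simp
qed

text \<open>
  The a priori estimate applied to \<open>y \<epsilon> - y 0\<close>: its right-hand side vanishes in the limit by (I), its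
  boundary value \<open>q \<epsilon> - B \<epsilon> (y 0)\<close> by (II).
\<close>

lemma sufficiency:
  fixes A :: "real \<Rightarrow> real \<Rightarrow> complex ^ 'm ^ 'm"
    and B :: "real \<Rightarrow> (real \<Rightarrow> complex ^ 'm) \<Rightarrow> complex ^ 'm"
  assumes \<epsilon>0: "0 < \<epsilon>0"
    and A_hb': "\<forall>\<epsilon>\<in>{0..<\<epsilon>0}. \<exists>R. holder_le n R (A \<epsilon>)"
    and B_op': "\<forall>\<epsilon>\<in>{0..<\<epsilon>0}. bounded_operator (Suc n) (B \<epsilon>)"
    and trivial: "\<And>y K t. holder_le (Suc n) K y \<Longrightarrow> ode (A 0) (\<lambda>_. 0) y \<Longrightarrow> B 0 y = 0 \<Longrightarrow> t \<in> {a..b} \<Longrightarrow> y t = 0"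
    and A: "vanishes n (\<lambda>\<epsilon> t. A \<epsilon> t - A 0 t)"
    and lim: "\<forall>y K. holder_le (Suc n) K y \<longrightarrow> ((\<lambda>\<epsilon>. B \<epsilon> y) \<longlongrightarrow> B 0 y) (at_right 0)"
  shows "solution_continuous_in_parameter a b n \<alpha> \<epsilon>0 A B"
proof -
  note A_hb = bspec[OF A_hb'] and B_op = bspec[OF B_op']
  have zero_in: "0 \<in> {0..<\<epsilon>0}" using \<epsilon>0 by simp
  then obtain R where A0: "holder_le n R (A 0)" using A_hb by blast
  have B0: "bounded_operator (Suc n) (B 0)" using B_op[OF zero_in] .
  have B: "\<forall>\<^sub>F \<epsilon> in at_right 0. bounded_operator (Suc n) (B \<epsilon>)"
    using \<epsilon>0 B_op by (rule eventually_of_interval)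
  have inj: "inj (\<lambda>c. B 0 (cauchy_solution (A 0) (\<lambda>_. 0) c))"
    using A0 B0 trivial by (rule inj_of_trivial_kernel)
  note est = bvp_estimate[OF A0 A B0 B lim inj]
  obtain \<delta> where \<delta>: "0 < \<delta>" "\<And>\<epsilon>. 0 < \<epsilon> \<Longrightarrow> \<epsilon> < \<delta> \<Longrightarrow> inj (\<lambda>c. B \<epsilon> (cauchy_solution (A \<epsilon>) (\<lambda>_. 0) c))"
    using est(1) unfolding eventually_at_right_field by blast
  \<comment> \<open>The half of \<open>\<epsilon>0\<close> makes \<open>\<epsilon>1\<close> strictly smaller than \<open>\<epsilon>0\<close>.\<close>
  define \<epsilon>1 where "\<epsilon>1 = min \<delta> (\<epsilon>0 / 2)"
  have \<epsilon>1: "0 < \<epsilon>1" "\<epsilon>1 < \<epsilon>0" using \<delta>(1) \<epsilon>0 by (auto simp: \<epsilon>1_def)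
  have solvable: "uniquely_solvable a b n \<alpha> (A \<epsilon>) (B \<epsilon>) g p"
    if \<epsilon>_in: "\<epsilon> \<in> {0..<\<epsilon>1}" and g: "g \<in> holder_space_vec a b n \<alpha>" for \<epsilon> g p
  proof -
    have \<epsilon>: "\<epsilon> \<in> {0..<\<epsilon>0}" using \<epsilon>_in \<epsilon>1 by auto
    obtain R' where R': "holder_le n R' (A \<epsilon>)" using A_hb[OF \<epsilon>] by blast
    obtain K where K: "holder_le n K g" using g unfolding holder_space_vec_iff by blast
    have "inj (\<lambda>c. B \<epsilon> (cauchy_solution (A \<epsilon>) (\<lambda>_. 0) c))"
      using inj \<delta>(2)[of \<epsilon>] \<epsilon>_in by (cases "\<epsilon> = 0") (auto simp: \<epsilon>1_def)
    from uniquely_solvable_of_inj[OF R' B_op[OF \<epsilon>] this K] show ?thesis .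
  qed
  have converge: "holder_convergent_vec a b (n + 1) \<alpha> y"
    if f: "\<forall>\<epsilon>\<in>{0..<\<epsilon>0}. f \<epsilon> \<in> holder_space_vec a b n \<alpha>" "holder_convergent_vec a b n \<alpha> f"
      and q: "(q \<longlongrightarrow> q 0) (at_right 0)"
      and y: "\<forall>\<epsilon>\<in>{0..<\<epsilon>1}. bvp_solution a b n \<alpha> (A \<epsilon>) (B \<epsilon>) (f \<epsilon>) (q \<epsilon>) (y \<epsilon>)" for f q y
  proof -
    have f_van: "vanishes n (\<lambda>\<epsilon> t. f \<epsilon> t - f 0 t)"
      using f(2) holder_convergent_vec_iff[of f n] eventually_of_interval[OF \<epsilon>0, of "\<lambda>\<epsilon>. f \<epsilon> \<in> holder_space_vec a b n \<alpha>"]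
        f(1) zero_in by blast
    have sol: "(\<exists>K. holder_le (Suc n) K (y \<epsilon>)) \<and> ode (A \<epsilon>) (f \<epsilon>) (y \<epsilon>) \<and> B \<epsilon> (y \<epsilon>) = q \<epsilon>"
      if "\<epsilon> \<in> {0..<\<epsilon>1}" for \<epsilon>
      using y that unfolding bvp_solution_iff by blast
    obtain L where L: "holder_le (Suc n) L (y 0)" and ode0: "ode (A 0) (f 0) (y 0)" and q0: "B 0 (y 0) = q 0"
      using sol[of 0] \<epsilon>1(1) by auto
    define g where "g \<epsilon> t = (f \<epsilon> t - f 0 t) - (A \<epsilon> t - A 0 t) *v y 0 t" for \<epsilon> t
    have g: "vanishes n g"
      unfolding g_def
      by (intro vanishes_diff f_van vanishes_prod_left[OF bounded_bilinear_matrix_vector_mult A holder_le_lower[OF L]])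
    have Blim: "((\<lambda>\<epsilon>. q \<epsilon> - B \<epsilon> (y 0)) \<longlongrightarrow> 0) (at_right 0)"
      using tendsto_diff[OF q lim[rule_format, OF L]] q0 by simp
    obtain C where C: "0 < C" "\<forall>\<^sub>F \<epsilon> in at_right 0. \<forall>y f K L. 0 < K \<longrightarrow> holder_le (Suc n) L y \<longrightarrow>
      ode (A \<epsilon>) f y \<longrightarrow> holder_le n K f \<longrightarrow> norm (B \<epsilon> y) \<le> K \<longrightarrow> holder_le (Suc n) (C * K) y"
      using est(2) by blast
    have "vanishes (Suc n) (\<lambda>\<epsilon> t. y \<epsilon> t - y 0 t)"
      unfolding vanishes_def
    proof (intro allI impI)
      fix e :: real assume "0 < e"
      then have eC: "0 < e / C" using C(1) by simp
      have "\<forall>\<^sub>F \<epsilon> in at_right 0. \<epsilon> \<in> {0..<\<epsilon>1}" using \<epsilon>1(1) by (rule eventually_of_interval)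
      from this B C(2) vanishes_eventually[OF g eC] tendstoD[OF Blim eC]
      show "\<forall>\<^sub>F \<epsilon> in at_right 0. holder_le (Suc n) e (\<lambda>t. y \<epsilon> t - y 0 t)"
      proof eventually_elim
        case (elim \<epsilon>)
        obtain K where K: "holder_le (Suc n) K (y \<epsilon>)" and ode: "ode (A \<epsilon>) (f \<epsilon>) (y \<epsilon>)" and q: "B \<epsilon> (y \<epsilon>) = q \<epsilon>"
          using sol[OF elim(1)] by blast
        have "ode (A \<epsilon>) (g \<epsilon>) (\<lambda>t. y \<epsilon> t - y 0 t)"
          by (rule ode_cong[OF ode_diff[OF ode ode_perturb[OF ode0]]]) (simp add: g_def)
        moreover have "norm (B \<epsilon> (\<lambda>t. y \<epsilon> t - y 0 t)) \<le> e / C"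
          using bounded_operator_diff[OF elim(2) K L] elim(5) q by (simp add: dist_norm)
        ultimately have "holder_le (Suc n) (C * (e / C)) (\<lambda>t. y \<epsilon> t - y 0 t)"
          using elim(3,4) eC holder_le_diff[OF K L] by blast
        then show ?case using C(1) by simp
      qed
    qed
    moreover have "\<forall>\<^sub>F \<epsilon> in at_right 0. y \<epsilon> \<in> holder_space_vec a b (Suc n) \<alpha>"
      using \<epsilon>1(1) by (rule eventually_of_interval) (use sol in \<open>auto simp: holder_space_vec_iff\<close>)
    moreover have "y 0 \<in> holder_space_vec a b (Suc n) \<alpha>"
      using L by (rule holder_le_holder_space_vec(1))
    ultimately show ?thesis by (simp add: holder_convergent_vec_iff)
  qed
  show ?thesis
    unfolding solution_continuous_in_parameter_def
  proof (intro exI[of _ \<epsilon>1] conjI ballI allI impI)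
    show "0 < \<epsilon>1" "\<epsilon>1 < \<epsilon>0" by (fact \<epsilon>1)+
    show "uniquely_solvable a b n \<alpha> (A \<epsilon>) (B \<epsilon>) g p"
      if "\<epsilon> \<in> {0..<\<epsilon>1}" "g \<in> holder_space_vec a b n \<alpha>" for \<epsilon> g p
      using that by (rule solvable)
    show "holder_convergent_vec a b (n + 1) \<alpha> y"
      if "(\<forall>\<epsilon>\<in>{0..<\<epsilon>0}. f \<epsilon> \<in> holder_space_vec a b n \<alpha>) \<and>
        holder_convergent_vec a b n \<alpha> f \<and> (q \<longlongrightarrow> q 0) (at_right 0) \<and>
        (\<forall>\<epsilon>\<in>{0..<\<epsilon>1}. bvp_solution a b n \<alpha> (A \<epsilon>) (B \<epsilon>) (f \<epsilon>) (q \<epsilon>) (y \<epsilon>))" for f q y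
      using that by (elim conjE) (rule converge)
  qed
qed

lemma vanishes_lower: "vanishes (Suc l) d \<Longrightarrow> vanishes l d"
  by (rule vanishes_transfer[where C = embed_const])
    (use embed_const_ge_1 in \<open>auto intro!: always_eventually holder_le_lower\<close>)

lemma vanishes_derivative:
  assumes d: "vanishes (Suc l) d"
    and deriv: "\<forall>\<^sub>F \<epsilon> in at_right 0. \<forall>t\<in>{a..b}. (d \<epsilon> has_vector_derivative d' \<epsilon> t) (at t within {a..b})"
  shows "vanishes l d'"
  using d
proof (rule vanishes_transfer[where C = 1])
  show "\<forall>\<^sub>F \<epsilon> in at_right 0. \<forall>K>0. holder_le (Suc l) K (d \<epsilon>) \<longrightarrow> holder_le l (1 * K) (d' \<epsilon>)"
    using deriv
  proof eventually_elim
    case (elim \<epsilon>)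
    then have eq: "vector_derivative (d \<epsilon>) (at t within {a..b}) = d' \<epsilon> t" if "t \<in> {a..b}" for t
      using vector_derivative_Icc that by blast
    have "holder_le l K (d' \<epsilon>)" if "holder_le (Suc l) K (d \<epsilon>)" for K
      using that unfolding holder_le_Suc_iff by (intro holder_le_cong[OF _ eq]) auto
    then show ?case by simp
  qed
qed simp

lemma vanishes_vec:
  fixes d :: "real \<Rightarrow> real \<Rightarrow> 'v::real_normed_vector ^ 'n"
  assumes "\<And>i. vanishes l (\<lambda>\<epsilon> t. d \<epsilon> t $ i)"
  shows "vanishes l d"
  unfolding vanishes_def
proof (intro allI impI)
  fix e :: real assume "0 < e"
  then have "0 < e / real CARD('n)" by simp
  then have "\<forall>\<^sub>F \<epsilon> in at_right 0. \<forall>i. holder_le l (e / real CARD('n)) (\<lambda>t. d \<epsilon> t $ i)"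
    using vanishes_eventually[OF assms] by (intro eventually_all_finite) blast
  then show "\<forall>\<^sub>F \<epsilon> in at_right 0. holder_le l e (d \<epsilon>)"
  proof eventually_elim
    case (elim \<epsilon>)
    then have "holder_le l (\<Sum>i\<in>(UNIV :: 'n set). e / real CARD('n)) (d \<epsilon>)"
      by (intro holder_le_vec) blast
    then show ?case by simp
  qed
qed

lemma vanishes_component: "vanishes l d \<Longrightarrow> vanishes l (\<lambda>\<epsilon> t. d \<epsilon> t $ i)"
  by (rule vanishes_transfer[where C = 1]) (auto intro: holder_le_component always_eventually)

section \<open>Necessity of the three conditions\<close>

text \<open>
  For small \<open>W\<close> the term with \<open>D\<close> on the right has at most half the norm of \<open>D\<close> and can be moved to the
  left. This needs a norm and not merely some radius, because the inequality is applied to the same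
  \<open>D\<close> on both sides.
\<close>

lemma vanishes_absorb:
  fixes D W E :: "real \<Rightarrow> real \<Rightarrow> complex ^ 'm ^ 'm"
  assumes E: "vanishes n E" and W: "vanishes n W" and Z: "holder_le n z Z"
    and D: "\<forall>\<^sub>F \<epsilon> in at_right 0. (\<exists>K. holder_le n K (D \<epsilon>)) \<and>
      (\<forall>t\<in>{a..b}. D \<epsilon> t = E \<epsilon> t - (D \<epsilon> t ** W \<epsilon> t) ** Z t)"
  shows "vanishes n D"
  unfolding vanishes_def
proof (intro allI impI)
  obtain P where P: "0 < P"
    "\<And>(x :: real \<Rightarrow> complex ^ 'm ^ 'm) (y :: real \<Rightarrow> complex ^ 'm ^ 'm) K L.
      holder_le n K x \<Longrightarrow> holder_le n L y \<Longrightarrow> holder_le n (P * K * L) (\<lambda>t. x t ** y t)"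
    using holder_le_bilinear[OF bounded_bilinear_matrix_matrix_mult, of n] by blast
  define Q where "Q = real CARD('m) * (real CARD('m) * (real n + 3))"
  have Q: "0 < Q" by (simp add: Q_def add_nonneg_pos)
  have z: "0 \<le> z" using Z by (rule holder_le_nonneg)
  have Z1: "holder_le n (z + 1) Z" using Z by (rule holder_le_mono) simp
  \<comment> \<open>Bounds \<open>w\<close> of \<open>W\<close> for which the constants of the comparison of norms, of the two products and of \<open>Z\<close> combine to the factor \<open>1/2\<close>.\<close>
  define w where "w = 1 / (2 * Q * P * P * (z + 1))"
  have w: "0 < w" using P(1) Q z by (simp add: w_def)
  fix e :: real assume "0 < e"
  then have e: "0 < e / (2 * Q)" using Q by simp
  from D vanishes_eventually[OF E e] vanishes_eventually[OF W w]
  show "\<forall>\<^sub>F \<epsilon> in at_right 0. holder_le n e (D \<epsilon>)"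
  proof eventually_elim
    case (elim \<epsilon>)
    define N where "N = holder_norm_mat a b n \<alpha> (D \<epsilon>)"
    have "D \<epsilon> \<in> holder_space_mat a b n \<alpha>" using elim(1) holder_le_holder_space_mat(1) by blast
    then have N: "holder_le n N (D \<epsilon>)" unfolding N_def by (rule holder_le_holder_norm_mat)
    have "holder_le n (e / (2 * Q) + P * (P * N * w) * (z + 1)) (\<lambda>t. E \<epsilon> t - (D \<epsilon> t ** W \<epsilon> t) ** Z t)"
      by (rule holder_le_diff[OF elim(2) P(2)[OF P(2)[OF N elim(3)] Z1]])
    then have "holder_le n (e / (2 * Q) + P * (P * N * w) * (z + 1)) (D \<epsilon>)"
      by (rule holder_le_cong) (use elim(1) in simp)
    from holder_le_holder_space_mat(2)[OF this]
    have "N \<le> Q * (e / (2 * Q) + P * (P * N * w) * (z + 1))"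
      by (simp only: N_def Q_def mult.assoc)
    also have "\<dots> = e / 2 + N / 2 * (2 * Q * P * P * (z + 1) * w)"
      using Q by (simp add: distrib_left mult_ac)
    also have "2 * Q * P * P * (z + 1) * w = 1"
      using Q P(1) z by (simp add: w_def)
    finally have "N \<le> e" by simp
    with N show ?case by (rule holder_le_mono)
  qed
qed

text \<open>
  Let \<open>X \<epsilon>\<close> be the matrix with the columns \<open>Y j \<epsilon>\<close> and \<open>D \<epsilon> = A \<epsilon> - A 0\<close>. The equations for the columns
  give \<open>D \<epsilon> X \<epsilon> = - ((X \<epsilon> - X 0)' + A 0 (X \<epsilon> - X 0))\<close>, which tends to \<open>0\<close> with one derivative less than
  \<open>X \<epsilon> - X 0\<close> does. It remains to divide by \<open>X \<epsilon>\<close>. Only the inverse \<open>Z\<close> of \<open>X 0\<close> is used: it is of the order \<open>n + 1\<close>, as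
  it solves the adjoint equation \<open>Z' = Z (A 0)\<close> with \<open>Z a = 1\<close>, and from \<open>X 0 = X \<epsilon> - (X \<epsilon> - X 0)\<close> follows
  \<open>D \<epsilon> = (D \<epsilon> X \<epsilon>) Z - (D \<epsilon> (X \<epsilon> - X 0)) Z\<close>, where the last term is absorbed.
\<close>

lemma coefficients_converge:
  fixes A :: "real \<Rightarrow> real \<Rightarrow> complex ^ 'm ^ 'm"
    and Y :: "'m \<Rightarrow> real \<Rightarrow> real \<Rightarrow> complex ^ 'm"
  assumes A0: "holder_le n R (A 0)" and A: "\<forall>\<^sub>F \<epsilon> in at_right 0. \<exists>R. holder_le n R (A \<epsilon>)"
    and ode: "\<forall>\<^sub>F \<epsilon> in at_right 0. \<forall>j. ode (A \<epsilon>) (\<lambda>_. 0) (Y j \<epsilon>)"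
    and ode0: "\<And>j. ode (A 0) (\<lambda>_. 0) (Y j 0)"
    and init: "\<And>j. Y j 0 a = axis j 1"
    and van: "\<And>j. vanishes (Suc n) (\<lambda>\<epsilon> t. Y j \<epsilon> t - Y j 0 t)"
  shows "vanishes n (\<lambda>\<epsilon> t. A \<epsilon> t - A 0 t)"
proof -
  define X where "X \<epsilon> t = (\<chi> i j. Y j \<epsilon> t $ i)" for \<epsilon> t
  have mult_X: "(M ** X \<epsilon> t) $ i $ j = (M *v Y j \<epsilon> t) $ i" for M \<epsilon> t i j
    by (simp add: matrix_matrix_mult_def matrix_vector_mult_def X_def)
  define E0 where "E0 \<epsilon> t = (A \<epsilon> t - A 0 t) ** X \<epsilon> t" for \<epsilon> t
  have column: "vanishes n (\<lambda>\<epsilon> t. (A \<epsilon> t - A 0 t) *v Y j \<epsilon> t)" for j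
  proof -
    have "vanishes n (\<lambda>\<epsilon> t. A 0 t *v Y j 0 t - A \<epsilon> t *v Y j \<epsilon> t)"
    proof (rule vanishes_derivative[OF van[of j]])
      show "\<forall>\<^sub>F \<epsilon> in at_right 0. \<forall>t\<in>{a..b}. ((\<lambda>t. Y j \<epsilon> t - Y j 0 t) has_vector_derivative
          A 0 t *v Y j 0 t - A \<epsilon> t *v Y j \<epsilon> t) (at t within {a..b})"
        using ode
      proof eventually_elim
        case (elim \<epsilon>)
        show ?case
        proof
          fix t assume "t \<in> {a..b}"
          then have "(Y j \<epsilon> has_vector_derivative 0 - A \<epsilon> t *v Y j \<epsilon> t) (at t within {a..b})"
            "(Y j 0 has_vector_derivative 0 - A 0 t *v Y j 0 t) (at t within {a..b})"
            using elim ode0 unfolding ode_def by blast+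
          from has_vector_derivative_diff[OF this]
          show "((\<lambda>t. Y j \<epsilon> t - Y j 0 t) has_vector_derivative
            A 0 t *v Y j 0 t - A \<epsilon> t *v Y j \<epsilon> t) (at t within {a..b})" by simp
        qed
      qed
    qed
    moreover have "vanishes n (\<lambda>\<epsilon> t. A 0 t *v (Y j \<epsilon> t - Y j 0 t))"
      by (rule vanishes_prod_left[OF bounded_bilinear.flip[OF bounded_bilinear_matrix_vector_mult]
            vanishes_lower[OF van] A0])
    ultimately have "vanishes n (\<lambda>\<epsilon> t. - ((A 0 t *v Y j 0 t - A \<epsilon> t *v Y j \<epsilon> t) + A 0 t *v (Y j \<epsilon> t - Y j 0 t)))"
      by (intro vanishes_minus vanishes_add)
    then show ?thesis
      by (rule vanishes_cong)
        (simp add: matrix_vector_mult_diff_distrib matrix_vector_mult_diff_rdistrib)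
  qed
  have E0: "vanishes n E0"
  proof (intro vanishes_vec)
    show "vanishes n (\<lambda>\<epsilon> t. E0 \<epsilon> t $ i $ j)" for i j
      using vanishes_component[OF column[of j], of i] by (simp add: E0_def mult_X)
  qed
  have W: "vanishes n (\<lambda>\<epsilon> t. X \<epsilon> t - X 0 t)"
  proof (intro vanishes_vec)
    show "vanishes n (\<lambda>\<epsilon> t. (X \<epsilon> t - X 0 t) $ i $ j)" for i j
      using vanishes_component[OF vanishes_lower[OF van[of j]], of i] by (simp add: X_def)
  qed
  have adj: "bounded_bilinear (\<lambda>(A :: complex ^ 'm ^ 'm) Z. - (Z ** A))"
    unfolding bilinear_conv_bounded_bilinear[symmetric] bilinear_def
    by (auto intro!: linearI simp: matrix_matrix_mult_def vec_eq_iff scaleR_sum_right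
        distrib_right distrib_left sum.distrib)
  obtain Z where Z: "Z a = mat 1"
    "\<forall>t\<in>{a..b}. (Z has_vector_derivative 0 - - (Z t ** A 0 t)) (at t within {a..b})"
    using ode_exists[OF adj holder_le_continuous[OF A0], of "\<lambda>_. 0" "mat 1"] by auto
  obtain C where C: "\<forall>A f y K. holder_le n R A \<longrightarrow> holder_le n K f \<longrightarrow> norm (y a) \<le> K \<longrightarrow>
    (\<forall>t\<in>{a..b}. (y has_vector_derivative f t - - (y t ** A t :: complex ^ 'm ^ 'm)) (at t within {a..b})) \<longrightarrow>
    holder_le (Suc n) (C * K) y"
    using ode_estimate[OF adj holder_le_nonneg[OF A0], of n] by blast
  have "holder_le (Suc n) (C * norm (mat 1 :: complex ^ 'm ^ 'm)) Z"
    by (rule C[rule_format, OF A0, of _ "\<lambda>_. 0"]) (use Z in \<open>auto simp: holder_le_zero\<close>)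
  then obtain L where L: "holder_le n L Z" using holder_le_lower by blast
  \<comment> \<open>The derivative of \<open>Z t *v Y j 0 t\<close> vanishes, so this product keeps its initial value.\<close>
  have inverse: "X 0 t ** Z t = mat 1" if t: "t \<in> {a..b}" for t
  proof -
    have "Z t *v Y j 0 t = axis j 1" for j
    proof -
      have "((\<lambda>t. Z t *v Y j 0 t) has_derivative (\<lambda>h. 0)) (at s within {a..b})" if s: "s \<in> {a..b}" for s
      proof -
        have "(Z has_vector_derivative Z s ** A 0 s) (at s within {a..b})" using Z(2) s by simp
        moreover have "(Y j 0 has_vector_derivative - (A 0 s *v Y j 0 s)) (at s within {a..b})"
          using ode0[of j] s unfolding ode_def by simp
        ultimately have "((\<lambda>t. Z t *v Y j 0 t) has_vector_derivative
            Z s *v - (A 0 s *v Y j 0 s) + (Z s ** A 0 s) *v Y j 0 s) (at s within {a..b})"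
          by (rule bounded_bilinear.has_vector_derivative[OF bounded_bilinear_matrix_vector_mult])
        moreover have "Z s *v - (A 0 s *v Y j 0 s) + (Z s ** A 0 s) *v Y j 0 s = 0"
          by (simp add: matrix_vector_mul_assoc
              bounded_bilinear.minus_right[OF bounded_bilinear_matrix_vector_mult])
        ultimately show ?thesis by (simp add: has_vector_derivative_def)
      qed
      then obtain c where c: "\<And>s. s \<in> {a..b} \<Longrightarrow> Z s *v Y j 0 s = c"
        using has_derivative_zero_constant[of "{a..b}" "\<lambda>t. Z t *v Y j 0 t"] by auto
      show ?thesis using c[OF t] c[of a] ab Z(1) init by simp
    qed
    then have "Z t ** X 0 t = mat 1"
      by (simp add: vec_eq_iff mult_X mat_def axis_def)
    then show ?thesis using matrix_left_right_inverse by blast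
  qed
  have "vanishes n (\<lambda>\<epsilon> t. E0 \<epsilon> t ** Z t)"
    by (rule vanishes_prod_left[OF bounded_bilinear_matrix_matrix_mult E0 L])
  then show ?thesis
    using W L
  proof (rule vanishes_absorb)
    show "\<forall>\<^sub>F \<epsilon> in at_right 0. (\<exists>K. holder_le n K (\<lambda>t. A \<epsilon> t - A 0 t)) \<and> (\<forall>t\<in>{a..b}. A \<epsilon> t - A 0 t =
      E0 \<epsilon> t ** Z t - ((A \<epsilon> t - A 0 t) ** (X \<epsilon> t - X 0 t)) ** Z t)"
      using A
    proof eventually_elim
      case (elim \<epsilon>)
      have "A \<epsilon> t - A 0 t = E0 \<epsilon> t ** Z t - ((A \<epsilon> t - A 0 t) ** (X \<epsilon> t - X 0 t)) ** Z t"
        if "t \<in> {a..b}" for t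
      proof -
        interpret mm: bounded_bilinear "(**) :: complex ^ 'm ^ 'm \<Rightarrow> complex ^ 'm ^ 'm \<Rightarrow> complex ^ 'm ^ 'm"
          by (rule bounded_bilinear_matrix_matrix_mult)
        have "E0 \<epsilon> t ** Z t - ((A \<epsilon> t - A 0 t) ** (X \<epsilon> t - X 0 t)) ** Z t
          = ((A \<epsilon> t - A 0 t) ** X 0 t) ** Z t"
          unfolding E0_def mm.diff_left[symmetric] mm.diff_right[symmetric] by simp
        also have "\<dots> = A \<epsilon> t - A 0 t"
          using inverse[OF that] by (simp flip: matrix_mul_assoc)
        finally show ?thesis by simp
      qed
      moreover have "\<exists>K. holder_le n K (\<lambda>t. A \<epsilon> t - A 0 t)" using elim holder_le_diff A0 by blast
      ultimately show ?case by blast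
    qed
  qed
qed

text \<open>
  Continuity in the parameter in terms of \<open>holder_le\<close>, \<open>ode\<close> and \<open>vanishes\<close>. By linearity, uniqueness
  is a statement about the homogeneous equation.
\<close>

lemma solution_continuity_elim:
  fixes A :: "real \<Rightarrow> real \<Rightarrow> complex ^ 'm ^ 'm"
    and B :: "real \<Rightarrow> (real \<Rightarrow> complex ^ 'm) \<Rightarrow> complex ^ 'm"
  assumes \<epsilon>0: "0 < \<epsilon>0" and cont: "solution_continuous_in_parameter a b n \<alpha> \<epsilon>0 A B"
  obtains \<epsilon>1 where "0 < \<epsilon>1" and "\<epsilon>1 < \<epsilon>0"
    and "\<forall>\<epsilon>\<in>{0..<\<epsilon>1}. \<forall>f p. (\<exists>K. holder_le n K f) \<longrightarrow>
      (\<exists>y. (\<exists>L. holder_le (Suc n) L y) \<and> ode (A \<epsilon>) f y \<and> B \<epsilon> y = p)"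
    and "\<forall>\<epsilon>\<in>{0..<\<epsilon>1}. \<forall>y z t. (\<exists>L. holder_le (Suc n) L y) \<longrightarrow> (\<exists>L. holder_le (Suc n) L z) \<longrightarrow>
      ode (A \<epsilon>) (\<lambda>_. 0) y \<longrightarrow> ode (A \<epsilon>) (\<lambda>_. 0) z \<longrightarrow> B \<epsilon> y = B \<epsilon> z \<longrightarrow> t \<in> {a..b} \<longrightarrow> y t = z t"
    and "\<forall>f q y. (\<forall>\<epsilon>\<in>{0..<\<epsilon>0}. \<exists>K. holder_le n K (f \<epsilon>)) \<longrightarrow> vanishes n (\<lambda>\<epsilon> t. f \<epsilon> t - f 0 t) \<longrightarrow>
      (q \<longlongrightarrow> q 0) (at_right 0) \<longrightarrow>
      (\<forall>\<epsilon>\<in>{0..<\<epsilon>1}. (\<exists>L. holder_le (Suc n) L (y \<epsilon>)) \<and> ode (A \<epsilon>) (f \<epsilon>) (y \<epsilon>) \<and> B \<epsilon> (y \<epsilon>) = q \<epsilon>) \<longrightarrow>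
      vanishes (Suc n) (\<lambda>\<epsilon> t. y \<epsilon> t - y 0 t)"
proof -
  from cont obtain \<epsilon>1 where \<epsilon>1: "0 < \<epsilon>1" "\<epsilon>1 < \<epsilon>0"
    and solv: "\<forall>\<epsilon>\<in>{0..<\<epsilon>1}. \<forall>g\<in>holder_space_vec a b n \<alpha>. \<forall>p. uniquely_solvable a b n \<alpha> (A \<epsilon>) (B \<epsilon>) g p"
    and conv: "\<forall>f q y. (\<forall>\<epsilon>\<in>{0..<\<epsilon>0}. f \<epsilon> \<in> holder_space_vec a b n \<alpha>) \<and>
          holder_convergent_vec a b n \<alpha> f \<and> (q \<longlongrightarrow> q 0) (at_right 0) \<and>
          (\<forall>\<epsilon>\<in>{0..<\<epsilon>1}. bvp_solution a b n \<alpha> (A \<epsilon>) (B \<epsilon>) (f \<epsilon>) (q \<epsilon>) (y \<epsilon>))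
          \<longrightarrow> holder_convergent_vec a b (n + 1) \<alpha> y"
    unfolding solution_continuous_in_parameter_def by (elim exE conjE)
  show thesis
  proof (rule that[OF \<epsilon>1]; intro ballI allI impI)
    fix \<epsilon> :: real and f :: "real \<Rightarrow> complex ^ 'm" and p
    assume "\<epsilon> \<in> {0..<\<epsilon>1}" "\<exists>K. holder_le n K f"
    then have "uniquely_solvable a b n \<alpha> (A \<epsilon>) (B \<epsilon>) f p"
      using solv holder_space_vec_iff by blast
    then show "\<exists>y. (\<exists>L. holder_le (Suc n) L y) \<and> ode (A \<epsilon>) f y \<and> B \<epsilon> y = p"
      unfolding uniquely_solvable_def bvp_solution_iff by blast
  next
    fix \<epsilon> t :: real and y z :: "real \<Rightarrow> complex ^ 'm"
    assume \<epsilon>: "\<epsilon> \<in> {0..<\<epsilon>1}" and y: "\<exists>L. holder_le (Suc n) L y" "ode (A \<epsilon>) (\<lambda>_. 0) y"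
      and z: "\<exists>L. holder_le (Suc n) L z" "ode (A \<epsilon>) (\<lambda>_. 0) z" and B: "B \<epsilon> y = B \<epsilon> z" and t: "t \<in> {a..b}"
    have "(\<lambda>_. 0) \<in> holder_space_vec a b n \<alpha>"
      using holder_le_zero[of 0 n] unfolding holder_space_vec_iff by blast
    then have "uniquely_solvable a b n \<alpha> (A \<epsilon>) (B \<epsilon>) (\<lambda>_. 0) (B \<epsilon> z)"
      using solv \<epsilon> by blast
    then obtain x where x: "\<And>z'. bvp_solution a b n \<alpha> (A \<epsilon>) (B \<epsilon>) (\<lambda>_. 0) (B \<epsilon> z) z' \<Longrightarrow>
        \<forall>t\<in>{a..b}. z' t = x t" unfolding uniquely_solvable_def by blast
    have "y t = x t" "z t = x t"
      using x[of y] x[of z] y z B t unfolding bvp_solution_iff by auto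
    then show "y t = z t" by simp
  next
    fix f y :: "real \<Rightarrow> real \<Rightarrow> complex ^ 'm" and q
    assume f: "\<forall>\<epsilon>\<in>{0..<\<epsilon>0}. \<exists>K. holder_le n K (f \<epsilon>)" "vanishes n (\<lambda>\<epsilon> t. f \<epsilon> t - f 0 t)"
      and q: "(q \<longlongrightarrow> q 0) (at_right 0)"
      and y: "\<forall>\<epsilon>\<in>{0..<\<epsilon>1}. (\<exists>L. holder_le (Suc n) L (y \<epsilon>)) \<and> ode (A \<epsilon>) (f \<epsilon>) (y \<epsilon>) \<and> B \<epsilon> (y \<epsilon>) = q \<epsilon>"
    have mem: "\<forall>\<epsilon>\<in>{0..<\<epsilon>0}. f \<epsilon> \<in> holder_space_vec a b n \<alpha>"
      using f(1) unfolding holder_space_vec_iff .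
    have "\<forall>\<^sub>F \<epsilon> in at_right 0. f \<epsilon> \<in> holder_space_vec a b n \<alpha>"
      using \<epsilon>0 bspec[OF mem] by (rule eventually_of_interval)
    then have "holder_convergent_vec a b n \<alpha> f"
      using f(2) mem \<epsilon>0 by (simp add: holder_convergent_vec_iff)
    then have "holder_convergent_vec a b (n + 1) \<alpha> y"
      using conv mem q y unfolding bvp_solution_iff by blast
    moreover have y_mem: "y \<epsilon> \<in> holder_space_vec a b (n + 1) \<alpha>" if "\<epsilon> \<in> {0..<\<epsilon>1}" for \<epsilon>
      using y that unfolding holder_space_vec_iff Suc_eq_plus1[symmetric] by blast
    moreover have "\<forall>\<^sub>F \<epsilon> in at_right 0. y \<epsilon> \<in> holder_space_vec a b (n + 1) \<alpha>"
      using \<epsilon>1(1) y_mem by (rule eventually_of_interval)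
    ultimately show "vanishes (Suc n) (\<lambda>\<epsilon> t. y \<epsilon> t - y 0 t)"
      using \<epsilon>1(1) by (simp add: holder_convergent_vec_iff)
  qed
qed

text \<open>
  The first part is uniqueness at \<open>\<epsilon> = 0\<close>. The second part applies \<open>coefficients_converge\<close> to the solutions
  of the homogeneous equations whose boundary values are those of the fundamental system at \<open>\<epsilon> = 0\<close>.
  For the third part, let \<open>z \<epsilon>\<close> solve the equation that \<open>y\<close> solves for the parameter \<open>\<epsilon>\<close>, but with boundary
  value \<open>0\<close>. By the second part its right-hand side converges, hence so does \<open>z \<epsilon>\<close>. Now \<open>y - z \<epsilon>\<close> solves
  the homogeneous equation with the boundary value \<open>B \<epsilon> y\<close>, and its initial value converges. The linear
  maps \<open>M \<epsilon>\<close> from boundary values to initial values of such solutions converge pointwise to an injective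
  map; so they are bounded below uniformly, and the boundary values converge as well.
\<close>

lemma necessity:
  fixes A :: "real \<Rightarrow> real \<Rightarrow> complex ^ 'm ^ 'm"
    and B :: "real \<Rightarrow> (real \<Rightarrow> complex ^ 'm) \<Rightarrow> complex ^ 'm"
  assumes \<epsilon>0: "0 < \<epsilon>0" and cont: "solution_continuous_in_parameter a b n \<alpha> \<epsilon>0 A B"
    and A_hb': "\<forall>\<epsilon>\<in>{0..<\<epsilon>0}. \<exists>R. holder_le n R (A \<epsilon>)"
    and B_op': "\<forall>\<epsilon>\<in>{0..<\<epsilon>0}. bounded_operator (Suc n) (B \<epsilon>)"
  shows "holder_le (Suc n) K y \<Longrightarrow> ode (A 0) (\<lambda>_. 0) y \<Longrightarrow> B 0 y = 0 \<Longrightarrow> t \<in> {a..b} \<Longrightarrow> y t = 0"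
    and "vanishes n (\<lambda>\<epsilon> t. A \<epsilon> t - A 0 t)"
    and "holder_le (Suc n) K y \<Longrightarrow> ((\<lambda>\<epsilon>. B \<epsilon> y) \<longlongrightarrow> B 0 y) (at_right 0)"
proof -
  note A_hb = bspec[OF A_hb'] and B_op = bspec[OF B_op']
  obtain \<epsilon>1 where \<epsilon>1: "0 < \<epsilon>1" "\<epsilon>1 < \<epsilon>0"
    and solv': "\<forall>\<epsilon>\<in>{0..<\<epsilon>1}. \<forall>f p. (\<exists>K. holder_le n K f) \<longrightarrow>
      (\<exists>y. (\<exists>L. holder_le (Suc n) L y) \<and> ode (A \<epsilon>) f y \<and> B \<epsilon> y = p)"
    and uniq': "\<forall>\<epsilon>\<in>{0..<\<epsilon>1}. \<forall>y z t. (\<exists>L. holder_le (Suc n) L y) \<longrightarrow> (\<exists>L. holder_le (Suc n) L z) \<longrightarrow>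
      ode (A \<epsilon>) (\<lambda>_. 0) y \<longrightarrow> ode (A \<epsilon>) (\<lambda>_. 0) z \<longrightarrow> B \<epsilon> y = B \<epsilon> z \<longrightarrow> t \<in> {a..b} \<longrightarrow> y t = z t"
    and conv': "\<forall>f q y. (\<forall>\<epsilon>\<in>{0..<\<epsilon>0}. \<exists>K. holder_le n K (f \<epsilon>)) \<longrightarrow> vanishes n (\<lambda>\<epsilon> t. f \<epsilon> t - f 0 t) \<longrightarrow>
      (q \<longlongrightarrow> q 0) (at_right 0) \<longrightarrow>
      (\<forall>\<epsilon>\<in>{0..<\<epsilon>1}. (\<exists>L. holder_le (Suc n) L (y \<epsilon>)) \<and> ode (A \<epsilon>) (f \<epsilon>) (y \<epsilon>) \<and> B \<epsilon> (y \<epsilon>) = q \<epsilon>) \<longrightarrow>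
      vanishes (Suc n) (\<lambda>\<epsilon> t. y \<epsilon> t - y 0 t)"
    by (rule solution_continuity_elim[OF \<epsilon>0 cont]) (rule that)
  have solv: "\<exists>y. (\<exists>L. holder_le (Suc n) L y) \<and> ode (A \<epsilon>) f y \<and> B \<epsilon> y = p"
    if "\<epsilon> \<in> {0..<\<epsilon>1}" "\<exists>K. holder_le n K f" for \<epsilon> f p
    using solv' that by blast
  have uniq: "y t = z t"
    if "\<epsilon> \<in> {0..<\<epsilon>1}" "\<exists>L. holder_le (Suc n) L y" "\<exists>L. holder_le (Suc n) L z" "ode (A \<epsilon>) (\<lambda>_. 0) y"
      "ode (A \<epsilon>) (\<lambda>_. 0) z" "B \<epsilon> y = B \<epsilon> z" "t \<in> {a..b}" for \<epsilon> y z t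
    using uniq' that by blast
  have conv: "vanishes (Suc n) (\<lambda>\<epsilon> t. y \<epsilon> t - y 0 t)"
    if "\<forall>\<epsilon>\<in>{0..<\<epsilon>0}. \<exists>K. holder_le n K (f \<epsilon>)" "vanishes n (\<lambda>\<epsilon> t. f \<epsilon> t - f 0 t)" "(q \<longlongrightarrow> q 0) (at_right 0)"
      "\<forall>\<epsilon>\<in>{0..<\<epsilon>1}. (\<exists>L. holder_le (Suc n) L (y \<epsilon>)) \<and> ode (A \<epsilon>) (f \<epsilon>) (y \<epsilon>) \<and> B \<epsilon> (y \<epsilon>) = q \<epsilon>" for f q y
    using conv'[THEN spec, THEN spec, THEN spec, THEN mp, THEN mp, THEN mp, THEN mp, OF that] .
  have sub: "\<epsilon> \<in> {0..<\<epsilon>0}" if "\<epsilon> \<in> {0..<\<epsilon>1}" for \<epsilon> using that \<epsilon>1(2) by auto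
  have in1: "0 \<in> {0..<\<epsilon>1}" and in0: "0 \<in> {0..<\<epsilon>0}" using \<epsilon>1 by auto
  have zero: "holder_le n 0 (\<lambda>_. 0 :: complex ^ 'm)" by (simp add: holder_le_zero)
  have zero': "holder_le (Suc n) 0 (\<lambda>_. 0 :: complex ^ 'm)" by (simp add: holder_le_zero)
  have zero_ex: "\<exists>K. holder_le n K (\<lambda>_. 0 :: complex ^ 'm)" and zero_ex': "\<exists>K. holder_le (Suc n) K (\<lambda>_. 0 :: complex ^ 'm)"
    using zero zero' by blast+
  have ode_zero: "ode M (\<lambda>_. 0) (\<lambda>_. 0)" for M :: "real \<Rightarrow> complex ^ 'm ^ 'm"
    by (simp add: ode_def)
  have B_zero: "B \<epsilon> (\<lambda>_. 0) = 0" if "\<epsilon> \<in> {0..<\<epsilon>0}" for \<epsilon>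
    using bounded_operator_scaleR[OF B_op[OF that] zero', of 0] by simp
  obtain R where A0: "holder_le n R (A 0)" using A_hb[OF in0] by blast
  note S0 = cauchy_solution[OF A0 zero]
  define w where "w \<epsilon> v = (SOME y. (\<exists>L. holder_le (Suc n) L y) \<and> ode (A \<epsilon>) (\<lambda>_. 0) y \<and> B \<epsilon> y = v)" for \<epsilon> v
  have w: "(\<exists>L. holder_le (Suc n) L (w \<epsilon> v)) \<and> ode (A \<epsilon>) (\<lambda>_. 0) (w \<epsilon> v) \<and> B \<epsilon> (w \<epsilon> v) = v"
    if "\<epsilon> \<in> {0..<\<epsilon>1}" for \<epsilon> v
    using someI_ex[OF solv[OF that zero_ex, of v]] unfolding w_def .
  note w_hb = conjunct1[OF w] and w_ode = conjunct1[OF conjunct2[OF w]] and w_B = conjunct2[OF conjunct2[OF w]]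
  have w_conv: "vanishes (Suc n) (\<lambda>\<epsilon> t. w \<epsilon> v t - w 0 v t)" for v
    by (intro conv[of "\<lambda>_ _. 0" "\<lambda>_. v"] ballI w zero_ex tendsto_const)
      (simp add: vanishes_def holder_le_zero)
  show trivial: "y t = 0"
    if y: "holder_le (Suc n) K y" and ode: "ode (A 0) (\<lambda>_. 0) y" and By: "B 0 y = 0" and t: "t \<in> {a..b}" for K y t
  proof -
    have "B 0 y = B 0 (\<lambda>_. 0)" using By B_zero[OF in0] by simp
    moreover have "\<exists>K. holder_le (Suc n) K y" using y by blast
    ultimately show ?thesis using uniq[OF in1 _ zero_ex' ode ode_zero _ t] by blast
  qed
  show A_conv: "vanishes n (\<lambda>\<epsilon> t. A \<epsilon> t - A 0 t)"
  proof -
    \<comment> \<open>The boundary values of the fundamental system of the limiting equation.\<close>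
    define q where "q j = B 0 (cauchy_solution (A 0) (\<lambda>_. 0) (axis j 1))" for j
    show ?thesis
    proof (rule coefficients_converge[where A = A and Y = "\<lambda>j \<epsilon>. w \<epsilon> (q j)", OF A0])
      show "\<forall>\<^sub>F \<epsilon> in at_right 0. \<exists>R. holder_le n R (A \<epsilon>)"
        using \<epsilon>0 A_hb by (rule eventually_of_interval)
      show "\<forall>\<^sub>F \<epsilon> in at_right 0. \<forall>j. ode (A \<epsilon>) (\<lambda>_. 0) (w \<epsilon> (q j))"
        by (rule eventually_of_interval[OF \<epsilon>1(1)], intro allI, rule w_ode)
      show "ode (A 0) (\<lambda>_. 0) (w 0 (q j))" for j using w_ode[OF in1] .
      show "w 0 (q j) a = axis j 1" for j
      proof -
        have "B 0 (w 0 (q j)) = B 0 (cauchy_solution (A 0) (\<lambda>_. 0) (axis j 1))"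
          using w_B[OF in1] by (simp add: q_def)
        moreover have "a \<in> {a..b}" using ab by simp
        ultimately have "w 0 (q j) a = cauchy_solution (A 0) (\<lambda>_. 0) (axis j 1) a"
          by (rule uniq[OF in1 w_hb[OF in1] S0(3) w_ode[OF in1] S0(2)])
        then show ?thesis using S0(1) by simp
      qed
      show "vanishes (Suc n) (\<lambda>\<epsilon> t. w \<epsilon> (q j) t - w 0 (q j) t)" for j by (rule w_conv)
    qed
  qed
  define M where "M \<epsilon> v = w \<epsilon> v a" for \<epsilon> v
  have M_eq: "M \<epsilon> (B \<epsilon> y) = y a"
    if "\<epsilon> \<in> {0..<\<epsilon>1}" "holder_le (Suc n) L y" "ode (A \<epsilon>) (\<lambda>_. 0) y" for \<epsilon> y L
  proof -
    have "a \<in> {a..b}" using ab by simp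
    with w_B[OF that(1), of "B \<epsilon> y"] show ?thesis
      unfolding M_def using that(2)
      by (intro uniq[OF that(1) w_hb[OF that(1)] _ w_ode[OF that(1)] that(3)] exI)
  qed
  have M_lin: "linear (M \<epsilon>)" if \<epsilon>: "\<epsilon> \<in> {0..<\<epsilon>1}" for \<epsilon>
  proof (rule linearI)
    fix u v :: "complex ^ 'm" and r :: real
    obtain K where K: "holder_le (Suc n) K (w \<epsilon> u)" "ode (A \<epsilon>) (\<lambda>_. 0) (w \<epsilon> u)" "B \<epsilon> (w \<epsilon> u) = u"
      using w[OF \<epsilon>, of u] by blast
    obtain L where L: "holder_le (Suc n) L (w \<epsilon> v)" "ode (A \<epsilon>) (\<lambda>_. 0) (w \<epsilon> v)" "B \<epsilon> (w \<epsilon> v) = v"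
      using w[OF \<epsilon>, of v] by blast
    have "ode (A \<epsilon>) (\<lambda>_. 0) (\<lambda>t. w \<epsilon> u t + w \<epsilon> v t)" using ode_add[OF K(2) L(2)] by simp
    from M_eq[OF \<epsilon> holder_le_add[OF K(1) L(1)] this] show "M \<epsilon> (u + v) = M \<epsilon> u + M \<epsilon> v"
      using bounded_operator_add[OF B_op[OF sub[OF \<epsilon>]] K(1) L(1)] K(3) L(3) by (simp add: M_def)
    have "ode (A \<epsilon>) (\<lambda>_. 0) (\<lambda>t. r *\<^sub>R w \<epsilon> u t)" using ode_scaleR[OF K(2), of r] by simp
    from M_eq[OF \<epsilon> holder_le_scaleR[OF K(1)] this] show "M \<epsilon> (r *\<^sub>R u) = r *\<^sub>R M \<epsilon> u"
      using bounded_operator_scaleR[OF B_op[OF sub[OF \<epsilon>]] K(1)] K(3) by (simp add: M_def)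
  qed
  have M_lim: "((\<lambda>\<epsilon>. M \<epsilon> v) \<longlongrightarrow> M 0 v) (at_right 0)" for v
    using vanishes_tendsto[OF w_conv[of v], of a] ab
    unfolding M_def by (simp add: LIM_zero_iff)
  have M_inj: "inj (M 0)"
  proof (rule injI)
    fix u v assume "M 0 u = M 0 v"
    then have M0: "M 0 (u - v) = 0" using linear_diff[OF M_lin[OF in1]] by simp
    obtain L where L: "holder_le (Suc n) L (w 0 (u - v))" "ode (A 0) (\<lambda>_. 0) (w 0 (u - v))" "B 0 (w 0 (u - v)) = u - v"
      using w[OF in1, of "u - v"] by blast
    have "w 0 (u - v) t = 0" if "t \<in> {a..b}" for t
      using ode_unique[OF A0 L(2) ode_zero _ that] M0 by (simp add: M_def)
    then have "B 0 (w 0 (u - v)) = B 0 (\<lambda>_. 0)"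
      by (rule bounded_operator_cong[OF B_op[OF in0] L(1)])
    then show "u = v" using L(3) B_zero[OF in0] by simp
  qed
  have M_ev: "\<forall>\<^sub>F \<epsilon> in at_right 0. linear (M \<epsilon>)"
    using \<epsilon>1(1) M_lin by (rule eventually_of_interval)
  obtain k where k: "0 < k" "\<forall>\<^sub>F \<epsilon> in at_right 0. \<forall>v. k * norm v \<le> norm (M \<epsilon> v)"
    using eventually_bounded_below[of M, OF M_ev M_lin[OF in1] M_inj M_lim] by blast
  show "((\<lambda>\<epsilon>. B \<epsilon> y) \<longlongrightarrow> B 0 y) (at_right 0)" if y: "holder_le (Suc n) K y" for K y
  proof -
    obtain y' where y': "\<And>t. t \<in> {a..b} \<Longrightarrow> (y has_vector_derivative y' t) (at t within {a..b})"
      and y'_hb: "holder_le n K y'" using y by (rule holder_le_SucE) blast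
    define f where "f \<epsilon> t = y' t + A \<epsilon> t *v y t" for \<epsilon> t
    have y_low: "holder_le n (embed_const * K) y" using y by (rule holder_le_lower)
    have ode_y: "ode (A \<epsilon>) (f \<epsilon>) y" for \<epsilon>
      using y' by (simp add: ode_def f_def)
    have f_hb: "\<exists>K. holder_le n K (f \<epsilon>)" if \<epsilon>: "\<epsilon> \<in> {0..<\<epsilon>0}" for \<epsilon>
    proof -
      obtain R' where R': "holder_le n R' (A \<epsilon>)" using A_hb[OF \<epsilon>] by blast
      obtain C where "\<And>(M :: real \<Rightarrow> complex ^ 'm ^ 'm) (y :: real \<Rightarrow> complex ^ 'm) K L. holder_le n K M \<Longrightarrow> holder_le n L y \<Longrightarrow>
          holder_le n (C * K * L) (\<lambda>t. M t *v y t)"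
        using holder_le_bilinear[OF bounded_bilinear_matrix_vector_mult, of n] by blast
      from holder_le_add[OF y'_hb this[OF R' y_low]] show ?thesis unfolding f_def by blast
    qed
    define z where "z \<epsilon> = (SOME z. (\<exists>L. holder_le (Suc n) L z) \<and> ode (A \<epsilon>) (f \<epsilon>) z \<and> B \<epsilon> z = 0)" for \<epsilon>
    have z: "(\<exists>L. holder_le (Suc n) L (z \<epsilon>)) \<and> ode (A \<epsilon>) (f \<epsilon>) (z \<epsilon>) \<and> B \<epsilon> (z \<epsilon>) = 0"
      if "\<epsilon> \<in> {0..<\<epsilon>1}" for \<epsilon>
      using someI_ex[OF solv[OF that f_hb[OF sub[OF that]], of 0]] unfolding z_def .
    have "vanishes n (\<lambda>\<epsilon> t. (A \<epsilon> t - A 0 t) *v y t)"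
      by (rule vanishes_prod_left[OF bounded_bilinear_matrix_vector_mult A_conv y_low])
    then have "vanishes n (\<lambda>\<epsilon> t. f \<epsilon> t - f 0 t)"
      by (simp add: f_def matrix_vector_mult_diff_rdistrib)
    then have "vanishes (Suc n) (\<lambda>\<epsilon> t. z \<epsilon> t - z 0 t)"
      by (intro conv[of f "\<lambda>_. 0"] ballI z f_hb tendsto_const)
    from vanishes_tendsto[OF this, of a] have z_lim: "((\<lambda>\<epsilon>. z \<epsilon> a) \<longlongrightarrow> z 0 a) (at_right 0)"
      using ab by (simp add: LIM_zero_iff)
    have M_B: "M \<epsilon> (B \<epsilon> y) = y a - z \<epsilon> a" if \<epsilon>: "\<epsilon> \<in> {0..<\<epsilon>1}" for \<epsilon>
    proof -
      obtain L where L: "holder_le (Suc n) L (z \<epsilon>)" using z[OF \<epsilon>] by blast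
      have "ode (A \<epsilon>) (\<lambda>_. 0) (\<lambda>t. y t - z \<epsilon> t)"
        using ode_diff[OF ode_y, of \<epsilon> "f \<epsilon>" "z \<epsilon>"] z[OF \<epsilon>] by simp
      from M_eq[OF \<epsilon> holder_le_diff[OF y L] this] show ?thesis
        using bounded_operator_diff[OF B_op[OF sub[OF \<epsilon>]] y L] z[OF \<epsilon>] by simp
    qed
    have "((\<lambda>\<epsilon>. y a - z \<epsilon> a - M \<epsilon> (B 0 y)) \<longlongrightarrow> y a - z 0 a - M 0 (B 0 y)) (at_right 0)"
      by (intro tendsto_intros z_lim M_lim)
    then have lim: "((\<lambda>\<epsilon>. norm (y a - z \<epsilon> a - M \<epsilon> (B 0 y)) / k) \<longlongrightarrow> 0) (at_right 0)"
      using M_B[OF in1] by (intro tendsto_divide_zero tendsto_norm_zero) simp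
    have "\<forall>\<^sub>F \<epsilon> in at_right 0. \<epsilon> \<in> {0..<\<epsilon>1}" using \<epsilon>1(1) by (rule eventually_of_interval)
    with k(2) have "\<forall>\<^sub>F \<epsilon> in at_right 0. norm (B \<epsilon> y - B 0 y) \<le> norm (y a - z \<epsilon> a - M \<epsilon> (B 0 y)) / k"
    proof eventually_elim
      case (elim \<epsilon>)
      have "k * norm (B \<epsilon> y - B 0 y) \<le> norm (M \<epsilon> (B \<epsilon> y - B 0 y))" using elim(1) by blast
      also have "M \<epsilon> (B \<epsilon> y - B 0 y) = y a - z \<epsilon> a - M \<epsilon> (B 0 y)"
        using linear_diff[OF M_lin[OF elim(2)]] M_B[OF elim(2)] by simp
      finally show ?case using k(1) by (simp add: pos_le_divide_eq mult.commute)
    qed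
    from Lim_null_comparison[OF this lim] show ?thesis by (simp add: LIM_zero_iff)
  qed
qed

end

section \<open>The criterion\<close>

theorem mainTheorem1:
  fixes a b \<alpha> \<epsilon>0 :: real
    and n :: nat
    and A :: "real \<Rightarrow> real \<Rightarrow> complex ^ 'm ^ 'm"
    and B :: "real \<Rightarrow> (real \<Rightarrow> complex ^ 'm) \<Rightarrow> complex ^ 'm"
  assumes "a < b"
    and "0 \<le> \<alpha>" and "\<alpha> \<le> 1"
    and "0 < \<epsilon>0"
    and "\<And>\<epsilon>. \<epsilon> \<in> {0..<\<epsilon>0} \<Longrightarrow> A \<epsilon> \<in> holder_space_mat a b n \<alpha>"
    and "\<And>\<epsilon>. \<epsilon> \<in> {0..<\<epsilon>0} \<Longrightarrow> continuous_linear_operator a b (n + 1) \<alpha> (B \<epsilon>)"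
  shows "solution_continuous_in_parameter a b n \<alpha> \<epsilon>0 A B \<longleftrightarrow>
    (\<forall>y\<in>holder_space_vec a b (n + 1) \<alpha>.
        (\<forall>t\<in>{a..b}. L_op a b (A 0) y t = 0) \<and> B 0 y = 0 \<longrightarrow> (\<forall>t\<in>{a..b}. y t = 0)) \<and>
    holder_convergent_mat a b n \<alpha> A \<and>
    (\<forall>y\<in>holder_space_vec a b (n + 1) \<alpha>. ((\<lambda>\<epsilon>. B \<epsilon> y) \<longlongrightarrow> B 0 y) (at_right 0))"
proof -
  interpret holder_scale a b \<alpha>
    using assms(1-3) by unfold_locales
  have A_hb: "\<forall>\<epsilon>\<in>{0..<\<epsilon>0}. \<exists>R. holder_le n R (A \<epsilon>)"
    using holder_le_holder_norm_mat[OF assms(5)] by blast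
  have B_op: "\<forall>\<epsilon>\<in>{0..<\<epsilon>0}. bounded_operator (Suc n) (B \<epsilon>)"
    using continuous_linear_operator_bounded[OF assms(6)] by simp
  have space: "y \<in> holder_space_vec a b (n + 1) \<alpha> \<longleftrightarrow> (\<exists>K. holder_le (Suc n) K y)"
    for y :: "real \<Rightarrow> complex ^ 'm"
    by (simp add: holder_space_vec_iff)
  have I: "holder_convergent_mat a b n \<alpha> A \<longleftrightarrow> vanishes n (\<lambda>\<epsilon> t. A \<epsilon> t - A 0 t)"
    using eventually_of_interval[OF assms(4,5)] assms(5)[of 0] assms(4)
    by (intro holder_convergent_mat_iff) auto
  have zero: "(\<forall>y\<in>holder_space_vec a b (n + 1) \<alpha>.
        (\<forall>t\<in>{a..b}. L_op a b (A 0) y t = 0) \<and> B 0 y = 0 \<longrightarrow> (\<forall>t\<in>{a..b}. y t = 0)) \<longleftrightarrow>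
      (\<forall>y K t. holder_le (Suc n) K y \<longrightarrow> ode (A 0) (\<lambda>_. 0) y \<longrightarrow> B 0 y = 0 \<longrightarrow> t \<in> {a..b} \<longrightarrow> y t = 0)"
    unfolding Ball_def space using ode_iff_L_op[of n _ _ "A 0" "\<lambda>_. 0"] by blast
  have II: "(\<forall>y\<in>holder_space_vec a b (n + 1) \<alpha>. ((\<lambda>\<epsilon>. B \<epsilon> y) \<longlongrightarrow> B 0 y) (at_right 0)) \<longleftrightarrow>
      (\<forall>y K. holder_le (Suc n) K y \<longrightarrow> ((\<lambda>\<epsilon>. B \<epsilon> y) \<longlongrightarrow> B 0 y) (at_right 0))"
    unfolding Ball_def space by blast
  show ?thesis
    unfolding I zero II
  proof (intro iffI conjI allI impI; (elim conjE)?)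
    assume cont: "solution_continuous_in_parameter a b n \<alpha> \<epsilon>0 A B"
    note nec = necessity[OF assms(4) cont A_hb B_op]
    show "vanishes n (\<lambda>\<epsilon> t. A \<epsilon> t - A 0 t)" by (rule nec)
    show "y t = 0" if "holder_le (Suc n) K y" "ode (A 0) (\<lambda>_. 0) y" "B 0 y = 0" "t \<in> {a..b}" for y K t
      using that by (rule nec(1))
    show "((\<lambda>\<epsilon>. B \<epsilon> y) \<longlongrightarrow> B 0 y) (at_right 0)" if "holder_le (Suc n) K y" for y K
      using that by (rule nec(3))
  next
    assume trivial: "\<forall>y K t. holder_le (Suc n) K y \<longrightarrow> ode (A 0) (\<lambda>_. 0) y \<longrightarrow> B 0 y = 0 \<longrightarrow> t \<in> {a..b} \<longrightarrow> y t = 0"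
      and A: "vanishes n (\<lambda>\<epsilon> t. A \<epsilon> t - A 0 t)"
      and lim: "\<forall>y K. holder_le (Suc n) K y \<longrightarrow> ((\<lambda>\<epsilon>. B \<epsilon> y) \<longlongrightarrow> B 0 y) (at_right 0)"
    show "solution_continuous_in_parameter a b n \<alpha> \<epsilon>0 A B"
      by (rule sufficiency[OF assms(4) A_hb B_op _ A lim]) (use trivial in blast)+
  qed
qed

end
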